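(* Let $n\ge1$, $k\in\{1,\dots,n\}$, and let $\phi\in\mathrm{Val}$ be $k$-strictly monotone. (1) If $\phi$ is $1$-homogeneous, then $\rho_\phi$ is a metric on $\mathcal{K}^n_1$ and $$\overline{\Delta}_\phi(K,L)=\rho_\phi(K,L)\quad\text{for all }K,L\in\mathcal{K}^n_1,$$ where $\overline{\Delta}_\phi$ is the induced intrinsic pseudometric of $\Delta_\phi$ on $\mathcal{K}^n_1$. (2) If $n>1$ and $\phi$ is $n$-homogeneous, then $\Delta_\phi$ is a metric on $\mathcal{K}^n_n$ and $$\overline{\rho}_\phi(K,L)=\Delta_\phi(K,L)\quad\text{for all }K,L\in\mathcal{K}^n_n,$$ where $\overline{\rho}_\phi$ is the induced intrinsic pseudometric of $\rho_\phi$ on $\mathcal{K}^n_n$.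
   Context: $\mathcal{K}^n$ is the set of nonempty compact convex subsets of $\mathbb{R}^n$, with the Hausdorff distance; $\mathcal{K}^n_k$ is the subset of those with affine dimension at least $k$. A valuation is a function $\phi:\mathcal{K}^n\to\mathbb{R}$ with $\phi(K\cup L)+\phi(K\cap L)=\phi(K)+\phi(L)$ whenever $K,L,K\cup L\in\mathcal{K}^n$, with the convention $\phi(\varnothing)=0$. $\mathrm{Val}$ is the space of valuations that are continuous (for the Hausdorff distance) and translation-invariant. $\phi$ is $i$-homogeneous if $\phi(tK)=t^i\phi(K)$ for all $t\ge0$, $K\in\mathcal{K}^n$. $\phi$ is $k$-strictly monotone if $K\subsetneq L$ implies $\phi(K)<\phi(L)$ for all $K,L\in\mathcal{K}^n_k\cup\{\varnothing\}$. The meet-deviation is $\Delta_\phi(K,L)=\phi(K)+\phi(L)-2\phi(K\cap L)$, and the join-deviation is $\rho_\phi(K,L)=2\phi(K\tilde\cup L)-\phi(K)-\phi(L)$, where $K\tilde\cup L$ is the convex hull of $K\cup L$. Let $\delta:X\times X\to\mathbb{R}$ be a semimetric on a set $X$ (all metric axioms except possibly the triangle inequality). A map $\gamma:[a,b]\to X$ is piecewise metric continuous (with respect to $\delta$) if there is a partition $a=p_0<\dots<p_N=b$ such that for each $i$, $\delta$ restricted to $\gamma([p_{i-1},p_i])$ is a metric and $\gamma|_{[p_{i-1},p_i]}$ is continuous for the metric topology on $\gamma([p_{i-1},p_i])$. The length of a piece is $L(\gamma|_{[p_{i-1},p_i]})=\sup\sum_{j=1}^M\delta(\gamma(q_{j-1}),\gamma(q_j))$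 over partitions $\{q_j\}_{j=0}^M$ of $[p_{i-1},p_i]$; $\gamma$ is $\delta$-rectifiable if all these suprema are finite, and then its length is $L(\gamma)=\sum_{i=1}^N L(\gamma|_{[p_{i-1},p_i]})$ (independent of the chosen partition). When any two points of $X$ can be joined by a $\delta$-rectifiable piecewise metric continuous curve (which is the case here), the induced intrinsic pseudometric is $\overline{\delta}(x,y)=\inf L(\gamma)$, the infimum over all $\delta$-rectifiable piecewise metric continuous curves $\gamma:[a,b]\to X$ with $\gamma(a)=x$, $\gamma(b)=y$. *)

theory Defs
  imports "HOL-Analysis.Analysis"
begin

text \<open>Metrics given only on a set. The locale \<open>Metric_space\<close> asks for nonnegativity and symmetry on
  the whole type, so a distance that is only meaningful on \<open>M\<close> is set to \<open>0\<close> elsewhere first.\<close>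

definition restrict_dist :: "'a set \<Rightarrow> ('a \<Rightarrow> 'a \<Rightarrow> real) \<Rightarrow> 'a \<Rightarrow> 'a \<Rightarrow> real"
  where "restrict_dist M d = (\<lambda>x y. if x \<in> M \<and> y \<in> M then d x y else 0)"

definition metric_on :: "'a set \<Rightarrow> ('a \<Rightarrow> 'a \<Rightarrow> real) \<Rightarrow> bool"
  where "metric_on M d \<longleftrightarrow> Metric_space M (restrict_dist M d)"

definition metric_topology_on :: "'a set \<Rightarrow> ('a \<Rightarrow> 'a \<Rightarrow> real) \<Rightarrow> 'a topology"
  where "metric_topology_on M d = Metric_space.mtopology M (restrict_dist M d)"


section \<open>Convex bodies and valuations\<close>

definition convex_bodies :: "(real ^ 'n) set set"
  where "convex_bodies = {K. K \<noteq> {} \<and> compact K \<and> convex K}"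

definition convex_bodies_dim :: "nat \<Rightarrow> (real ^ 'n) set set"
  where "convex_bodies_dim k = {K \<in> convex_bodies. int k \<le> aff_dim K}"

definition hausdorff_dist :: "'a::metric_space set \<Rightarrow> 'a set \<Rightarrow> real"
  where "hausdorff_dist K L = max (SUP x\<in>K. infdist x L) (SUP y\<in>L. infdist y K)"

definition valuation :: "((real ^ 'n) set \<Rightarrow> real) \<Rightarrow> bool"
  where "valuation \<phi> \<longleftrightarrow> \<phi> {} = 0 \<and>
    (\<forall>K\<in>convex_bodies. \<forall>L\<in>convex_bodies. K \<union> L \<in> convex_bodies \<longrightarrow>
       \<phi> (K \<union> L) + \<phi> (K \<inter> L) = \<phi> K + \<phi> L)"

definition continuous_translation_invariant_valuations :: "((real ^ 'n) set \<Rightarrow> real) set" ("Val")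
  where "Val = {\<phi>. valuation \<phi> \<and>
    continuous_map (metric_topology_on convex_bodies hausdorff_dist) euclideanreal \<phi> \<and>
    (\<forall>K\<in>convex_bodies. \<forall>x. \<phi> ((+) x ` K) = \<phi> K)}"

definition homogeneous_val :: "nat \<Rightarrow> ((real ^ 'n) set \<Rightarrow> real) \<Rightarrow> bool"
  where "homogeneous_val i \<phi> \<longleftrightarrow> (\<forall>t\<ge>0. \<forall>K\<in>convex_bodies. \<phi> ((*\<^sub>R) t ` K) = t ^ i * \<phi> K)"

definition strictly_monotone_val :: "nat \<Rightarrow> ((real ^ 'n) set \<Rightarrow> real) \<Rightarrow> bool"
  where "strictly_monotone_val k \<phi> \<longleftrightarrow>
    (\<forall>K\<in>convex_bodies_dim k \<union> {{}}. \<forall>L\<in>convex_bodies_dim k \<union> {{}}. K \<subset> L \<longrightarrow> \<phi> K < \<phi> L)"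

definition meet_deviation :: "((real ^ 'n) set \<Rightarrow> real) \<Rightarrow> (real ^ 'n) set \<Rightarrow> (real ^ 'n) set \<Rightarrow> real"
  where "meet_deviation \<phi> K L = \<phi> K + \<phi> L - 2 * \<phi> (K \<inter> L)"

definition join_deviation :: "((real ^ 'n) set \<Rightarrow> real) \<Rightarrow> (real ^ 'n) set \<Rightarrow> (real ^ 'n) set \<Rightarrow> real"
  where "join_deviation \<phi> K L = 2 * \<phi> (convex hull (K \<union> L)) - \<phi> K - \<phi> L"


section \<open>Curves and the induced intrinsic pseudometric\<close>

definition partition_of_interval :: "nat \<Rightarrow> (nat \<Rightarrow> real) \<Rightarrow> real \<Rightarrow> real \<Rightarrow> bool"
  where "partition_of_interval N p a b \<longleftrightarrow> p 0 = a \<and> p N = b \<and> (\<forall>i<N. p i < p (Suc i))"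

definition metric_continuous_piece ::
    "('a \<Rightarrow> 'a \<Rightarrow> real) \<Rightarrow> (real \<Rightarrow> 'a) \<Rightarrow> real \<Rightarrow> real \<Rightarrow> bool"
  where "metric_continuous_piece \<delta> \<gamma> c d \<longleftrightarrow>
    metric_on (\<gamma> ` {c..d}) \<delta> \<and>
    continuous_map (top_of_set {c..d}) (metric_topology_on (\<gamma> ` {c..d}) \<delta>) \<gamma>"

definition polygonal_sums :: "('a \<Rightarrow> 'a \<Rightarrow> real) \<Rightarrow> (real \<Rightarrow> 'a) \<Rightarrow> real \<Rightarrow> real \<Rightarrow> real set"
  where "polygonal_sums \<delta> \<gamma> c d =
    {\<Sum>j<M. \<delta> (\<gamma> (q j)) (\<gamma> (q (Suc j))) | M q. partition_of_interval M q c d}"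

text \<open>\<open>\<gamma>\<close> is a \<open>\<delta>\<close>-rectifiable piecewise metric continuous curve on \<open>[a, b]\<close> of length \<open>l\<close>. By the
  triangle inequality on the pieces, \<open>l\<close> does not depend on the partition \<open>p\<close>.\<close>

definition has_curve_length ::
    "('a \<Rightarrow> 'a \<Rightarrow> real) \<Rightarrow> (real \<Rightarrow> 'a) \<Rightarrow> real \<Rightarrow> real \<Rightarrow> real \<Rightarrow> bool"
  where "has_curve_length \<delta> \<gamma> a b l \<longleftrightarrow>
    (\<exists>N p. partition_of_interval N p a b \<and>
       (\<forall>i<N. metric_continuous_piece \<delta> \<gamma> (p i) (p (Suc i)) \<and>
              bdd_above (polygonal_sums \<delta> \<gamma> (p i) (p (Suc i)))) \<and>
       l = (\<Sum>i<N. Sup (polygonal_sums \<delta> \<gamma> (p i) (p (Suc i)))))"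

text \<open>The infimum is taken in the extended reals, so that it is \<open>\<infinity>\<close> when \<open>x\<close> and \<open>y\<close> cannot be
  joined by a rectifiable curve; a finite value therefore includes the existence of such a curve.\<close>

definition intrinsic_dist :: "'a set \<Rightarrow> ('a \<Rightarrow> 'a \<Rightarrow> real) \<Rightarrow> 'a \<Rightarrow> 'a \<Rightarrow> ereal"
  where "intrinsic_dist X \<delta> x y =
    Inf {ereal l | l. \<exists>\<gamma> a b. a < b \<and> \<gamma> ` {a..b} \<subseteq> X \<and> \<gamma> a = x \<and> \<gamma> b = y \<and>
                          has_curve_length \<delta> \<gamma> a b l}"

end

theory Submission
  imports Defs
begin

text \<open>Both parts compare a length with a valuation \<open>\<phi>\<close> along nested families of bodies. If
  \<open>K \<subseteq> L\<close>, then both deviations of the pair are \<open>\<phi> L - \<phi> K\<close>. A monotone family of bodies is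
  therefore, for either deviation, a curve isometric to an interval, and a chain of nested bodies
  bounds the intrinsic distance from above by the total variation of \<open>\<phi>\<close> along it
  (\<open>intrinsic_dist_le_nested_chain\<close>). Lower bounds come from a metric that is locally dominated by
  the deviation: the triangle inequality along fine partitions makes it a lower bound for the
  length of every curve (\<open>intrinsic_dist_ge\<close>).

  In degree one, \<open>\<phi>\<close> is Minkowski additive. Then the inclusion
  \<open>conv (K \<union> M) + L \<subseteq> conv (K \<union> L) + conv (L \<union> M)\<close> is the triangle inequality of the join-deviation,
  and \<open>conv (K \<union> L) + (K \<inter> L) \<subseteq> K + L\<close> says that it is at most the meet-deviation when \<open>K\<close> and
  \<open>L\<close> meet. Bodies at small meet-deviation from a body of positive dimension do meet it, so
  the lower bound applies; the chain \<open>K, conv (K \<union> L), L\<close> attains it.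

  In degree \<open>n\<close>, \<open>\<phi>\<close> is a multiple of the volume, so the meet-deviation is a multiple of the volume
  of the symmetric difference, and it is at most the join-deviation because the convex hull
  contains the union. The chain \<open>K, K \<inter> L, L\<close> attains the bound when \<open>K \<inter> L\<close> has interior.
  Otherwise the bound is \<open>\<phi> K + \<phi> L\<close>, and it is approached by shrinking \<open>K\<close> and \<open>L\<close> to small copies
  and passing through the convex hull of the two copies, which is close to a segment; for \<open>n > 1\<close>
  a segment has no volume.

  Minkowski additivity is the main point. Put
  \<open>\<psi> L = \<phi> (K + L) - \<phi> K - \<phi> L\<close> for a fixed \<open>K\<close>. Additivity for segments follows from cutting
  \<open>A + [0, 2u]\<close> into two translates of \<open>A + [0, u]\<close>; it makes \<open>\<psi>\<close> bounded, since \<open>K\<close> lies in a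
  zonotope. A bounded translation invariant valuation with \<open>\<psi> (P / k) \<longrightarrow> 0\<close> vanishes on polytopes
  (\<open>polytope_zero\<close>): cut \<open>m\<close> times a polytope by the barycentric coordinates of its vertices. Each
  cut expresses a difference \<open>\<psi> (m P) - \<psi> ((m - 1) P)\<close> by a set with one more coordinate truncated
  and a set with one vertex fewer, and after all the coordinates have been truncated nothing is left for
  large \<open>m\<close>. So \<open>m \<mapsto> \<psi> (m P)\<close> is polynomial for large \<open>m\<close>, hence constant, being bounded, and
  rescaling \<open>P\<close> identifies the constant with the limit \<open>0\<close> at small copies. Continuity extends
  additivity from polytopes to all bodies.

  For the volume, halving boxes shows that \<open>\<phi>\<close> vanishes on degenerate boxes, because doubling
  \<open>n - 1\<close> sides multiplies \<open>\<phi>\<close> by at most \<open>2 ^ (n - 1)\<close> whereas homogeneity asks for \<open>2 ^ n\<close>. So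
  \<open>\<phi>\<close> is additive in each side of a box, a multiple of the volume on boxes, and the additive box
  function \<open>B \<mapsto> \<phi> (K \<inter> B)\<close> is the integral of a multiple of the indicator of \<open>K\<close>.\<close>

section \<open>The Hausdorff metric and its topology\<close>

lemma infdist_bdd_above:
  fixes K L :: "'a::metric_space set"
  assumes "compact K"
  shows "bdd_above ((\<lambda>x. infdist x L) ` K)"
  by (intro compact_imp_bounded[THEN bounded_imp_bdd_above] compact_continuous_image assms
      continuous_intros)

lemma hausdorff_dist_le_iff:
  fixes K L :: "'a::metric_space set"
  assumes "compact K" "compact L" "K \<noteq> {}" "L \<noteq> {}"
  shows "hausdorff_dist K L \<le> r \<longleftrightarrow> (\<forall>x\<in>K. infdist x L \<le> r) \<and> (\<forall>y\<in>L. infdist y K \<le> r)"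
  using assms by (simp add: hausdorff_dist_def cSUP_le_iff infdist_bdd_above)

lemma infdist_le_hausdorff_dist:
  fixes K L :: "'a::metric_space set"
  assumes "compact K" "compact L" "K \<noteq> {}" "L \<noteq> {}" "x \<in> K"
  shows "infdist x L \<le> hausdorff_dist K L"
  using hausdorff_dist_le_iff[OF assms(1-4), of "hausdorff_dist K L"] assms(5) by auto

lemma hausdorff_dist_commute: "hausdorff_dist K L = hausdorff_dist L K"
  by (simp add: hausdorff_dist_def max.commute)

lemma convex_bodiesD:
  assumes "K \<in> convex_bodies"
  shows "compact K" "convex K" "K \<noteq> {}" "closed K" "bounded K"
  using assms compact_imp_closed compact_imp_bounded by (auto simp: convex_bodies_def)

lemma metric_on_hausdorff_dist:
  "metric_on (convex_bodies :: (real ^ 'n) set set) hausdorff_dist"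
proof -
  note [dest] = convex_bodiesD
  have nonneg: "0 \<le> hausdorff_dist K L" if "K \<in> convex_bodies" "L \<in> convex_bodies"
    for K L :: "(real ^ 'n) set"
  proof -
    obtain x where x: "x \<in> K" using \<open>K \<in> convex_bodies\<close> by fast
    have "infdist x L \<le> hausdorff_dist K L"
      using that x by (intro infdist_le_hausdorff_dist) auto
    then show ?thesis using infdist_nonneg[of x L] by linarith
  qed
  have zero: "hausdorff_dist K L = 0 \<longleftrightarrow> K = L" if "K \<in> convex_bodies" "L \<in> convex_bodies"
    for K L :: "(real ^ 'n) set"
  proof -
    have "hausdorff_dist K L = 0 \<longleftrightarrow> hausdorff_dist K L \<le> 0"
      using nonneg[OF that] by linarith
    also have "\<dots> \<longleftrightarrow> (\<forall>x\<in>K. infdist x L \<le> 0) \<and> (\<forall>y\<in>L. infdist y K \<le> 0)"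
      using that by (intro hausdorff_dist_le_iff) auto
    also have "\<dots> \<longleftrightarrow> (\<forall>x\<in>K. x \<in> L) \<and> (\<forall>y\<in>L. y \<in> K)"
    proof -
      have "infdist x M \<le> 0 \<longleftrightarrow> x \<in> M" if "M \<in> convex_bodies" for x :: "real ^ 'n" and M
        using that in_closed_iff_infdist_zero[of M x] infdist_nonneg[of x M]
        by (metis convex_bodiesD(3,4) order_antisym_conv order_refl)
      then show ?thesis using that by simp
    qed
    finally show ?thesis by blast
  qed
  have triangle: "hausdorff_dist K M \<le> hausdorff_dist K L + hausdorff_dist L M"
    if "K \<in> convex_bodies" "L \<in> convex_bodies" "M \<in> convex_bodies" for K L M :: "(real ^ 'n) set"
  proof -
    have *: "infdist x M \<le> hausdorff_dist K L + hausdorff_dist L M"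
      if "x \<in> K" "K \<in> convex_bodies" and L: "L \<in> convex_bodies" and "M \<in> convex_bodies"
      for x and K L M :: "(real ^ 'n) set"
    proof -
      obtain y where y: "y \<in> L" "infdist x L = dist x y"
        using infdist_attains_inf[OF convex_bodiesD(4,3)[OF L]] by blast
      have "infdist x M \<le> infdist y M + dist x y"
        by (rule infdist_triangle)
      moreover have "infdist x L \<le> hausdorff_dist K L" "infdist y M \<le> hausdorff_dist L M"
        using that y(1) by (auto intro!: infdist_le_hausdorff_dist)
      ultimately show ?thesis using y by linarith
    qed
    have "(\<forall>x\<in>K. infdist x M \<le> hausdorff_dist K L + hausdorff_dist L M) \<and>
          (\<forall>x\<in>M. infdist x K \<le> hausdorff_dist K L + hausdorff_dist L M)"
      using *[of _ K L M] *[of _ M L K] that by (auto simp: hausdorff_dist_commute add.commute)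
    then show ?thesis
      using that by (subst hausdorff_dist_le_iff) auto
  qed
  show ?thesis
    unfolding metric_on_def Metric_space_def restrict_dist_def
    by (auto simp: nonneg zero hausdorff_dist_commute intro: triangle)
qed

lemma mball_restrict_dist:
  assumes "metric_on M d" "x \<in> M"
  shows "Metric_space.mball M (restrict_dist M d) x r = {y \<in> M. d x y < r}"
proof -
  have "Metric_space M (restrict_dist M d)" using assms(1) by (simp add: metric_on_def)
  then show ?thesis
    using assms(2) by (auto simp: Metric_space.mball_def restrict_dist_def)
qed

lemma openin_metric_topology_on:
  assumes "metric_on M d"
  shows "openin (metric_topology_on M d) U \<longleftrightarrow>
    U \<subseteq> M \<and> (\<forall>x\<in>U. \<exists>r>0. {y \<in> M. d x y < r} \<subseteq> U)"
proof -
  have "Metric_space M (restrict_dist M d)" using assms by (simp add: metric_on_def)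
  note open_iff = Metric_space.openin_mtopology[OF this, of U, folded metric_topology_on_def]
  show ?thesis
  proof (cases "U \<subseteq> M")
    case True
    then have "Metric_space.mball M (restrict_dist M d) x r = {y \<in> M. d x y < r}" if "x \<in> U" for x r
      using that mball_restrict_dist[OF assms] by (simp add: subset_iff)
    with True show ?thesis unfolding open_iff Ball_def by (simp cong: imp_cong)
  qed (simp add: open_iff)
qed

lemma topspace_metric_topology_on:
  assumes "metric_on M d"
  shows "topspace (metric_topology_on M d) = M"
  using assms by (simp add: metric_topology_on_def metric_on_def Metric_space.topspace_mtopology)

lemma openin_metric_ball:
  assumes "metric_on M d" "x \<in> M"
  shows "openin (metric_topology_on M d) {y \<in> M. d x y < r}"
  using assms Metric_space.openin_mball[of M "restrict_dist M d" x r]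
  by (simp add: mball_restrict_dist metric_topology_on_def metric_on_def)

lemma continuous_from_metric_topology_on:
  assumes "metric_on M d" and "continuous_map (metric_topology_on M d) euclideanreal f"
    and "x \<in> M" and "e > 0"
  shows "\<exists>r>0. \<forall>y\<in>M. d x y < r \<longrightarrow> \<bar>f y - f x\<bar> < e"
proof -
  have "openin (metric_topology_on M d) {y \<in> topspace (metric_topology_on M d). f y \<in> ball (f x) e}"
    using assms(2) by (rule openin_continuous_map_preimage) simp
  then have "openin (metric_topology_on M d) {y \<in> M. f y \<in> ball (f x) e}"
    by (simp only: topspace_metric_topology_on[OF assms(1)])
  moreover have "x \<in> {y \<in> M. f y \<in> ball (f x) e}" using assms(3,4) by simp
  ultimately obtain r where "r > 0" and r: "{y \<in> M. d x y < r} \<subseteq> {y \<in> M. f y \<in> ball (f x) e}"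
    unfolding openin_metric_topology_on[OF assms(1)] by blast
  have "\<bar>f y - f x\<bar> < e" if "y \<in> M" "d x y < r" for y
  proof -
    have "y \<in> {y \<in> M. f y \<in> ball (f x) e}" using r that by blast
    then show ?thesis by (simp add: dist_real_def abs_minus_commute)
  qed
  then show ?thesis using \<open>r > 0\<close> by blast
qed

lemma continuous_into_metric_topology_on:
  assumes "metric_continuous_piece d \<gamma> a b" and "t \<in> {a..b}" and "e > 0"
  shows "\<exists>r>0. \<forall>s\<in>{a..b}. \<bar>s - t\<bar> < r \<longrightarrow> d (\<gamma> t) (\<gamma> s) < e"
proof -
  let ?M = "\<gamma> ` {a..b}"
  let ?U = "{s \<in> {a..b}. \<gamma> s \<in> {y \<in> ?M. d (\<gamma> t) y < e}}"
  have metric: "metric_on ?M d"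
    and cont: "continuous_map (top_of_set {a..b}) (metric_topology_on ?M d) \<gamma>"
    using assms(1) by (auto simp: metric_continuous_piece_def)
  have t: "\<gamma> t \<in> ?M" using assms(2) by (rule imageI)
  have "d (\<gamma> t) (\<gamma> t) = 0"
    using metric t Metric_space.mdist_zero[of ?M "restrict_dist ?M d" "\<gamma> t"]
    by (simp add: metric_on_def restrict_dist_def)
  then have "t \<in> ?U" using assms(2,3) t by simp
  moreover have "openin (top_of_set {a..b}) ?U"
    using openin_continuous_map_preimage[OF cont openin_metric_ball[OF metric t]]
    by (simp only: topspace_euclidean_subtopology)
  ultimately have "\<exists>r>0. ball t r \<inter> {a..b} \<subseteq> ?U"
    by (simp only: openin_contains_ball)
  then obtain r where "r > 0" and r: "ball t r \<inter> {a..b} \<subseteq> ?U" by blast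
  have "d (\<gamma> t) (\<gamma> s) < e" if "s \<in> {a..b}" "\<bar>s - t\<bar> < r" for s
  proof -
    have "s \<in> ball t r \<inter> {a..b}" using that by (auto simp: dist_real_def)
    then have "s \<in> ?U" using r by blast
    then show ?thesis by simp
  qed
  then show ?thesis using \<open>r > 0\<close> by blast
qed

lemma metric_continuous_pieceI:
  assumes metric: "metric_on (\<gamma> ` {a..b}) d"
    and cont: "\<And>t e. t \<in> {a..b} \<Longrightarrow> e > 0 \<Longrightarrow> \<exists>r>0. \<forall>s\<in>{a..b}. \<bar>s - t\<bar> < r \<longrightarrow> d (\<gamma> t) (\<gamma> s) < e"
  shows "metric_continuous_piece d \<gamma> a b"
proof -
  let ?M = "\<gamma> ` {a..b}"
  have "continuous_map (top_of_set {a..b}) (metric_topology_on ?M d) \<gamma>"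
    unfolding continuous_map_def
  proof (intro conjI allI impI)
    show "\<gamma> \<in> topspace (top_of_set {a..b}) \<rightarrow> topspace (metric_topology_on ?M d)"
      by (auto simp: topspace_metric_topology_on[OF metric])
    fix U assume "openin (metric_topology_on ?M d) U"
    then have U: "\<And>x. x \<in> U \<Longrightarrow> \<exists>e>0. {y \<in> ?M. d x y < e} \<subseteq> U"
      by (auto simp: openin_metric_topology_on[OF metric])
    have nbhd: "\<exists>r>0. ball t r \<inter> {a..b} \<subseteq> {s \<in> {a..b}. \<gamma> s \<in> U}"
      if t: "t \<in> {a..b}" "\<gamma> t \<in> U" for t
    proof -
      obtain e where e: "e > 0" "{y \<in> ?M. d (\<gamma> t) y < e} \<subseteq> U" using U[OF t(2)] by blast
      obtain r where r: "r > 0" "\<forall>s\<in>{a..b}. \<bar>s - t\<bar> < r \<longrightarrow> d (\<gamma> t) (\<gamma> s) < e"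
        using cont[OF t(1) e(1)] by blast
      have "\<gamma> s \<in> U" if "s \<in> ball t r" "s \<in> {a..b}" for s
      proof -
        have "d (\<gamma> t) (\<gamma> s) < e" using r(2) that by (auto simp: dist_real_def abs_minus_commute)
        then show ?thesis using e(2) that(2) by blast
      qed
      then have "ball t r \<inter> {a..b} \<subseteq> {s \<in> {a..b}. \<gamma> s \<in> U}" by auto
      then show ?thesis using r(1) by blast
    qed
    show "openin (top_of_set {a..b}) {s \<in> topspace (top_of_set {a..b}). \<gamma> s \<in> U}"
      unfolding openin_contains_ball topspace_euclidean_subtopology
    proof (intro conjI ballI)
      fix t assume "t \<in> {s \<in> {a..b}. \<gamma> s \<in> U}"
      then show "\<exists>r>0. ball t r \<inter> {a..b} \<subseteq> {s \<in> {a..b}. \<gamma> s \<in> U}" by (intro nbhd) simp_all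
    qed auto
  qed
  then show ?thesis
    using metric by (simp add: metric_continuous_piece_def)
qed

text \<open>The form in which continuity of a valuation is used: a bound \<open>r\<close> on the distances of the points
  of each body from the other one bounds the Hausdorff distance.\<close>

lemma Val_tendsto:
  fixes \<phi> :: "(real ^ 'n) set \<Rightarrow> real"
  assumes "\<phi> \<in> Val" and K: "K \<in> convex_bodies"
    and "\<forall>\<^sub>F s in F. L s \<in> convex_bodies \<and>
           (\<forall>x\<in>K. \<exists>y\<in>L s. dist x y \<le> r s) \<and> (\<forall>y\<in>L s. \<exists>x\<in>K. dist y x \<le> r s)"
    and r: "(r \<longlongrightarrow> 0) F"
  shows "((\<lambda>s. \<phi> (L s)) \<longlongrightarrow> \<phi> K) F"
proof (rule tendstoI)
  fix e :: real assume "e > 0"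
  have "continuous_map (metric_topology_on convex_bodies hausdorff_dist) euclideanreal \<phi>"
    using assms(1) by (simp add: continuous_translation_invariant_valuations_def)
  from continuous_from_metric_topology_on[OF metric_on_hausdorff_dist this K \<open>e > 0\<close>]
  obtain d where d: "d > 0" "\<forall>L\<in>convex_bodies. hausdorff_dist K L < d \<longrightarrow> \<bar>\<phi> L - \<phi> K\<bar> < e"
    by blast
  have "\<forall>\<^sub>F s in F. r s < d" using order_tendstoD(2)[OF r d(1)] .
  with assms(3) show "\<forall>\<^sub>F s in F. dist (\<phi> (L s)) (\<phi> K) < e"
  proof eventually_elim
    case (elim s)
    have "hausdorff_dist K (L s) \<le> r s"
    proof (subst hausdorff_dist_le_iff)
      show "(\<forall>x\<in>K. infdist x (L s) \<le> r s) \<and> (\<forall>y\<in>L s. infdist y K \<le> r s)"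
        using elim by (meson infdist_le2)
    qed (use elim K convex_bodiesD in auto)
    then show ?case using d elim by (auto simp: dist_real_def)
  qed
qed

section \<open>Lengths of curves\<close>

lemma partition_of_interval_mono:
  assumes "partition_of_interval N p a b" "i \<le> j" "j \<le> N"
  shows "p i \<le> p j"
  using assms(2,3)
proof (induction j rule: dec_induct)
  case (step n)
  then have "p n < p (Suc n)" using assms(1) by (simp add: partition_of_interval_def)
  with step show ?case by simp
qed simp

lemma partition_of_interval_mem:
  assumes "partition_of_interval N p a b" "i \<le> N"
  shows "p i \<in> {a..b}"
  using partition_of_interval_mono[OF assms(1), of 0 i] partition_of_interval_mono[OF assms(1), of i N]
    assms by (auto simp: partition_of_interval_def)

lemma polygonal_sums_trivial: "0 \<in> polygonal_sums \<delta> \<gamma> c c"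
  unfolding polygonal_sums_def
  by (auto intro!: exI[of _ 0] exI[of _ "\<lambda>_. c"] simp: partition_of_interval_def)

lemma polygonal_sums_single:
  assumes "c < d"
  shows "\<delta> (\<gamma> c) (\<gamma> d) \<in> polygonal_sums \<delta> \<gamma> c d"
  unfolding polygonal_sums_def using assms
  by (auto intro!: exI[of _ 1] exI[of _ "\<lambda>i. if i = 0 then c else d"]
      simp: partition_of_interval_def)

lemma polygonal_sums_concat:
  assumes "v \<in> polygonal_sums \<delta> \<gamma> a b" "w \<in> polygonal_sums \<delta> \<gamma> b c"
  shows "v + w \<in> polygonal_sums \<delta> \<gamma> a c"
proof -
  obtain M p where p: "partition_of_interval M p a b"
    and v: "v = (\<Sum>j<M. \<delta> (\<gamma> (p j)) (\<gamma> (p (Suc j))))"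
    using assms(1) by (auto simp: polygonal_sums_def)
  obtain N q where q: "partition_of_interval N q b c"
    and w: "w = (\<Sum>j<N. \<delta> (\<gamma> (q j)) (\<gamma> (q (Suc j))))"
    using assms(2) by (auto simp: polygonal_sums_def)
  define r where "r = (\<lambda>j. if j \<le> M then p j else q (j - M))"
  have r_shift: "r (M + j) = q j" for j
    using p q by (auto simp: r_def partition_of_interval_def)
  have split: "(\<Sum>j<M + n. f j) = (\<Sum>j<M. f j) + (\<Sum>j<n. f (M + j))" for f :: "nat \<Rightarrow> real" and n
    by (induction n) auto
  have "partition_of_interval (M + N) r a c"
    unfolding partition_of_interval_def
  proof (intro conjI allI impI)
    show "r 0 = a" using p by (simp add: r_def partition_of_interval_def)
    show "r (M + N) = c" using q by (simp add: r_shift partition_of_interval_def)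
    fix i assume i: "i < M + N"
    show "r i < r (Suc i)"
    proof (cases "i < M")
      case True
      then show ?thesis using p by (simp add: r_def partition_of_interval_def)
    next
      case False
      then obtain j where j: "i = M + j" "j < N"
        using i by (metis add_diff_inverse_nat nat_add_left_cancel_less)
      have "r (M + j) < r (M + Suc j)"
        unfolding r_shift using q j by (simp add: partition_of_interval_def)
      then show ?thesis using j by simp
    qed
  qed
  moreover have "v + w = (\<Sum>j<M + N. \<delta> (\<gamma> (r j)) (\<gamma> (r (Suc j))))"
  proof -
    have "(\<Sum>j<N. \<delta> (\<gamma> (r (M + j))) (\<gamma> (r (Suc (M + j))))) = w"
      unfolding w using r_shift[of "Suc _"] by (simp add: r_shift)
    moreover have "(\<Sum>j<M. \<delta> (\<gamma> (r j)) (\<gamma> (r (Suc j)))) = v"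
      unfolding v by (intro sum.cong) (auto simp: r_def)
    ultimately show ?thesis by (simp add: split)
  qed
  ultimately show ?thesis unfolding polygonal_sums_def by blast
qed

text \<open>If \<open>\<delta>\<close> dominates the distance \<open>D\<close> near every point, then every point of a piece has a
  neighbourhood in which single steps of a polygonal sum dominate \<open>D\<close>. Bisection
  glues these local partitions to a partition of the whole piece, and the triangle inequality for
  \<open>D\<close> does the rest.\<close>

lemma curve_length_ge:
  assumes refl: "\<And>x. x \<in> X \<Longrightarrow> D x x = 0"
    and triangle: "\<And>x y z. \<lbrakk>x \<in> X; y \<in> X; z \<in> X\<rbrakk> \<Longrightarrow> D x z \<le> D x y + D y z"
    and locally_le: "\<And>x. x \<in> X \<Longrightarrow>
      \<exists>e>0. \<forall>y\<in>X. \<delta> x y < e \<longrightarrow> D x y \<le> \<delta> x y \<and> D y x \<le> \<delta> y x"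
    and \<gamma>: "\<gamma> ` {a..b} \<subseteq> X" and l: "has_curve_length \<delta> \<gamma> a b l"
  shows "D (\<gamma> a) (\<gamma> b) \<le> l"
proof -
  have piece: "\<exists>v \<in> polygonal_sums \<delta> \<gamma> c d. D (\<gamma> c) (\<gamma> d) \<le> v"
    if "c \<le> d" "\<gamma> ` {c..d} \<subseteq> X" and cont: "metric_continuous_piece \<delta> \<gamma> c d" for c d
  proof -
    \<comment> \<open>The bounds on \<open>s\<close> and \<open>t\<close> are part of the property because bisection quantifies over all pairs
      around a point.\<close>
    define P where "P = (\<lambda>s t. c \<le> s \<and> s \<le> t \<and> t \<le> d \<longrightarrow>
      (\<exists>v \<in> polygonal_sums \<delta> \<gamma> s t. D (\<gamma> s) (\<gamma> t) \<le> v))"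
    have in_X: "\<gamma> s \<in> X" if "s \<in> {c..d}" for s
      using that \<open>\<gamma> ` {c..d} \<subseteq> X\<close> by blast
    have P_concat: "P s u" if st: "P s t" and tu: "P t u" and "s \<le> t" "t \<le> u" for s t u
      unfolding P_def
    proof
      assume bounds: "c \<le> s \<and> s \<le> u \<and> u \<le> d"
      obtain v where v: "v \<in> polygonal_sums \<delta> \<gamma> s t" "D (\<gamma> s) (\<gamma> t) \<le> v"
        using st \<open>t \<le> u\<close> \<open>s \<le> t\<close> bounds by (auto simp: P_def)
      obtain w where w: "w \<in> polygonal_sums \<delta> \<gamma> t u" "D (\<gamma> t) (\<gamma> u) \<le> w"
        using tu \<open>t \<le> u\<close> \<open>s \<le> t\<close> bounds by (auto simp: P_def)
      have "D (\<gamma> s) (\<gamma> u) \<le> D (\<gamma> s) (\<gamma> t) + D (\<gamma> t) (\<gamma> u)"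
        using bounds \<open>t \<le> u\<close> \<open>s \<le> t\<close> by (intro triangle in_X) auto
      then show "\<exists>v \<in> polygonal_sums \<delta> \<gamma> s u. D (\<gamma> s) (\<gamma> u) \<le> v"
        using polygonal_sums_concat[OF v(1) w(1)] v(2) w(2) by (intro bexI[of _ "v + w"]) auto
    qed
    have "P c d"
      using \<open>c \<le> d\<close>
    proof (induction rule: Bolzano)
      case (trans s t u)
      then show ?case using P_concat by blast
    next
      case (local x)
      obtain e where e: "e > 0"
        "\<forall>y\<in>X. \<delta> (\<gamma> x) y < e \<longrightarrow> D (\<gamma> x) y \<le> \<delta> (\<gamma> x) y \<and> D y (\<gamma> x) \<le> \<delta> y (\<gamma> x)"
        using locally_le[OF in_X[of x]] local by auto
      obtain r where r: "r > 0" "\<forall>s\<in>{c..d}. \<bar>s - x\<bar> < r \<longrightarrow> \<delta> (\<gamma> x) (\<gamma> s) < e"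
        using continuous_into_metric_topology_on[OF cont _ e(1), of x] local by auto
      have le: "D (\<gamma> x) (\<gamma> s) \<le> \<delta> (\<gamma> x) (\<gamma> s)" "D (\<gamma> s) (\<gamma> x) \<le> \<delta> (\<gamma> s) (\<gamma> x)"
        if "s \<in> {c..d}" "\<bar>s - x\<bar> < r" for s
        using that e r in_X by blast+
      have left: "P s x" if "x - s < r" for s
        unfolding P_def
      proof
        assume s: "c \<le> s \<and> s \<le> x \<and> x \<le> d"
        show "\<exists>v \<in> polygonal_sums \<delta> \<gamma> s x. D (\<gamma> s) (\<gamma> x) \<le> v"
        proof (cases "s = x")
          case True
          then show ?thesis
            using refl[OF in_X, of x] local polygonal_sums_trivial[of \<delta> \<gamma> x] by auto
        next
          case False
          then show ?thesis
            using s that by (intro bexI[OF _ polygonal_sums_single] le) auto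
        qed
      qed
      have right: "P x s" if "s - x < r" for s
        unfolding P_def
      proof
        assume s: "c \<le> x \<and> x \<le> s \<and> s \<le> d"
        show "\<exists>v \<in> polygonal_sums \<delta> \<gamma> x s. D (\<gamma> x) (\<gamma> s) \<le> v"
        proof (cases "s = x")
          case True
          then show ?thesis
            using refl[OF in_X, of x] local polygonal_sums_trivial[of \<delta> \<gamma> x] by auto
        next
          case False
          then show ?thesis
            using s that by (intro bexI[OF _ polygonal_sums_single] le) auto
        qed
      qed
      show ?case
      proof (intro exI[of _ r] conjI allI impI)
        fix s t assume st: "s \<le> x \<and> x \<le> t \<and> t - s < r"
        have "P s x" "P x t" using st by (auto intro!: left right)
        then show "P s t" using st \<open>\<And>s t u. \<lbrakk>P s t; P t u; s \<le> t; t \<le> u\<rbrakk> \<Longrightarrow> P s u\<close> by blast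
      qed (use r in auto)
    qed
    then show ?thesis using \<open>c \<le> d\<close> by (simp add: P_def)
  qed
  from l obtain N p where p: "partition_of_interval N p a b"
    and all_pieces: "\<forall>i<N. metric_continuous_piece \<delta> \<gamma> (p i) (p (Suc i)) \<and>
              bdd_above (polygonal_sums \<delta> \<gamma> (p i) (p (Suc i)))"
    and l_eq: "l = (\<Sum>i<N. Sup (polygonal_sums \<delta> \<gamma> (p i) (p (Suc i))))"
    unfolding has_curve_length_def by (elim exE conjE)
  have pieces: "metric_continuous_piece \<delta> \<gamma> (p i) (p (Suc i))"
      "bdd_above (polygonal_sums \<delta> \<gamma> (p i) (p (Suc i)))" if "i < N" for i
    using all_pieces that by simp_all
  note mem = partition_of_interval_mem[OF p]
  have in_X: "\<gamma> (p i) \<in> X" if "i \<le> N" for i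
    using \<gamma> mem[OF that] by blast
  have "D (\<gamma> (p 0)) (\<gamma> (p i)) \<le> (\<Sum>j<i. Sup (polygonal_sums \<delta> \<gamma> (p j) (p (Suc j))))"
    if "i \<le> N" for i
    using that
  proof (induction i)
    case 0
    then show ?case using refl[OF in_X[of 0]] by simp
  next
    case (Suc i)
    have "{p i..p (Suc i)} \<subseteq> {a..b}" using mem[of i] mem[of "Suc i"] Suc.prems by auto
    then have "\<gamma> ` {p i..p (Suc i)} \<subseteq> X" using \<gamma> by blast
    moreover have "p i \<le> p (Suc i)" using partition_of_interval_mono[OF p] Suc.prems by simp
    ultimately obtain v where v: "v \<in> polygonal_sums \<delta> \<gamma> (p i) (p (Suc i))"
      "D (\<gamma> (p i)) (\<gamma> (p (Suc i))) \<le> v"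
      using piece[OF _ _ pieces(1)[of i]] Suc.prems by auto
    have "v \<le> Sup (polygonal_sums \<delta> \<gamma> (p i) (p (Suc i)))"
      using Suc.prems by (intro cSup_upper v pieces) auto
    moreover have "D (\<gamma> (p 0)) (\<gamma> (p (Suc i)))
        \<le> D (\<gamma> (p 0)) (\<gamma> (p i)) + D (\<gamma> (p i)) (\<gamma> (p (Suc i)))"
      using Suc.prems by (intro triangle in_X) auto
    ultimately show ?case using Suc v by simp
  qed
  from this[of N] show ?thesis
    using p by (simp add: l_eq partition_of_interval_def)
qed

lemma intrinsic_dist_ge:
  assumes "\<And>x. x \<in> X \<Longrightarrow> D x x = 0"
    and "\<And>x y z. \<lbrakk>x \<in> X; y \<in> X; z \<in> X\<rbrakk> \<Longrightarrow> D x z \<le> D x y + D y z"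
    and "\<And>x. x \<in> X \<Longrightarrow>
      \<exists>e>0. \<forall>y\<in>X. \<delta> x y < e \<longrightarrow> D x y \<le> \<delta> x y \<and> D y x \<le> \<delta> y x"
  shows "ereal (D x y) \<le> intrinsic_dist X \<delta> x y"
  unfolding intrinsic_dist_def
  by (rule Inf_greatest) (use curve_length_ge[of X D \<delta>, OF assms] in fastforce)

text \<open>A curve along which \<open>\<delta>\<close> is the variation of a monotone function is isometric to an interval, so
  all its polygonal sums telescope to the same value.\<close>

lemma isometric_piece:
  assumes cd: "c < d"
    and \<delta>: "\<And>s t. \<lbrakk>s \<in> {c..d}; t \<in> {c..d}\<rbrakk> \<Longrightarrow> \<delta> (\<gamma> s) (\<gamma> t) = \<bar>f (\<gamma> t) - f (\<gamma> s)\<bar>"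
    and inj: "\<And>s t. \<lbrakk>s \<in> {c..d}; t \<in> {c..d}; f (\<gamma> s) = f (\<gamma> t)\<rbrakk> \<Longrightarrow> \<gamma> s = \<gamma> t"
    and cont: "continuous_on {c..d} (\<lambda>t. f (\<gamma> t))"
    and mono: "mono_on {c..d} (\<lambda>t. f (\<gamma> t))"
  shows "metric_continuous_piece \<delta> \<gamma> c d"
    and "polygonal_sums \<delta> \<gamma> c d = {\<bar>f (\<gamma> d) - f (\<gamma> c)\<bar>}"
proof -
  have "metric_on (\<gamma> ` {c..d}) \<delta>"
    unfolding metric_on_def
  proof
    fix x y z
    show "0 \<le> restrict_dist (\<gamma> ` {c..d}) \<delta> x y"
      using \<delta> by (auto simp: restrict_dist_def)
    show "restrict_dist (\<gamma> ` {c..d}) \<delta> x y = restrict_dist (\<gamma> ` {c..d}) \<delta> y x"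
      using \<delta> by (auto simp: restrict_dist_def)
    assume "x \<in> \<gamma> ` {c..d}" "y \<in> \<gamma> ` {c..d}"
    then obtain s t where st: "x = \<gamma> s" "y = \<gamma> t" "s \<in> {c..d}" "t \<in> {c..d}" by blast
    then show "restrict_dist (\<gamma> ` {c..d}) \<delta> x y = 0 \<longleftrightarrow> x = y"
      using \<delta>[of s t] inj[of s t] by (auto simp: restrict_dist_def)
    assume "z \<in> \<gamma> ` {c..d}"
    then obtain u where "z = \<gamma> u" "u \<in> {c..d}" by blast
    then show "restrict_dist (\<gamma> ` {c..d}) \<delta> x z
        \<le> restrict_dist (\<gamma> ` {c..d}) \<delta> x y + restrict_dist (\<gamma> ` {c..d}) \<delta> y z"
      using st \<delta>[of s t] \<delta>[of t u] \<delta>[of s u] by (auto simp: restrict_dist_def)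
  qed
  then show "metric_continuous_piece \<delta> \<gamma> c d"
  proof (rule metric_continuous_pieceI)
    fix t e :: real assume t: "t \<in> {c..d}" and "e > 0"
    then obtain r where "r > 0" "\<forall>s\<in>{c..d}. dist s t < r \<longrightarrow> dist (f (\<gamma> s)) (f (\<gamma> t)) < e"
      using cont by (metis continuous_on_iff)
    then show "\<exists>r>0. \<forall>s\<in>{c..d}. \<bar>s - t\<bar> < r \<longrightarrow> \<delta> (\<gamma> t) (\<gamma> s) < e"
      using t by (intro exI[of _ r]) (auto simp: \<delta> dist_real_def)
  qed
  have sum: "v = \<bar>f (\<gamma> d) - f (\<gamma> c)\<bar>" if "v \<in> polygonal_sums \<delta> \<gamma> c d" for v
  proof -
    from that obtain M q where q: "partition_of_interval M q c d"
      and v: "v = (\<Sum>j<M. \<delta> (\<gamma> (q j)) (\<gamma> (q (Suc j))))"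
      by (auto simp: polygonal_sums_def)
    have "\<delta> (\<gamma> (q j)) (\<gamma> (q (Suc j))) = f (\<gamma> (q (Suc j))) - f (\<gamma> (q j))" if "j < M" for j
    proof -
      have "q j \<in> {c..d}" "q (Suc j) \<in> {c..d}" "q j \<le> q (Suc j)"
        using that q partition_of_interval_mem[OF q, of j] partition_of_interval_mem[OF q, of "Suc j"]
        by (auto simp: partition_of_interval_def less_imp_le)
      then show ?thesis using \<delta>[of "q j" "q (Suc j)"] mono_onD[OF mono, of "q j" "q (Suc j)"] by auto
    qed
    then have "v = (\<Sum>j<M. f (\<gamma> (q (Suc j))) - f (\<gamma> (q j)))" by (simp add: v)
    also have "\<dots> = f (\<gamma> d) - f (\<gamma> c)"
      using q by (subst sum_lessThan_telescope) (auto simp: partition_of_interval_def)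
    also have "\<dots> = \<bar>f (\<gamma> d) - f (\<gamma> c)\<bar>"
      using mono_onD[OF mono, of c d] cd by auto
    finally show ?thesis .
  qed
  show "polygonal_sums \<delta> \<gamma> c d = {\<bar>f (\<gamma> d) - f (\<gamma> c)\<bar>}"
  proof
    have a: "\<delta> (\<gamma> c) (\<gamma> d) \<in> polygonal_sums \<delta> \<gamma> c d" by (rule polygonal_sums_single[OF cd])
    show "{\<bar>f (\<gamma> d) - f (\<gamma> c)\<bar>} \<subseteq> polygonal_sums \<delta> \<gamma> c d"
      using a unfolding sum[OF a] by blast
  qed (use sum in blast)
qed

section \<open>Convex bodies and monotone valuations\<close>

lemma compact_set_plus:
  fixes A B :: "'a::real_normed_vector set"
  assumes "compact A" "compact B"
  shows "compact (A + B)"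
proof -
  have "A + B = {x + y |x y. x \<in> A \<and> y \<in> B}" by (auto simp: set_plus_def)
  then show ?thesis using compact_sums[OF assms] by simp
qed

lemma convex_bodies_set_plus:
  "A \<in> convex_bodies \<Longrightarrow> B \<in> convex_bodies \<Longrightarrow> A + B \<in> convex_bodies"
  by (auto simp: convex_bodies_def compact_set_plus convex_set_plus elim!: set_plus_elim)

lemma convex_bodies_scaling: "A \<in> convex_bodies \<Longrightarrow> (*\<^sub>R) t ` A \<in> convex_bodies"
  by (simp add: convex_bodies_def compact_scaling convex_scaling)

lemma convex_bodies_translation: "A \<in> convex_bodies \<Longrightarrow> (+) x ` A \<in> convex_bodies"
  by (simp add: convex_bodies_def compact_translation convex_translation)

lemma convex_bodies_hull_Un:
  "A \<in> convex_bodies \<Longrightarrow> B \<in> convex_bodies \<Longrightarrow> convex hull (A \<union> B) \<in> convex_bodies"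
  by (simp add: convex_bodies_def compact_convex_hull compact_Un)

lemma convex_bodies_cball: "0 \<le> r \<Longrightarrow> cball x r \<in> convex_bodies"
  by (simp add: convex_bodies_def)

lemma convex_bodies_dimD: "K \<in> convex_bodies_dim d \<Longrightarrow> K \<in> convex_bodies"
  by (simp add: convex_bodies_dim_def)

lemma convex_bodies_dim_mono:
  "K \<in> convex_bodies_dim d \<Longrightarrow> L \<in> convex_bodies \<Longrightarrow> K \<subseteq> L \<Longrightarrow> L \<in> convex_bodies_dim d"
  unfolding convex_bodies_dim_def using aff_dim_subset[of K L] by auto

lemma set_plus_cball_full_dim:
  fixes A :: "(real ^ 'n) set"
  assumes "A \<in> convex_bodies" "0 < r" "d \<le> CARD('n)"
  shows "A + cball 0 r \<in> convex_bodies_dim d"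
proof -
  obtain a where "a \<in> A" using assms convex_bodiesD by blast
  have "cball a r \<subseteq> A + cball 0 r"
  proof
    fix x assume "x \<in> cball a r"
    then have "a + (x - a) \<in> A + cball 0 r"
      using \<open>a \<in> A\<close> by (intro set_plus_intro) (auto simp: dist_norm norm_minus_commute)
    then show "x \<in> A + cball 0 r" by simp
  qed
  then have "aff_dim (cball a r) \<le> aff_dim (A + cball 0 r)" by (rule aff_dim_subset)
  moreover have "aff_dim (cball a r) = int CARD('n)" using assms by (simp add: aff_dim_cball)
  ultimately show ?thesis
    using assms convex_bodies_set_plus[OF assms(1) convex_bodies_cball[of r 0]]
    by (simp add: convex_bodies_dim_def)
qed

lemma Val_tendsto_set_plus:
  fixes \<phi> :: "(real ^ 'n) set \<Rightarrow> real"
  assumes "\<phi> \<in> Val" "A \<in> convex_bodies"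
    and "\<forall>\<^sub>F s in F. B s \<in> convex_bodies \<and> B s \<subseteq> cball 0 (r s)" and "(r \<longlongrightarrow> 0) F"
  shows "((\<lambda>s. \<phi> (A + B s)) \<longlongrightarrow> \<phi> A) F"
proof (rule Val_tendsto[OF assms(1,2) _ assms(4)])
  show "\<forall>\<^sub>F s in F. A + B s \<in> convex_bodies \<and>
    (\<forall>x\<in>A. \<exists>y\<in>A + B s. dist x y \<le> r s) \<and> (\<forall>y\<in>A + B s. \<exists>x\<in>A. dist y x \<le> r s)"
    using assms(3)
  proof eventually_elim
    case (elim s)
    then obtain b where b: "b \<in> B s" "norm b \<le> r s" using convex_bodiesD(3) by fastforce
    have "\<exists>y\<in>A + B s. dist x y \<le> r s" if "x \<in> A" for x
      using that b by (intro bexI[of _ "x + b"]) (auto simp: dist_norm)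
    moreover have "\<exists>x\<in>A. dist y x \<le> r s" if "y \<in> A + B s" for y
    proof -
      from \<open>y \<in> A + B s\<close> obtain a c where "a \<in> A" "c \<in> B s" "y = a + c" by (rule set_plus_elim)
      then show ?thesis using elim by (intro bexI[of _ a]) (auto simp: dist_norm)
    qed
    ultimately show ?case
      using elim convex_bodies_set_plus[OF assms(2)] by blast
  qed
qed

text \<open>Strict monotonicity concerns bodies of dimension at least \<open>k\<close> only. Adding a small ball makes every
  body full-dimensional, and letting the radius tend to zero leaves the weak inequality.\<close>

lemma monotone_on_convex_bodies:
  fixes \<phi> :: "(real ^ 'n) set \<Rightarrow> real"
  assumes "\<phi> \<in> Val" "strictly_monotone_val k \<phi>" "k \<le> CARD('n)"
    and A: "A \<in> convex_bodies" and B: "B \<in> convex_bodies" and "A \<subseteq> B"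
  shows "\<phi> A \<le> \<phi> B"
proof -
  have lim: "((\<lambda>s. \<phi> (C + cball 0 s)) \<longlongrightarrow> \<phi> C) (at_right 0)" if "C \<in> convex_bodies" for C
    by (rule Val_tendsto_set_plus[OF assms(1) that, where r = "\<lambda>s. s"])
      (auto intro!: eventually_mono[OF eventually_at_right_less] convex_bodies_cball)
  have "\<forall>\<^sub>F s in at_right 0. \<phi> (A + cball 0 s) \<le> \<phi> (B + cball 0 s)"
    using eventually_at_right_less[of 0]
  proof eventually_elim
    case (elim s)
    have "A + cball 0 s \<subseteq> B + cball 0 s" using assms by (intro set_plus_mono2) auto
    moreover have "A + cball 0 s \<in> convex_bodies_dim k" "B + cball 0 s \<in> convex_bodies_dim k"
      using assms elim by (auto intro: set_plus_cball_full_dim)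
    ultimately show ?case
      using assms(2) unfolding strictly_monotone_val_def
      by (cases "A + cball 0 s = B + cball 0 s") (auto simp: psubset_eq less_imp_le)
  qed
  then show ?thesis by (rule tendsto_le[OF _ lim[OF B] lim[OF A], rotated]) simp
qed

text \<open>The same thickening, compared with the empty set.\<close>

lemma nonneg_on_convex_bodies:
  fixes \<phi> :: "(real ^ 'n) set \<Rightarrow> real"
  assumes "\<phi> \<in> Val" "strictly_monotone_val k \<phi>" "k \<le> CARD('n)" and A: "A \<in> convex_bodies"
  shows "0 \<le> \<phi> A"
proof -
  have lim: "((\<lambda>s. \<phi> (A + cball 0 s)) \<longlongrightarrow> \<phi> A) (at_right 0)"
    by (rule Val_tendsto_set_plus[OF assms(1) A, where r = "\<lambda>s. s"])
      (auto intro!: eventually_mono[OF eventually_at_right_less] convex_bodies_cball)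
  have "\<forall>\<^sub>F s in at_right 0. 0 \<le> \<phi> (A + cball 0 s)"
    using eventually_at_right_less[of 0]
  proof eventually_elim
    case (elim s)
    have *: "A + cball 0 s \<in> convex_bodies_dim k" using assms elim by (intro set_plus_cball_full_dim)
    then have "{} \<subset> A + cball 0 s" using convex_bodiesD(3) convex_bodies_dimD by blast
    then have "\<phi> {} < \<phi> (A + cball 0 s)" using assms(2) * unfolding strictly_monotone_val_def by blast
    moreover have "\<phi> {} = 0"
      using assms(1) by (simp add: continuous_translation_invariant_valuations_def valuation_def)
    ultimately show ?case by simp
  qed
  then show ?thesis using tendsto_lowerbound[OF lim] by simp
qed

section \<open>Chains of nested bodies\<close>

definition minkowski_segment :: "'a::real_vector set \<Rightarrow> 'a set \<Rightarrow> real \<Rightarrow> 'a set"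
  where "minkowski_segment K L t = (*\<^sub>R) (1 - t) ` K + (*\<^sub>R) t ` L"

lemma mem_minkowski_segment:
  "z \<in> minkowski_segment K L t \<longleftrightarrow> (\<exists>x\<in>K. \<exists>y\<in>L. z = (1 - t) *\<^sub>R x + t *\<^sub>R y)"
  by (auto simp: minkowski_segment_def set_plus_def)

lemma minkowski_segment_0: "L \<noteq> {} \<Longrightarrow> minkowski_segment K L 0 = K"
  by (auto simp: mem_minkowski_segment)

lemma minkowski_segment_1: "K \<noteq> {} \<Longrightarrow> minkowski_segment K L 1 = L"
  by (auto simp: mem_minkowski_segment)

lemma minkowski_segment_reverse: "minkowski_segment L K t = minkowski_segment K L (1 - t)"
  by (auto simp: minkowski_segment_def add.commute)

lemma minkowski_segment_convex_bodies:
  "K \<in> convex_bodies \<Longrightarrow> L \<in> convex_bodies \<Longrightarrow> minkowski_segment K L t \<in> convex_bodies"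
  unfolding minkowski_segment_def by (intro convex_bodies_set_plus convex_bodies_scaling)

text \<open>With \<open>K \<subseteq> L\<close>, part of the weight can be moved from \<open>K\<close> to \<open>L\<close>: a point of \<open>K\<close> and a point of
  \<open>L\<close> are averaged to a point of \<open>L\<close>.\<close>

lemma minkowski_segment_mono:
  assumes "K \<subseteq> L" "convex L" "0 \<le> s" "s \<le> t" "t \<le> 1"
  shows "minkowski_segment K L s \<subseteq> minkowski_segment K L t"
proof
  fix z assume "z \<in> minkowski_segment K L s"
  then obtain x y where xy: "x \<in> K" "y \<in> L" "z = (1 - s) *\<^sub>R x + s *\<^sub>R y"
    by (auto simp: mem_minkowski_segment)
  show "z \<in> minkowski_segment K L t"
  proof (cases "t = 0")
    case True
    then show ?thesis using xy assms by (auto simp: mem_minkowski_segment)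
  next
    case False
    let ?w = "((t - s) / t) *\<^sub>R x + (s / t) *\<^sub>R y"
    have "?w \<in> L"
      using assms xy False by (intro convexD) (auto simp: field_simps)
    moreover have "z = (1 - t) *\<^sub>R x + t *\<^sub>R ?w"
      using False by (simp add: xy scaleR_right_distrib scaleR_left_diff_distrib)
    ultimately show ?thesis using xy by (auto simp: mem_minkowski_segment)
  qed
qed

lemma continuous_on_Val_minkowski_segment:
  fixes \<phi> :: "(real ^ 'n) set \<Rightarrow> real"
  assumes "\<phi> \<in> Val" and K: "K \<in> convex_bodies" and L: "L \<in> convex_bodies"
  shows "continuous_on S (\<lambda>t. \<phi> (minkowski_segment K L t))"
  unfolding continuous_on_def
proof
  fix t assume "t \<in> S"
  have "bounded (K \<union> L)" using K L convex_bodiesD(5) by auto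
  then obtain R where R: "\<And>x. x \<in> K \<union> L \<Longrightarrow> norm x \<le> R" by (auto simp: bounded_iff)
  have dist: "dist ((1 - s) *\<^sub>R x + s *\<^sub>R y) ((1 - t) *\<^sub>R x + t *\<^sub>R y) \<le> \<bar>s - t\<bar> * (2 * R)"
    if "x \<in> K" "y \<in> L" for s t x y
  proof -
    have "(1 - s) *\<^sub>R x + s *\<^sub>R y - ((1 - t) *\<^sub>R x + t *\<^sub>R y) = (s - t) *\<^sub>R (y - x)"
      by (simp add: algebra_simps)
    then have "dist ((1 - s) *\<^sub>R x + s *\<^sub>R y) ((1 - t) *\<^sub>R x + t *\<^sub>R y) = \<bar>s - t\<bar> * norm (y - x)"
      by (simp add: dist_norm)
    moreover have "norm (y - x) \<le> 2 * R" using norm_triangle_ineq4[of y x] R[of x] R[of y] that by auto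
    ultimately show ?thesis by (simp add: mult_left_mono)
  qed
  show "((\<lambda>s. \<phi> (minkowski_segment K L s)) \<longlongrightarrow> \<phi> (minkowski_segment K L t)) (at t within S)"
  proof (rule Val_tendsto[OF assms(1), where r = "\<lambda>s. \<bar>s - t\<bar> * (2 * R)"])
    show "((\<lambda>s. \<bar>s - t\<bar> * (2 * R)) \<longlongrightarrow> 0) (at t within S)"
      by (intro tendsto_eq_intros refl) auto
    show "\<forall>\<^sub>F s in at t within S. minkowski_segment K L s \<in> convex_bodies \<and>
       (\<forall>x\<in>minkowski_segment K L t. \<exists>y\<in>minkowski_segment K L s. dist x y \<le> \<bar>s - t\<bar> * (2 * R)) \<and>
       (\<forall>y\<in>minkowski_segment K L s. \<exists>x\<in>minkowski_segment K L t. dist y x \<le> \<bar>s - t\<bar> * (2 * R))"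
    proof (intro always_eventually allI conjI ballI minkowski_segment_convex_bodies K L)
      fix s x assume "x \<in> minkowski_segment K L t"
      then show "\<exists>y\<in>minkowski_segment K L s. dist x y \<le> \<bar>s - t\<bar> * (2 * R)"
        using dist[of _ _ t s] by (fastforce simp: mem_minkowski_segment abs_minus_commute)
    next
      fix s x assume "x \<in> minkowski_segment K L s"
      then show "\<exists>y\<in>minkowski_segment K L t. dist x y \<le> \<bar>s - t\<bar> * (2 * R)"
        using dist[of _ _ s t] by (fastforce simp: mem_minkowski_segment)
    qed
  qed (intro minkowski_segment_convex_bodies K L)
qed

text \<open>Consecutive bodies are joined by Minkowski interpolation. It is monotone for inclusion, so that on
  each piece \<open>\<delta>\<close> is the variation of \<open>\<phi>\<close>; strict monotonicity says that equal values of \<open>\<phi>\<close> on a piece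
  come from equal bodies, so that \<open>\<delta>\<close> is a metric there.\<close>

lemma intrinsic_dist_le_nested_chain:
  fixes \<phi> :: "(real ^ 'n) set \<Rightarrow> real" and Y :: "nat \<Rightarrow> (real ^ 'n) set"
  assumes Val: "\<phi> \<in> Val"
    and mono: "\<And>A B. \<lbrakk>A \<in> convex_bodies; B \<in> convex_bodies; A \<subseteq> B\<rbrakk> \<Longrightarrow> \<phi> A \<le> \<phi> B"
    and strict: "\<And>A B. \<lbrakk>A \<in> convex_bodies_dim d; B \<in> convex_bodies_dim d; A \<subset> B\<rbrakk> \<Longrightarrow> \<phi> A < \<phi> B"
    and \<delta>: "\<And>A B. \<lbrakk>A \<in> convex_bodies_dim d; B \<in> convex_bodies_dim d; A \<subseteq> B\<rbrakk>
              \<Longrightarrow> \<delta> A B = \<phi> B - \<phi> A \<and> \<delta> B A = \<phi> B - \<phi> A"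
    and Y: "\<And>i. i \<le> N \<Longrightarrow> Y i \<in> convex_bodies_dim d"
    and nested: "\<And>i. i < N \<Longrightarrow> Y i \<subseteq> Y (Suc i) \<or> Y (Suc i) \<subseteq> Y i"
    and "0 < N"
  shows "intrinsic_dist (convex_bodies_dim d) \<delta> (Y 0) (Y N)
           \<le> ereal (\<Sum>i<N. \<bar>\<phi> (Y (Suc i)) - \<phi> (Y i)\<bar>)"
proof -
  \<comment> \<open>Rounding \<open>t\<close> down through the ceiling makes a node belong to the piece on its left, so that the last
    node \<open>N\<close> does not refer to a body beyond the chain.\<close>
  define \<gamma> where "\<gamma> t = (let n = nat (\<lceil>t\<rceil> - 1)
    in minkowski_segment (Y n) (Y (Suc n)) (t - real n))" for t :: real
  have Y_bodies: "Y i \<in> convex_bodies" if "i \<le> N" for i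
    using Y[OF that] by (rule convex_bodies_dimD)
  have \<gamma>_piece: "\<gamma> t = minkowski_segment (Y i) (Y (Suc i)) (t - real i)"
    if "i < N" "t \<in> {real i..real (Suc i)}" for i t
  proof (cases "t = real i")
    case False
    then have "\<lceil>t\<rceil> = int i + 1" using that by (intro ceiling_unique) auto
    then show ?thesis by (simp add: \<gamma>_def)
  next
    case t: True
    show ?thesis
    proof (cases i)
      case 0
      then show ?thesis using t by (simp add: \<gamma>_def)
    next
      case (Suc j)
      have "\<lceil>t\<rceil> = int j + 1" using t Suc by (intro ceiling_unique) auto
      then have "\<gamma> t = minkowski_segment (Y j) (Y i) 1" using t Suc by (simp add: \<gamma>_def)
      also have "\<dots> = Y i"
        using that Suc Y_bodies[of j] convex_bodiesD(3) by (intro minkowski_segment_1) auto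
      also have "\<dots> = minkowski_segment (Y i) (Y (Suc i)) 0"
        using that Y_bodies[of "Suc i"] convex_bodiesD(3) by (subst minkowski_segment_0) auto
      finally show ?thesis using t by simp
    qed
  qed
  have \<gamma>_nat: "\<gamma> (real i) = Y i" if "i \<le> N" for i
  proof (cases "i < N")
    case True
    then show ?thesis
      using \<gamma>_piece[OF True, of "real i"] convex_bodiesD(3)[OF Y_bodies[of "Suc i"]]
      by (simp add: minkowski_segment_0)
  next
    case False
    then obtain j where j: "i = Suc j" "j < N" using \<open>i \<le> N\<close> \<open>0 < N\<close> by (cases i) auto
    then show ?thesis
      using \<gamma>_piece[OF j(2), of "real i"] convex_bodiesD(3)[OF Y_bodies[of j]]
      by (simp add: minkowski_segment_1)
  qed
  have piece: "metric_continuous_piece \<delta> \<gamma> (real i) (real (Suc i))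
      \<and> polygonal_sums \<delta> \<gamma> (real i) (real (Suc i)) = {\<bar>\<phi> (Y (Suc i)) - \<phi> (Y i)\<bar>}
      \<and> \<gamma> ` {real i..real (Suc i)} \<subseteq> convex_bodies_dim d" if i: "i < N" for i
  proof -
    let ?I = "{real i..real (Suc i)}"
    have bodies: "Y i \<in> convex_bodies" "Y (Suc i) \<in> convex_bodies" using i Y_bodies by auto
    have chain: "(\<forall>s\<in>?I. \<forall>t\<in>?I. s \<le> t \<longrightarrow> \<gamma> s \<subseteq> \<gamma> t) \<or> (\<forall>s\<in>?I. \<forall>t\<in>?I. s \<le> t \<longrightarrow> \<gamma> t \<subseteq> \<gamma> s)"
      using nested[OF i]
    proof
      assume "Y i \<subseteq> Y (Suc i)"
      then have "\<forall>s\<in>?I. \<forall>t\<in>?I. s \<le> t \<longrightarrow> \<gamma> s \<subseteq> \<gamma> t"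
        using convex_bodiesD(2)[OF bodies(2)]
        by (intro ballI impI) (simp add: \<gamma>_piece[OF i] minkowski_segment_mono)
      then show ?thesis by blast
    next
      assume "Y (Suc i) \<subseteq> Y i"
      then have "\<forall>s\<in>?I. \<forall>t\<in>?I. s \<le> t \<longrightarrow> \<gamma> t \<subseteq> \<gamma> s"
        using convex_bodiesD(2)[OF bodies(1)]
        by (intro ballI impI)
          (simp add: \<gamma>_piece[OF i] minkowski_segment_reverse[of "Y i"] minkowski_segment_mono)
      then show ?thesis by blast
    qed
    have in_bodies: "\<gamma> t \<in> convex_bodies" if "t \<in> ?I" for t
      using \<gamma>_piece[OF i that] minkowski_segment_convex_bodies bodies by metis
    have in_X: "\<gamma> t \<in> convex_bodies_dim d" if t: "t \<in> ?I" for t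
    proof -
      have ends: "real i \<in> ?I" "real (Suc i) \<in> ?I" by auto
      have "Y i \<subseteq> \<gamma> t \<or> Y (Suc i) \<subseteq> \<gamma> t"
        using chain
      proof
        assume "\<forall>s\<in>?I. \<forall>t\<in>?I. s \<le> t \<longrightarrow> \<gamma> s \<subseteq> \<gamma> t"
        then have "\<gamma> (real i) \<subseteq> \<gamma> t" using t ends by auto
        then show ?thesis using \<gamma>_nat[of i] i by simp
      next
        assume "\<forall>s\<in>?I. \<forall>t\<in>?I. s \<le> t \<longrightarrow> \<gamma> t \<subseteq> \<gamma> s"
        then have "\<gamma> (real (Suc i)) \<subseteq> \<gamma> t" using t ends by auto
        then show ?thesis using \<gamma>_nat[of "Suc i"] i by simp
      qed
      then show ?thesis
        using convex_bodies_dim_mono[OF _ in_bodies[OF t]] Y[of i] Y[of "Suc i"] i by auto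
    qed
    have comparable: "\<gamma> s \<subseteq> \<gamma> t \<or> \<gamma> t \<subseteq> \<gamma> s" if "s \<in> ?I" "t \<in> ?I" for s t
      using chain that by (metis linear)
    have isometric: "\<delta> (\<gamma> s) (\<gamma> t) = \<bar>\<phi> (\<gamma> t) - \<phi> (\<gamma> s)\<bar>" if "s \<in> ?I" "t \<in> ?I" for s t
      using comparable[OF that] \<delta>[OF in_X[OF that(1)] in_X[OF that(2)]]
        \<delta>[OF in_X[OF that(2)] in_X[OF that(1)]] mono in_bodies[OF that(1)] in_bodies[OF that(2)]
      by fastforce
    have inj: "\<gamma> s = \<gamma> t" if "s \<in> ?I" "t \<in> ?I" "\<phi> (\<gamma> s) = \<phi> (\<gamma> t)" for s t
      using comparable[OF that(1,2)] strict[OF in_X[OF that(1)] in_X[OF that(2)]]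
        strict[OF in_X[OF that(2)] in_X[OF that(1)]] that(3) by (auto simp: psubset_eq)
    have cont: "continuous_on ?I (\<lambda>t. \<phi> (\<gamma> t))"
    proof -
      have "continuous_on ?I (\<lambda>t. \<phi> (minkowski_segment (Y i) (Y (Suc i)) (t - real i)))"
        by (rule continuous_on_compose2[OF continuous_on_Val_minkowski_segment[OF Val bodies]])
          (auto intro!: continuous_intros)
      then show ?thesis by (rule continuous_on_eq) (simp add: \<gamma>_piece[OF i])
    qed
    have lt: "real i < real (Suc i)" by simp
    have "metric_continuous_piece \<delta> \<gamma> (real i) (real (Suc i))
      \<and> polygonal_sums \<delta> \<gamma> (real i) (real (Suc i)) = {\<bar>\<phi> (\<gamma> (real (Suc i))) - \<phi> (\<gamma> (real i))\<bar>}"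
      using chain
    proof
      assume "\<forall>s\<in>?I. \<forall>t\<in>?I. s \<le> t \<longrightarrow> \<gamma> s \<subseteq> \<gamma> t"
      then have "mono_on ?I (\<lambda>t. \<phi> (\<gamma> t))" by (intro mono_onI mono in_bodies) auto
      from isometric_piece[where f = \<phi>, OF lt isometric inj cont this]
      show ?thesis by (rule conjI)
    next
      assume "\<forall>s\<in>?I. \<forall>t\<in>?I. s \<le> t \<longrightarrow> \<gamma> t \<subseteq> \<gamma> s"
      then have "mono_on ?I (\<lambda>t. - \<phi> (\<gamma> t))" by (intro mono_onI le_imp_neg_le mono in_bodies) auto
      moreover have "continuous_on ?I (\<lambda>t. - \<phi> (\<gamma> t))" using cont by (rule continuous_on_minus)
      moreover have "\<delta> (\<gamma> s) (\<gamma> t) = \<bar>- \<phi> (\<gamma> t) - - \<phi> (\<gamma> s)\<bar>" if "s \<in> ?I" "t \<in> ?I" for s t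
        using isometric[OF that] by simp
      ultimately have "metric_continuous_piece \<delta> \<gamma> (real i) (real (Suc i))"
        "polygonal_sums \<delta> \<gamma> (real i) (real (Suc i))
          = {\<bar>- \<phi> (\<gamma> (real (Suc i))) - - \<phi> (\<gamma> (real i))\<bar>}"
        using isometric_piece[where f = "\<lambda>A. - \<phi> A" and c = "real i" and d = "real (Suc i)"
            and \<gamma> = \<gamma> and \<delta> = \<delta>] lt inj neg_equal_iff_equal by blast+
      then show ?thesis by (simp add: abs_minus_commute)
    qed
    then show ?thesis using in_X \<gamma>_nat[of i] \<gamma>_nat[of "Suc i"] i by auto
  qed
  have "partition_of_interval N real 0 (real N)" by (simp add: partition_of_interval_def)
  then have length: "has_curve_length \<delta> \<gamma> 0 (real N) (\<Sum>i<N. \<bar>\<phi> (Y (Suc i)) - \<phi> (Y i)\<bar>)"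
    unfolding has_curve_length_def using piece by (intro exI[of _ N] exI[of _ real]) auto
  have range: "\<gamma> ` {0..real N} \<subseteq> convex_bodies_dim d"
  proof
    fix A assume "A \<in> \<gamma> ` {0..real N}"
    then obtain t where t: "0 \<le> t" "t \<le> real N" "A = \<gamma> t" by auto
    show "A \<in> convex_bodies_dim d"
    proof (cases "t = real N")
      case True
      then show ?thesis using t Y \<gamma>_nat by simp
    next
      case False
      have i: "nat \<lfloor>t\<rfloor> < N" using t False by linarith
      have "t \<in> {real (nat \<lfloor>t\<rfloor>)..real (Suc (nat \<lfloor>t\<rfloor>))}" using t by (auto; linarith)
      then show ?thesis using piece[OF i] t by blast
    qed
  qed
  show ?thesis
    unfolding intrinsic_dist_def
  proof (rule Inf_lower, rule CollectI, rule exI, rule conjI[OF refl],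
      rule exI[of _ \<gamma>], rule exI[of _ 0], rule exI[of _ "real N"], intro conjI)
    show "\<gamma> 0 = Y 0" using \<gamma>_nat[of 0] by simp
  qed (use length range \<gamma>_nat[of N] \<open>0 < N\<close> in auto)
qed

section \<open>Bounded translation invariant valuations\<close>

text \<open>For \<open>S = {}\<close> this is the polytope \<open>m * conv (p ` V)\<close>; the set \<open>S\<close> lists the vertices
  whose weight is truncated at 1. The points \<open>p i\<close> may be dependent or coincide, so that every
  polytope is covered without a triangulation.\<close>

definition weighted_sums :: "('i \<Rightarrow> 'a::real_vector) \<Rightarrow> 'i set \<Rightarrow> 'i set \<Rightarrow> real \<Rightarrow> 'a set"
  where "weighted_sums p V S m = {\<Sum>i\<in>V. l i *\<^sub>R p i | l.
    (\<forall>i\<in>V. 0 \<le> l i) \<and> (\<Sum>i\<in>V. l i) = m \<and> (\<forall>i\<in>S. l i \<le> 1)}"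

definition zonotope :: "('i \<Rightarrow> 'a::real_vector) \<Rightarrow> ('i \<Rightarrow> real) \<Rightarrow> 'i set \<Rightarrow> 'a set"
  where "zonotope q c V = {\<Sum>i\<in>V. l i *\<^sub>R q i | l. \<forall>i\<in>V. 0 \<le> l i \<and> l i \<le> c i}"

lemma zonotope_empty [simp]: "zonotope q c {} = {0}"
  by (simp add: zonotope_def)

lemma zonotope_insert:
  assumes "finite V" "j \<notin> V"
  shows "zonotope q c (insert j V) = (\<lambda>t. t *\<^sub>R q j) ` {0..c j} + zonotope q c V"
    (is "?L = ?R")
proof (intro equalityI subsetI)
  fix x assume "x \<in> ?L"
  then obtain l where l: "x = (\<Sum>i\<in>insert j V. l i *\<^sub>R q i)"
    "\<forall>i\<in>insert j V. 0 \<le> l i \<and> l i \<le> c i" unfolding zonotope_def by blast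
  have "l j *\<^sub>R q j + (\<Sum>i\<in>V. l i *\<^sub>R q i) \<in> ?R"
    unfolding zonotope_def using l by (intro set_plus_intro) auto
  then show "x \<in> ?R" using l assms by simp
next
  fix x assume "x \<in> ?R"
  then obtain y z where yz: "y \<in> (\<lambda>t. t *\<^sub>R q j) ` {0..c j}" "z \<in> zonotope q c V" "x = y + z"
    by (rule set_plus_elim)
  from yz(1) obtain t where "y = t *\<^sub>R q j" "t \<in> {0..c j}" by (rule imageE)
  then have t: "y = t *\<^sub>R q j" "0 \<le> t" "t \<le> c j" by auto
  obtain l where l: "z = (\<Sum>i\<in>V. l i *\<^sub>R q i)" "\<forall>i\<in>V. 0 \<le> l i \<and> l i \<le> c i"
    using yz(2) unfolding zonotope_def by blast
  have "z = (\<Sum>i\<in>V. (l(j := t)) i *\<^sub>R q i)"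
    using assms l by (auto intro!: sum.cong)
  then have "x = (\<Sum>i\<in>insert j V. (l(j := t)) i *\<^sub>R q i)"
    using assms t yz by (simp add: sum.insert)
  moreover have "\<forall>i\<in>insert j V. 0 \<le> (l(j := t)) i \<and> (l(j := t)) i \<le> c i"
    using l t by auto
  ultimately show "x \<in> ?L" unfolding zonotope_def by blast
qed

lemma compact_zonotope:
  fixes q :: "'i \<Rightarrow> 'a::real_normed_vector"
  assumes "finite V"
  shows "compact (zonotope q c V)"
  using assms
proof (induction V)
  case (insert j V)
  have "compact ((\<lambda>t. t *\<^sub>R q j) ` {0..c j})"
    by (intro compact_continuous_image continuous_intros) auto
  then show ?case
    using insert by (simp add: zonotope_insert compact_set_plus)
qed simp

text \<open>The pair of the weighted sum and the total weight runs through a zonotope one dimension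
  higher, and fixing the total weight takes a closed slice of it.\<close>

lemma compact_weighted_sums:
  fixes p :: "'i \<Rightarrow> 'a::euclidean_space"
  assumes "finite V" "S \<subseteq> V"
  shows "compact (weighted_sums p V S m)"
proof -
  define q where "q = (\<lambda>i. (p i, 1 :: real))"
  define c where "c = (\<lambda>i. if i \<in> S then 1 else m)"
  let ?Z = "zonotope q c V"
  have q_sum: "(\<Sum>i\<in>V. l i *\<^sub>R q i) = (\<Sum>i\<in>V. l i *\<^sub>R p i, \<Sum>i\<in>V. l i)" for l
    by (simp add: q_def prod_eq_iff fst_sum snd_sum)
  have "weighted_sums p V S m = fst ` (?Z \<inter> {z. snd z = m})"
  proof (intro equalityI subsetI)
    fix x assume "x \<in> weighted_sums p V S m"
    then obtain l where l: "x = (\<Sum>i\<in>V. l i *\<^sub>R p i)" "\<forall>i\<in>V. 0 \<le> l i" "(\<Sum>i\<in>V. l i) = m"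
      "\<forall>i\<in>S. l i \<le> 1" unfolding weighted_sums_def by blast
    have "l i \<le> m" if "i \<in> V" for i
      using member_le_sum[of i V l] l that assms(1) by auto
    then have "\<forall>i\<in>V. 0 \<le> l i \<and> l i \<le> c i" using l by (auto simp: c_def)
    then have "(x, m) \<in> ?Z" using l q_sum[of l] unfolding zonotope_def by (intro CollectI exI[of _ l]) auto
    then have "(x, m) \<in> ?Z \<inter> {z. snd z = m}" by (rule IntI) simp
    then have "fst (x, m) \<in> fst ` (?Z \<inter> {z. snd z = m})" by (rule imageI)
    then show "x \<in> fst ` (?Z \<inter> {z. snd z = m})" by (simp only: fst_conv)
  next
    fix x assume "x \<in> fst ` (?Z \<inter> {z. snd z = m})"
    then obtain l where l: "x = fst (\<Sum>i\<in>V. l i *\<^sub>R q i)" "snd (\<Sum>i\<in>V. l i *\<^sub>R q i) = m"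
      "\<forall>i\<in>V. 0 \<le> l i \<and> l i \<le> c i" unfolding zonotope_def by auto
    have "\<forall>i\<in>S. l i \<le> 1" using l(3) assms(2) by (auto simp: c_def dest!: bspec)
    then show "x \<in> weighted_sums p V S m"
      unfolding weighted_sums_def using l q_sum[of l] by auto
  qed
  moreover have "closed {z :: 'a \<times> real. snd z = m}"
    by (intro closed_Collect_eq continuous_intros)
  ultimately show ?thesis
    using compact_zonotope[OF assms(1)] 
    by (auto intro!: compact_continuous_image compact_Int_closed continuous_intros)
qed

lemma convex_weighted_sums: "S \<subseteq> V \<Longrightarrow> convex (weighted_sums p V S m)"
proof (rule convexI)
  fix x y u v assume S: "S \<subseteq> V" and x: "x \<in> weighted_sums p V S m"
    and y: "y \<in> weighted_sums p V S m" and uv: "0 \<le> u" "0 \<le> v" "u + v = (1::real)"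
  from x obtain l where l: "x = (\<Sum>i\<in>V. l i *\<^sub>R p i)" "\<forall>i\<in>V. 0 \<le> l i" "(\<Sum>i\<in>V. l i) = m"
    "\<forall>i\<in>S. l i \<le> 1" unfolding weighted_sums_def by blast
  from y obtain k where k: "y = (\<Sum>i\<in>V. k i *\<^sub>R p i)" "\<forall>i\<in>V. 0 \<le> k i" "(\<Sum>i\<in>V. k i) = m"
    "\<forall>i\<in>S. k i \<le> 1" unfolding weighted_sums_def by blast
  let ?h = "\<lambda>i. u * l i + v * k i"
  have "u *\<^sub>R x + v *\<^sub>R y = (\<Sum>i\<in>V. ?h i *\<^sub>R p i)"
    by (simp add: l k scaleR_sum_right scaleR_left_distrib sum.distrib)
  moreover have "(\<Sum>i\<in>V. ?h i) = m"
  proof -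
    have "(\<Sum>i\<in>V. ?h i) = (u + v) * m"
      by (simp add: sum.distrib sum_distrib_left[symmetric] l k distrib_right)
    then show ?thesis using uv by simp
  qed
  moreover have "\<forall>i\<in>V. 0 \<le> ?h i" using l k uv by auto
  moreover have "\<forall>i\<in>S. ?h i \<le> 1"
    using l k uv convex_bound_le[of _ 1 _ u v] by auto
  ultimately show "u *\<^sub>R x + v *\<^sub>R y \<in> weighted_sums p V S m"
    unfolding weighted_sums_def by (intro CollectI exI[of _ ?h]) simp
qed

lemma weighted_sums_shift:
  assumes "finite V" "j \<in> V" "j \<notin> S"
  shows "(+) (p j) ` weighted_sums p V S (m - 1) = {\<Sum>i\<in>V. l i *\<^sub>R p i | l.
    (\<forall>i\<in>V. 0 \<le> l i) \<and> (\<Sum>i\<in>V. l i) = m \<and> (\<forall>i\<in>S. l i \<le> 1) \<and> 1 \<le> l j}" (is "?L = ?R")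
proof (intro equalityI subsetI)
  fix x assume "x \<in> ?L"
  then obtain l where l: "x = p j + (\<Sum>i\<in>V. l i *\<^sub>R p i)" "\<forall>i\<in>V. 0 \<le> l i" "(\<Sum>i\<in>V. l i) = m - 1"
    "\<forall>i\<in>S. l i \<le> 1" unfolding weighted_sums_def by blast
  let ?h = "l(j := l j + 1)"
  have "x = (\<Sum>i\<in>V. ?h i *\<^sub>R p i)" "(\<Sum>i\<in>V. ?h i) = m"
    using l assms by (simp_all add: sum.remove[of V j] algebra_simps)
  then show "x \<in> ?R" using l assms by (intro CollectI exI[of _ ?h]) auto
next
  fix x assume "x \<in> ?R"
  then obtain l where l: "x = (\<Sum>i\<in>V. l i *\<^sub>R p i)" "\<forall>i\<in>V. 0 \<le> l i" "(\<Sum>i\<in>V. l i) = m"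
    "\<forall>i\<in>S. l i \<le> 1" "1 \<le> l j" by blast
  let ?h = "l(j := l j - 1)"
  have "x = p j + (\<Sum>i\<in>V. ?h i *\<^sub>R p i)" "(\<Sum>i\<in>V. ?h i) = m - 1"
    using l assms by (simp_all add: sum.remove[of V j] algebra_simps)
  moreover have "\<forall>i\<in>V. 0 \<le> ?h i" "\<forall>i\<in>S. ?h i \<le> 1" using l assms by auto
  ultimately show "x \<in> ?L"
    unfolding weighted_sums_def by (intro image_eqI[of _ _ "\<Sum>i\<in>V. ?h i *\<^sub>R p i"]) auto
qed

text \<open>The polytope is cut along the locus where \<open>p j\<close> has weight 1. The part with
  larger weight is a translate of the set for total weight \<open>m - 1\<close>.\<close>

lemma weighted_sums_cut_Un:
  assumes "finite V" "j \<in> V" "j \<notin> S"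
  shows "weighted_sums p V (insert j S) m \<union> (+) (p j) ` weighted_sums p V S (m - 1)
    = weighted_sums p V S m"
proof -
  have "l j \<le> 1 \<or> 1 \<le> l j" for l :: "_ \<Rightarrow> real" by linarith
  then show ?thesis
    unfolding weighted_sums_shift[OF assms] unfolding weighted_sums_def by blast
qed

text \<open>Weights are not determined by the point, so a point of both parts may have one representation with
  weight of \<open>p j\<close> below 1 and another one above 1. A convex combination of the two has weight exactly 1.\<close>

lemma weighted_sums_cut_Int:
  assumes "finite V" "j \<in> V" "j \<notin> S" "S \<subseteq> V"
  shows "weighted_sums p V (insert j S) m \<inter> (+) (p j) ` weighted_sums p V S (m - 1)
    = (+) (p j) ` weighted_sums p (V - {j}) S (m - 1)"
proof (intro equalityI subsetI)
  fix x assume x: "x \<in> weighted_sums p V (insert j S) m \<inter> (+) (p j) ` weighted_sums p V S (m - 1)"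
  then obtain l where l: "x = (\<Sum>i\<in>V. l i *\<^sub>R p i)" "\<forall>i\<in>V. 0 \<le> l i" "(\<Sum>i\<in>V. l i) = m"
    "\<forall>i\<in>insert j S. l i \<le> 1" unfolding weighted_sums_def by blast
  from x obtain k where k: "x = (\<Sum>i\<in>V. k i *\<^sub>R p i)" "\<forall>i\<in>V. 0 \<le> k i" "(\<Sum>i\<in>V. k i) = m"
    "\<forall>i\<in>S. k i \<le> 1" "1 \<le> k j" unfolding weighted_sums_shift[OF assms(1-3)] by blast
  \<comment> \<open>The two representations are mixed so that the weight of \<open>p j\<close> becomes 1.\<close>
  obtain t where t: "0 \<le> t" "t \<le> 1" "(1 - t) * l j + t * k j = 1"
  proof (cases "k j = l j")
    case True
    then show ?thesis using that[of 0] k(5) l(4) by auto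
  next
    case False
    then have "l j < k j" using k(5) l(4) by auto
    have *: "(1 - s) * l j + s * k j = 1" if "s = (1 - l j) / (k j - l j)" for s
    proof -
      have "s * (k j - l j) = 1 - l j" using False that by simp
      then show ?thesis by (simp add: algebra_simps)
    qed
    have "0 \<le> (1 - l j) / (k j - l j)" "(1 - l j) / (k j - l j) \<le> 1"
      using \<open>l j < k j\<close> k(5) l(4) by (auto simp: divide_le_eq)
    then show ?thesis using *[OF refl] by (rule that)
  qed
  let ?h = "\<lambda>i. (1 - t) * l i + t * k i"
  have "(\<Sum>i\<in>V. ?h i *\<^sub>R p i) = (1 - t) *\<^sub>R x + t *\<^sub>R x"
    unfolding scaleR_left_distrib sum.distrib scaleR_scaleR[symmetric] scaleR_sum_right[symmetric]
    using l(1) k(1) by simp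
  then have "x = (\<Sum>i\<in>V. ?h i *\<^sub>R p i)" by (simp add: scaleR_left_diff_distrib)
  also have "\<dots> = p j + (\<Sum>i\<in>V - {j}. ?h i *\<^sub>R p i)"
    using assms t by (simp add: sum.remove[of V j])
  finally have "x = p j + (\<Sum>i\<in>V - {j}. ?h i *\<^sub>R p i)" .
  moreover have "(\<Sum>i\<in>V - {j}. ?h i) = m - 1"
  proof -
    have "(\<Sum>i\<in>V. ?h i) = (1 - t) * m + t * m"
      by (simp add: sum.distrib sum_distrib_left[symmetric] l(3) k(3))
    then show ?thesis using assms t by (simp add: sum.remove[of V j] algebra_simps)
  qed
  moreover have "\<forall>i\<in>V - {j}. 0 \<le> ?h i" using l k t by auto
  moreover have "\<forall>i\<in>S. ?h i \<le> 1"
    using l k t convex_bound_le[of _ 1 _ "1 - t" t] by auto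
  ultimately show "x \<in> (+) (p j) ` weighted_sums p (V - {j}) S (m - 1)"
    unfolding weighted_sums_def by (intro image_eqI[of _ _ "\<Sum>i\<in>V - {j}. ?h i *\<^sub>R p i"]) auto
next
  fix x assume "x \<in> (+) (p j) ` weighted_sums p (V - {j}) S (m - 1)"
  then obtain l where l: "x = p j + (\<Sum>i\<in>V - {j}. l i *\<^sub>R p i)" "\<forall>i\<in>V - {j}. 0 \<le> l i"
    "(\<Sum>i\<in>V - {j}. l i) = m - 1" "\<forall>i\<in>S. l i \<le> 1" unfolding weighted_sums_def by blast
  let ?h = "l(j := 1)"
  have "x = (\<Sum>i\<in>V. ?h i *\<^sub>R p i)" "(\<Sum>i\<in>V. ?h i) = m"
    using l assms by (simp_all add: sum.remove[of V j])
  moreover have "\<forall>i\<in>V. 0 \<le> ?h i" "\<forall>i\<in>insert j S. ?h i \<le> 1" "1 \<le> ?h j" using l assms by auto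
  ultimately show "x \<in> weighted_sums p V (insert j S) m \<inter> (+) (p j) ` weighted_sums p V S (m - 1)"
    unfolding weighted_sums_shift[OF assms(1-3)] unfolding weighted_sums_def
    by (intro IntI CollectI exI[of _ ?h]) auto
qed

lemma weighted_sums_scale:
  assumes "0 < r"
  shows "weighted_sums p V {} (r * m) = (*\<^sub>R) r ` weighted_sums p V {} m"
proof (intro equalityI subsetI)
  fix x assume "x \<in> weighted_sums p V {} (r * m)"
  then obtain l where l: "x = (\<Sum>i\<in>V. l i *\<^sub>R p i)" "\<forall>i\<in>V. 0 \<le> l i" "(\<Sum>i\<in>V. l i) = r * m"
    unfolding weighted_sums_def by blast
  let ?h = "\<lambda>i. l i / r"
  have "x = r *\<^sub>R (\<Sum>i\<in>V. ?h i *\<^sub>R p i)" using l assms by (simp add: scaleR_sum_right)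
  moreover have "(\<Sum>i\<in>V. ?h i) = m" using l assms by (simp add: sum_divide_distrib[symmetric])
  moreover have "\<forall>i\<in>V. 0 \<le> ?h i" using l assms by auto
  ultimately show "x \<in> (*\<^sub>R) r ` weighted_sums p V {} m"
    unfolding weighted_sums_def by (intro image_eqI[of _ _ "\<Sum>i\<in>V. ?h i *\<^sub>R p i"]) auto
next
  fix x assume "x \<in> (*\<^sub>R) r ` weighted_sums p V {} m"
  then obtain l where l: "x = r *\<^sub>R (\<Sum>i\<in>V. l i *\<^sub>R p i)" "\<forall>i\<in>V. 0 \<le> l i" "(\<Sum>i\<in>V. l i) = m"
    unfolding weighted_sums_def by blast
  let ?h = "\<lambda>i. r * l i"
  have "x = (\<Sum>i\<in>V. ?h i *\<^sub>R p i)" "(\<Sum>i\<in>V. ?h i) = r * m" "\<forall>i\<in>V. 0 \<le> ?h i"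
    using l assms by (simp_all add: scaleR_sum_right flip: sum_distrib_left)
  then show "x \<in> weighted_sums p V {} (r * m)"
    unfolding weighted_sums_def by (intro CollectI exI[of _ ?h]) auto
qed

lemma weighted_sums_scaled_points:
  "weighted_sums (\<lambda>i. r *\<^sub>R p i) V S m = (*\<^sub>R) r ` weighted_sums p V S m"
proof -
  have "(\<Sum>i\<in>V. l i *\<^sub>R r *\<^sub>R p i) = r *\<^sub>R (\<Sum>i\<in>V. l i *\<^sub>R p i)" for l :: "_ \<Rightarrow> real"
    by (simp add: scaleR_sum_right mult.commute)
  then show ?thesis unfolding weighted_sums_def by auto
qed

text \<open>The last condition is what remains of continuity at a point together with \<open>\<psi> {0} = 0\<close>.\<close>

locale bounded_valuation =
  fixes \<psi> :: "'a::euclidean_space set \<Rightarrow> real" and C :: real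
  assumes empty: "\<psi> {} = 0"
    and Un: "\<lbrakk>compact A; convex A; compact B; convex B; convex (A \<union> B)\<rbrakk>
              \<Longrightarrow> \<psi> (A \<union> B) + \<psi> (A \<inter> B) = \<psi> A + \<psi> B"
    and translation: "\<lbrakk>compact A; convex A\<rbrakk> \<Longrightarrow> \<psi> ((+) x ` A) = \<psi> A"
    and bounded: "\<lbrakk>compact A; convex A\<rbrakk> \<Longrightarrow> \<bar>\<psi> A\<bar> \<le> C"
    and shrink: "\<lbrakk>compact A; convex A; A \<noteq> {}\<rbrakk>
              \<Longrightarrow> (\<lambda>k. \<psi> ((*\<^sub>R) (1 / real (Suc k)) ` A)) \<longlonglongrightarrow> 0"
begin

lemma weighted_sums_recurrence:
  assumes "finite V" "j \<in> V" "j \<notin> S" "S \<subseteq> V"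
  shows "\<psi> (weighted_sums p V S m) + \<psi> (weighted_sums p (V - {j}) S (m - 1))
    = \<psi> (weighted_sums p V (insert j S) m) + \<psi> (weighted_sums p V S (m - 1))"
proof -
  have sub: "insert j S \<subseteq> V" "S \<subseteq> V - {j}" "finite (V - {j})" using assms by auto
  have "\<psi> (weighted_sums p V S m) + \<psi> ((+) (p j) ` weighted_sums p (V - {j}) S (m - 1))
    = \<psi> (weighted_sums p V (insert j S) m) + \<psi> ((+) (p j) ` weighted_sums p V S (m - 1))"
    using Un[of "weighted_sums p V (insert j S) m" "(+) (p j) ` weighted_sums p V S (m - 1)"]
    using assms(1,4) sub
    by (simp add: weighted_sums_cut_Un[OF assms(1-3)] weighted_sums_cut_Int[OF assms]
        compact_weighted_sums convex_weighted_sums compact_translation convex_translation)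
  then show ?thesis
    using assms(1,4) sub
    by (simp add: translation compact_weighted_sums convex_weighted_sums)
qed

text \<open>Write \<open>b S m\<close> for the value at total weight \<open>m\<close>. By induction on the number of points, the
  recurrence reduces to \<open>b S m - b S (m - 1) = b (insert j S) m\<close> for \<open>m > card V\<close>. The set is empty if all weights are
  truncated and \<open>m > card V\<close>. Removing truncations one by one, \<open>b S\<close> is eventually constant, and for nonempty \<open>S\<close> the
  constant is the slope of \<open>b (S - {i})\<close>, which is bounded, so it is zero. For \<open>S = {}\<close> the
  stationarity holds for all rescalings of the points from the same index on, so the value at a
  polytope is the value at its arbitrarily small copies, whence zero.\<close>

lemma weighted_sums_zero:
  assumes "finite V" "S \<subseteq> V" "card V + 1 \<le> m"
  shows "\<psi> (weighted_sums p V S (real m)) = 0"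
  using assms
proof (induction "card V" arbitrary: V S m p rule: less_induct)
  case less
  define b where "b = (\<lambda>p S m. \<psi> (weighted_sums p V S (real m)))"
  have difference: "b p S (Suc m) - b p S m = b p (insert j S) (Suc m)"
    if j: "j \<in> V" "j \<notin> S" and "S \<subseteq> V" "card V \<le> m" for p S m j
  proof -
    have "card (V - {j}) < card V" using less.prems(1) j by (intro psubset_card_mono) auto
    then have "\<psi> (weighted_sums p (V - {j}) S (real m)) = 0"
      using less.hyps[of "V - {j}" S m p] less.prems(1) that by auto
    then show ?thesis
      using weighted_sums_recurrence[OF less.prems(1) j \<open>S \<subseteq> V\<close>, of p "real (Suc m)"]
      by (simp add: b_def)
  qed
  have stationary: "b p S m = b p S (card V)"
    if "j \<in> V" "j \<notin> S" "S \<subseteq> V" "card V \<le> m"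
      and zero: "\<And>m. card V + 1 \<le> m \<Longrightarrow> b p (insert j S) m = 0" for p S m j
    using \<open>card V \<le> m\<close>
  proof (induction m rule: dec_induct)
    case (step m)
    then show ?case using difference[of j S m p] zero[of "Suc m"] that by simp
  qed simp
  have nonempty: "b p S m = 0" if "S \<subseteq> V" "S \<noteq> {}" "card V + 1 \<le> m" for p S m
    using that
  proof (induction "card (V - S)" arbitrary: S m rule: less_induct)
    case inner: less
    show ?case
    proof (cases "S = V")
      case True
      have "(\<Sum>i\<in>V. l i) \<noteq> real m" if "\<forall>i\<in>V. l i \<le> (1 :: real)" for l
        using sum_mono[of V l "\<lambda>_. 1"] that inner.prems(3) by auto
      then have "weighted_sums p V S (real m) = {}" unfolding weighted_sums_def True by auto
      then show ?thesis by (simp add: b_def empty)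
    next
      case False
      then obtain j where j: "j \<in> V" "j \<notin> S" using inner.prems(1) by auto
      have "card (V - insert j S) < card (V - S)"
        using less.prems(1) j by (intro psubset_card_mono) auto
      then have "b p (insert j S) m = 0" if "card V + 1 \<le> m" for m
        using inner.hyps[of "insert j S" m] j inner.prems(1) that by auto
      then have const: "b p S m = b p S (card V)" if "card V \<le> m" for m
        using stationary[OF j inner.prems(1) that] by blast
      obtain i where i: "i \<in> S" using inner.prems(2) by blast
      let ?S = "S - {i}" and ?c = "b p S (card V)"
      \<comment> \<open>The constant \<open>?c\<close> is the slope of the sequence with one truncation less.\<close>
      have linear: "b p ?S (card V + n) = b p ?S (card V) + real n * ?c" for n
      proof (induction n)
        case (Suc n)
        have "b p ?S (Suc (card V + n)) - b p ?S (card V + n) = b p (insert i ?S) (Suc (card V + n))"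
          using inner.prems i by (intro difference) auto
        also have "\<dots> = ?c" using i const[of "Suc (card V + n)"] by (simp add: insert_absorb)
        finally show ?case using Suc by (simp add: algebra_simps)
      qed simp
      have bound: "\<bar>b p ?S k\<bar> \<le> C" for k
        unfolding b_def using inner.prems(1) less.prems(1)
        by (intro bounded compact_weighted_sums convex_weighted_sums) auto
      have "?c = 0"
      proof (rule ccontr)
        assume "?c \<noteq> 0"
        then obtain n where "2 * C < real n * \<bar>?c\<bar>"
          using reals_Archimedean3[of "\<bar>?c\<bar>"] by auto
        moreover have "real n * \<bar>?c\<bar> = \<bar>b p ?S (card V + n) - b p ?S (card V)\<bar>"
          by (simp add: linear abs_mult)
        ultimately show False using bound[of "card V + n"] bound[of "card V"] by linarith
      qed
      then show ?thesis using const[of m] inner.prems(3) by simp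
    qed
  qed
  have "b p {} m = 0" if "card V + 1 \<le> m" for p m
  proof (cases "V = {}")
    case True
    then have "weighted_sums p V {} (real m) = {}"
      using that by (auto simp: weighted_sums_def)
    then show ?thesis by (simp add: b_def empty)
  next
    case False
    then obtain j where j: "j \<in> V" by blast
    define N where "N = card V"
    have "0 < N" using less.prems(1) False by (simp add: N_def card_gt_0_iff)
    have const: "b q {} m = b q {} N" if "N \<le> m" for q m
      using stationary[of j "{}" m q] nonempty[of "{j}"] j that by (simp add: N_def)
    let ?P = "weighted_sums p V {} (real m)"
    have scale: "\<psi> ((*\<^sub>R) (1 / real (Suc k)) ` ?P) = \<psi> ?P" for k
    proof -
      \<comment> \<open>Scaled so that total weight \<open>N * Suc k\<close> gives the polytope and total weight \<open>N\<close> its small copy.\<close>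
      let ?q = "\<lambda>i. (real m / (real N * real (Suc k))) *\<^sub>R p i"
      have pos: "0 < real m / (real N * real (Suc k))" using that \<open>0 < N\<close> by simp
      have q: "weighted_sums ?q V {} t = weighted_sums p V {} (real m / (real N * real (Suc k)) * t)" for t
        unfolding weighted_sums_scaled_points weighted_sums_scale[OF pos] ..
      have "weighted_sums ?q V {} (real (N * Suc k)) = ?P"
      proof -
        have "real m / (real N * real (Suc k)) * real (N * Suc k) = real m"
          using \<open>0 < N\<close> by (simp del: of_nat_Suc add: of_nat_mult mult_Suc_right[symmetric] del: mult_Suc_right)
        then show ?thesis by (subst q) (rule arg_cong)
      qed
      moreover have "weighted_sums ?q V {} (real N) = (*\<^sub>R) (1 / real (Suc k)) ` ?P"
      proof -
        have "real m / (real N * real (Suc k)) * real N = 1 / real (Suc k) * real m"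
          using \<open>0 < N\<close> by (simp del: of_nat_Suc)
        then have "weighted_sums ?q V {} (real N) = weighted_sums p V {} (1 / real (Suc k) * real m)"
          by (subst q) (rule arg_cong)
        also have "\<dots> = (*\<^sub>R) (1 / real (Suc k)) ` ?P" by (rule weighted_sums_scale) simp
        finally show ?thesis .
      qed
      ultimately show ?thesis using const[of "N * Suc k" ?q] by (simp add: b_def)
    qed
    show ?thesis
    proof (cases "?P = {}")
      case False
      then have "(\<lambda>k. \<psi> ((*\<^sub>R) (1 / real (Suc k)) ` ?P)) \<longlonglongrightarrow> 0"
        using less.prems(1) by (intro shrink compact_weighted_sums convex_weighted_sums) auto
      then show ?thesis unfolding scale using LIMSEQ_unique[OF tendsto_const] by (auto simp: b_def)
    qed (simp add: b_def empty)
  qed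
  then show ?case using nonempty less.prems by (cases "S = {}") (auto simp: b_def)
qed

lemma polytope_zero:
  assumes "finite F"
  shows "\<psi> (convex hull F) = 0"
proof -
  let ?m = "card F + 1"
  have "convex hull F = weighted_sums (\<lambda>x. x) F {} 1"
    unfolding convex_hull_finite[OF assms] weighted_sums_def by auto
  also have "\<dots> = weighted_sums (\<lambda>x. x) F {} (1 / real ?m * real ?m)" by simp
  also have "\<dots> = weighted_sums (\<lambda>x. (1 / real ?m) *\<^sub>R x) F {} (real ?m)"
    unfolding weighted_sums_scaled_points by (intro weighted_sums_scale) simp
  finally show ?thesis using weighted_sums_zero[OF assms, of "{}" ?m] by simp
qed

end

section \<open>Minkowski additivity of valuations of degree one\<close>

lemma compact_convex_cases:
  assumes "compact A" "convex A"
  obtains "A = {}" | "A \<in> convex_bodies"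
  using assms by (auto simp: convex_bodies_def)

text \<open>A segment from \<open>A\<close> to \<open>B\<close> inside the union is connected, so it meets the intersection.\<close>

lemma closed_convex_Un_crossing:
  fixes A B :: "'a::real_normed_vector set"
  assumes "closed A" "closed B" "convex (A \<union> B)" "a \<in> A" "b \<in> B"
  obtains t where "0 \<le> t" "t \<le> 1" "(1 - t) *\<^sub>R a + t *\<^sub>R b \<in> A \<inter> B"
proof -
  have "closed_segment a b \<subseteq> A \<union> B"
    using assms by (intro closed_segment_subset) auto
  moreover have "A \<inter> closed_segment a b \<noteq> {}" "B \<inter> closed_segment a b \<noteq> {}"
    using assms by auto
  ultimately have "A \<inter> B \<inter> closed_segment a b \<noteq> {}"
    using connected_closedD[OF connected_segment(1), of A B a b] assms(1,2) by blast
  then obtain z where "z \<in> closed_segment a b" "z \<in> A \<inter> B" by blast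
  then show thesis using that by (auto simp: closed_segment_def)
qed

lemma set_plus_Un_distrib: "K + (A \<union> B) = (K + A) \<union> (K + (B :: 'a::plus set))"
  by (auto simp: set_plus_def)

text \<open>Together with the distributivity over unions, this makes \<open>A \<mapsto> \<phi> (K + A)\<close> a valuation. Convexity
  of the union is essential: two representations \<open>k + a = k' + b\<close> of a point are mixed so that the second
  summand falls into the intersection.\<close>

lemma set_plus_Int_distrib:
  fixes A B K :: "'a::real_normed_vector set"
  assumes "convex K" "closed A" "closed B" "convex (A \<union> B)"
  shows "K + (A \<inter> B) = (K + A) \<inter> (K + B)"
proof
  show "(K + A) \<inter> (K + B) \<subseteq> K + (A \<inter> B)"
  proof
    fix z assume z: "z \<in> (K + A) \<inter> (K + B)"
    then obtain k a where a: "k \<in> K" "a \<in> A" "z = k + a" by (auto elim: set_plus_elim)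
    from z obtain k' b where b: "k' \<in> K" "b \<in> B" "z = k' + b" by (auto elim: set_plus_elim)
    obtain t where t: "0 \<le> t" "t \<le> 1" "(1 - t) *\<^sub>R a + t *\<^sub>R b \<in> A \<inter> B"
      using closed_convex_Un_crossing[OF assms(2-4) a(2) b(2)] .
    have "z = (1 - t) *\<^sub>R (k + a) + t *\<^sub>R (k' + b)"
      unfolding a(3)[symmetric] b(3)[symmetric] by (simp add: scaleR_left_diff_distrib)
    also have "\<dots> = ((1 - t) *\<^sub>R k + t *\<^sub>R k') + ((1 - t) *\<^sub>R a + t *\<^sub>R b)"
      by (simp add: algebra_simps)
    also have "\<dots> \<in> K + (A \<inter> B)"
    proof (rule set_plus_intro[OF _ t(3)])
      show "(1 - t) *\<^sub>R k + t *\<^sub>R k' \<in> K"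
        using t(1,2) a(1) b(1) by (intro convexD[OF assms(1)]) auto
    qed
    finally show "z \<in> K + (A \<inter> B)" .
  qed
qed (auto simp: set_plus_def)

lemma translation_eq_set_plus: "(+) v ` A = {v} + (A :: 'a::plus set)"
  by (auto simp: set_plus_def)

lemma Val_empty: "\<phi> \<in> Val \<Longrightarrow> \<phi> {} = 0"
  by (simp add: continuous_translation_invariant_valuations_def valuation_def)

lemma Val_translation: "\<phi> \<in> Val \<Longrightarrow> K \<in> convex_bodies \<Longrightarrow> \<phi> ((+) x ` K) = \<phi> K"
  by (simp add: continuous_translation_invariant_valuations_def)

lemma Val_Un:
  fixes \<phi> :: "(real ^ 'n) set \<Rightarrow> real"
  assumes "\<phi> \<in> Val" "compact A" "convex A" "compact B" "convex B" "convex (A \<union> B)"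
  shows "\<phi> (A \<union> B) + \<phi> (A \<inter> B) = \<phi> A + \<phi> B"
proof (cases "A = {} \<or> B = {}")
  case True
  then show ?thesis using Val_empty[OF assms(1)] by auto
next
  case False
  then show ?thesis
    using assms unfolding continuous_translation_invariant_valuations_def valuation_def
    by (auto simp: convex_bodies_def compact_Un)
qed

lemma convex_bodies_multiples_segment: "(\<lambda>r. r *\<^sub>R u) ` {0..real m} \<in> convex_bodies"
  unfolding convex_bodies_def
  by (auto intro!: compact_continuous_image continuous_intros convex_linear_image linearI
      simp: scaleR_left_distrib)

text \<open>The sum \<open>A + [0, (m + k) u]\<close> is the union of \<open>A + [0, m u]\<close> and \<open>m u + A + [0, k u]\<close>; a
  point of both lies between two points of \<open>m u + A\<close> in direction \<open>u\<close>, so the intersection is \<open>m u + A\<close>.\<close>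

lemma Val_plus_segment_step:
  fixes \<phi> :: "(real ^ 'n) set \<Rightarrow> real" and u :: "real ^ 'n"
  assumes "\<phi> \<in> Val" and A: "A \<in> convex_bodies"
  defines "S \<equiv> \<lambda>m. (\<lambda>r. r *\<^sub>R u) ` {0..real m}"
  shows "\<phi> (A + S (m + k)) + \<phi> A = \<phi> (A + S m) + \<phi> (A + S k)"
proof -
  let ?v = "real m *\<^sub>R u"
  have S: "S m \<in> convex_bodies" for m unfolding S_def by (rule convex_bodies_multiples_segment)
  have S_iff: "x \<in> S m \<longleftrightarrow> (\<exists>r. x = r *\<^sub>R u \<and> 0 \<le> r \<and> r \<le> real m)" for x m
    unfolding S_def image_iff Bex_def atLeastAtMost_iff by blast
  note AS = convex_bodies_set_plus[OF A S]
  have split: "S (m + k) = S m \<union> (+) ?v ` S k"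
  proof (intro equalityI subsetI)
    fix x assume "x \<in> S (m + k)"
    then obtain r where r: "x = r *\<^sub>R u" "0 \<le> r" "r \<le> real m + real k"
      unfolding S_iff by auto
    show "x \<in> S m \<union> (+) ?v ` S k"
    proof (cases "r \<le> real m")
      case False
      have "x = ?v + (r - real m) *\<^sub>R u" using r by (simp add: scaleR_left_diff_distrib)
      moreover have "(r - real m) *\<^sub>R u \<in> S k"
        unfolding S_iff using r False by (intro exI[of _ "r - real m"]) auto
      ultimately show ?thesis by blast
    qed (use r in \<open>auto simp: S_iff\<close>)
  next
    fix x assume "x \<in> S m \<union> (+) ?v ` S k"
    then show "x \<in> S (m + k)"
    proof
      assume "x \<in> (+) ?v ` S k"
      then obtain r where "x = (real m + r) *\<^sub>R u" "0 \<le> r" "r \<le> real k"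
        unfolding image_iff Bex_def S_iff by (auto simp: scaleR_left_distrib)
      then show ?thesis unfolding S_iff by (intro exI[of _ "real m + r"]) auto
    qed (auto simp: S_def)
  qed
  have shift: "(+) ?v ` (A + B) = A + (+) ?v ` B" for B
    unfolding translation_eq_set_plus by (rule add.left_commute)
  have Un: "A + S (m + k) = (A + S m) \<union> (+) ?v ` (A + S k)"
    unfolding split set_plus_Un_distrib shift ..
  have Int: "(A + S m) \<inter> (+) ?v ` (A + S k) = (+) ?v ` A"
  proof (intro equalityI subsetI)
    fix x assume x: "x \<in> (A + S m) \<inter> (+) ?v ` (A + S k)"
    then obtain a s where "a \<in> A" "s \<in> S m" "x = a + s" by (auto elim: set_plus_elim)
    then obtain \<alpha> where a: "x = a + \<alpha> *\<^sub>R u" "a \<in> A" "\<alpha> \<le> real m"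
      unfolding S_iff by blast
    from x obtain b s where "b \<in> A" "s \<in> S k" "x = ?v + (b + s)" by (auto elim: set_plus_elim)
    then obtain \<beta> where b: "x = ?v + (b + \<beta> *\<^sub>R u)" "b \<in> A" "0 \<le> \<beta>"
      unfolding S_iff by blast
    let ?y = "x - ?v" and ?\<delta> = "real m - \<alpha>"
    have y: "?y = a - ?\<delta> *\<^sub>R u" "?y = b + \<beta> *\<^sub>R u" using a b by (auto simp: algebra_simps)
    have "?y \<in> A"
    proof (cases "?\<delta> + \<beta> = 0")
      case True
      then have "?\<delta> = 0" using a(3) b(3) by linarith
      then show ?thesis using y(1) a(2) by simp
    next
      case False
      then have pos: "0 < ?\<delta> + \<beta>" using a(3) b(3) by linarith
      let ?s = "?\<delta> / (?\<delta> + \<beta>)" and ?t = "\<beta> / (?\<delta> + \<beta>)"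
      have st: "?s + ?t = 1" using pos by (simp add: add_divide_distrib[symmetric])
      have "?y = ?t *\<^sub>R ?y + ?s *\<^sub>R ?y"
        using st by (metis add.commute scaleR_left_distrib scaleR_one)
      also have "\<dots> = ?t *\<^sub>R (a - ?\<delta> *\<^sub>R u) + ?s *\<^sub>R (b + \<beta> *\<^sub>R u)" using y by simp
      also have "\<dots> = ?t *\<^sub>R a + ?s *\<^sub>R b"
        by (simp add: scaleR_right_distrib scaleR_right_diff_distrib mult.commute[of \<beta>])
      also have "\<dots> \<in> A"
        using a b pos st convex_bodiesD(2)[OF A] by (intro convexD) auto
      finally show ?thesis .
    qed
    then show "x \<in> (+) ?v ` A" by (intro image_eqI[of _ _ ?y]) auto
  next
    fix x assume "x \<in> (+) ?v ` A"
    then obtain a where a: "a \<in> A" "x = ?v + a" by blast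
    have "a + ?v \<in> A + S m" using a by (intro set_plus_intro) (auto simp: S_def)
    moreover have "a + 0 \<in> A + S k"
      using a by (intro set_plus_intro) (auto simp: S_def intro!: image_eqI[of _ _ 0])
    ultimately show "x \<in> (A + S m) \<inter> (+) ?v ` (A + S k)" using a by (auto simp: add.commute)
  qed
  have "convex ((A + S m) \<union> (+) ?v ` (A + S k))"
    unfolding Un[symmetric] using AS convex_bodiesD(2) by blast
  then have "\<phi> (A + S (m + k)) + \<phi> ((+) ?v ` A) = \<phi> (A + S m) + \<phi> ((+) ?v ` (A + S k))"
    using Val_Un[OF assms(1), of "A + S m" "(+) ?v ` (A + S k)"]
      convex_bodiesD(1,2)[OF AS] convex_bodiesD(1,2)[OF convex_bodies_translation[OF AS]]
    unfolding Un Int by simp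
  then show ?thesis using Val_translation[OF assms(1)] A AS by simp
qed

lemma Val_plus_segment_linear:
  fixes \<phi> :: "(real ^ 'n) set \<Rightarrow> real" and u :: "real ^ 'n"
  assumes "\<phi> \<in> Val" "A \<in> convex_bodies"
  shows "\<phi> (A + (\<lambda>r. r *\<^sub>R u) ` {0..real m})
    = \<phi> A + real m * (\<phi> (A + (\<lambda>r. r *\<^sub>R u) ` {0..1}) - \<phi> A)"
proof (induction m)
  case 0
  have "A + {0} = A" by (auto simp: set_plus_def)
  then show ?case by simp
next
  case (Suc m)
  show ?case
    using Val_plus_segment_step[OF assms, of u m 1] Suc by (simp add: algebra_simps)
qed

locale linear_valuation =
  fixes \<phi> :: "(real ^ 'n) set \<Rightarrow> real"
  assumes Val: "\<phi> \<in> Val"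
    and homogeneous: "homogeneous_val 1 \<phi>"
    and mono: "\<lbrakk>A \<in> convex_bodies; B \<in> convex_bodies; A \<subseteq> B\<rbrakk> \<Longrightarrow> \<phi> A \<le> \<phi> B"
begin

lemma scale: "A \<in> convex_bodies \<Longrightarrow> 0 \<le> t \<Longrightarrow> \<phi> ((*\<^sub>R) t ` A) = t * \<phi> A"
  using homogeneous by (simp add: homogeneous_val_def)

lemma singleton: "\<phi> {x} = 0"
  using scale[of "{0}" 0] Val_translation[OF Val, of "{0}" x] by (simp add: convex_bodies_def)

lemma nonneg: "A \<in> convex_bodies \<Longrightarrow> 0 \<le> \<phi> A"
proof -
  assume A: "A \<in> convex_bodies"
  then obtain x where "x \<in> A" using convex_bodiesD(3) by blast
  then show ?thesis using mono[of "{x}" A] singleton[of x] A by (simp add: convex_bodies_def)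
qed

lemma shrink_tendsto:
  assumes "K \<in> convex_bodies" "A \<in> convex_bodies"
  shows "(\<lambda>k. \<phi> (K + (*\<^sub>R) (1 / real (Suc k)) ` A)) \<longlonglongrightarrow> \<phi> K"
proof -
  obtain R where R: "\<And>a. a \<in> A \<Longrightarrow> norm a \<le> R"
    using convex_bodiesD(5)[OF assms(2)] by (auto simp: bounded_iff)
  show ?thesis
  proof (rule Val_tendsto_set_plus[OF Val assms(1), where r = "\<lambda>k. R / real (Suc k)"])
    show "\<forall>\<^sub>F k in sequentially. (*\<^sub>R) (1 / real (Suc k)) ` A \<in> convex_bodies \<and>
        (*\<^sub>R) (1 / real (Suc k)) ` A \<subseteq> cball 0 (R / real (Suc k))"
      using R by (intro always_eventually allI conjI convex_bodies_scaling assms)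
        (auto simp: divide_right_mono simp del: of_nat_Suc)
    show "(\<lambda>k. R / real (Suc k)) \<longlonglongrightarrow> 0"
      using tendsto_mult[OF tendsto_const[of R] LIMSEQ_inverse_real_of_nat] by (simp add: divide_inverse)
  qed
qed

text \<open>Dividing \<open>\<phi> (A + m S) = \<phi> A + m (\<phi> (A + S) - \<phi> A)\<close> by \<open>m\<close> gives
  \<open>\<phi> (A / m + S) \<longrightarrow> \<phi> (A + S) - \<phi> A\<close>, while the left-hand side tends to \<open>\<phi> S\<close>.\<close>

lemma plus_segment:
  assumes A: "A \<in> convex_bodies"
  shows "\<phi> (A + (\<lambda>r. r *\<^sub>R u) ` {0..1}) = \<phi> A + \<phi> ((\<lambda>r. r *\<^sub>R u) ` {0..1})"
proof -
  let ?S = "(\<lambda>r. r *\<^sub>R u) ` {0..1}"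
  have S: "?S \<in> convex_bodies" using convex_bodies_multiples_segment[of u 1] by simp
  have eq: "\<phi> (?S + (*\<^sub>R) (1 / real (Suc k)) ` A)
      = (1 / real (Suc k)) * \<phi> A + (\<phi> (A + ?S) - \<phi> A)" for k
  proof -
    let ?m = "real (Suc k)"
    have "?S + (*\<^sub>R) (1 / ?m) ` A = (*\<^sub>R) (1 / ?m) ` (A + (\<lambda>r. r *\<^sub>R u) ` {0..?m})"
    proof (intro equalityI subsetI)
      fix x assume "x \<in> ?S + (*\<^sub>R) (1 / ?m) ` A"
      then obtain r a where ra: "0 \<le> r" "r \<le> 1" "a \<in> A" "x = r *\<^sub>R u + (1 / ?m) *\<^sub>R a"
        by (auto simp: set_plus_def)
      have "x = (1 / ?m) *\<^sub>R (a + (?m * r) *\<^sub>R u)"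
        using ra(4) by (simp add: scaleR_right_distrib del: of_nat_Suc)
      moreover have "a + (?m * r) *\<^sub>R u \<in> A + (\<lambda>r. r *\<^sub>R u) ` {0..?m}"
        using ra mult_left_le[of r ?m] by (intro set_plus_intro imageI) auto
      ultimately show "x \<in> (*\<^sub>R) (1 / ?m) ` (A + (\<lambda>r. r *\<^sub>R u) ` {0..?m})" by blast
    next
      fix x assume "x \<in> (*\<^sub>R) (1 / ?m) ` (A + (\<lambda>r. r *\<^sub>R u) ` {0..?m})"
      then obtain r a where ra: "0 \<le> r" "r \<le> ?m" "a \<in> A" "x = (1 / ?m) *\<^sub>R (a + r *\<^sub>R u)"
        by (auto simp: set_plus_def simp del: of_nat_Suc)
      have "x = (r / ?m) *\<^sub>R u + (1 / ?m) *\<^sub>R a"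
        using ra(4) by (simp add: scaleR_right_distrib del: of_nat_Suc)
      moreover have "(r / ?m) *\<^sub>R u \<in> ?S" using ra by (intro imageI) auto
      ultimately show "x \<in> ?S + (*\<^sub>R) (1 / ?m) ` A" using ra(3) by (auto intro: set_plus_intro)
    qed
    then have "\<phi> (?S + (*\<^sub>R) (1 / ?m) ` A) = \<phi> ((*\<^sub>R) (1 / ?m) ` (A + (\<lambda>r. r *\<^sub>R u) ` {0..?m}))"
      by (rule arg_cong)
    also have "\<dots> = 1 / ?m * \<phi> (A + (\<lambda>r. r *\<^sub>R u) ` {0..?m})"
      by (rule scale[OF convex_bodies_set_plus[OF A convex_bodies_multiples_segment]]) simp
    also have "\<dots> = 1 / ?m * \<phi> A + (\<phi> (A + ?S) - \<phi> A)"
      unfolding Val_plus_segment_linear[OF Val A, of u "Suc k"]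
      by (simp add: distrib_left del: of_nat_Suc)
    finally show ?thesis .
  qed
  have "(\<lambda>k. (1 / real (Suc k)) * \<phi> A + (\<phi> (A + ?S) - \<phi> A)) \<longlonglongrightarrow> \<phi> ?S"
    using shrink_tendsto[OF S A] unfolding eq .
  moreover have "(\<lambda>k. (1 / real (Suc k)) * \<phi> A + (\<phi> (A + ?S) - \<phi> A)) \<longlonglongrightarrow> 0 * \<phi> A + (\<phi> (A + ?S) - \<phi> A)"
    using LIMSEQ_inverse_real_of_nat by (intro tendsto_intros) (simp add: inverse_eq_divide)
  ultimately show ?thesis using LIMSEQ_unique by fastforce
qed

text \<open>The body \<open>K\<close> lies in a translate of a cube, a sum of segments, and \<open>\<phi>\<close> is additive for segments.\<close>

lemma plus_bounded:
  assumes K: "K \<in> convex_bodies"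
  obtains C where "\<And>L. L \<in> convex_bodies \<Longrightarrow> \<phi> (K + L) \<le> C + \<phi> L"
proof -
  obtain R where R: "\<And>x. x \<in> K \<Longrightarrow> norm x \<le> R"
    using convex_bodiesD(5)[OF K] by (auto simp: bounded_iff)
  have "0 \<le> R" using R convex_bodiesD(3)[OF K] norm_ge_zero order_trans by blast
  define z where "z = (\<Sum>b\<in>(Basis :: (real ^ 'n) set). (- R) *\<^sub>R b)"
  let ?Z = "zonotope (\<lambda>b. (2 * R) *\<^sub>R b) (\<lambda>_. 1)"
  have Z: "zonotope (\<lambda>b :: real ^ 'n. (2 * R) *\<^sub>R b) (\<lambda>_. 1) F \<in> convex_bodies \<and>
      (\<exists>C. \<forall>L\<in>convex_bodies. \<phi> (?Z F + L) \<le> C + \<phi> L)" if "finite F" for F :: "(real ^ 'n) set"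
    using that
  proof (induction F)
    case empty
    have "{0 :: real ^ 'n} + L = L" for L by (auto simp: set_plus_def)
    then show ?case by (auto simp: convex_bodies_def intro!: exI[of _ 0])
  next
    case (insert b F)
    let ?S = "(\<lambda>r. r *\<^sub>R (2 * R) *\<^sub>R b) ` {0..1}"
    have S: "?S \<in> convex_bodies" using convex_bodies_multiples_segment[of "(2 * R) *\<^sub>R b" 1] by simp
    have eq: "?Z (insert b F) = ?S + ?Z F" using insert.hyps by (rule zonotope_insert)
    obtain C where C: "\<And>L. L \<in> convex_bodies \<Longrightarrow> \<phi> (?Z F + L) \<le> C + \<phi> L"
      using insert.IH by blast
    have "\<phi> (?Z (insert b F) + L) \<le> (\<phi> ?S + C) + \<phi> L" if L: "L \<in> convex_bodies" for L
    proof -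
      have "?Z F + L \<in> convex_bodies" using insert.IH L by (auto intro: convex_bodies_set_plus)
      then have "\<phi> ((?Z F + L) + ?S) = \<phi> (?Z F + L) + \<phi> ?S" by (rule plus_segment)
      then show ?thesis using C[OF L] by (simp add: eq add_ac)
    qed
    moreover have "?Z (insert b F) \<in> convex_bodies"
      unfolding eq using S insert.IH by (auto intro: convex_bodies_set_plus)
    ultimately show ?case by blast
  qed
  let ?W = "zonotope (\<lambda>b :: real ^ 'n. (2 * R) *\<^sub>R b) (\<lambda>_. 1) Basis"
  obtain C where C: "\<And>L. L \<in> convex_bodies \<Longrightarrow> \<phi> (?W + L) \<le> C + \<phi> L" and W: "?W \<in> convex_bodies"
    using Z[OF finite_Basis] by blast
  have sub: "K \<subseteq> (+) z ` ?W"
  proof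
    fix x assume "x \<in> K"
    show "x \<in> (+) z ` ?W"
    proof (cases "R = 0")
      case True
      then have "x = 0" "z = 0" using R[OF \<open>x \<in> K\<close>] by (auto simp: z_def)
      moreover have "0 \<in> ?W" unfolding zonotope_def by (intro CollectI exI[of _ "\<lambda>_. 0"]) simp
      ultimately show ?thesis by force
    next
      case False
      then have "0 < R" using \<open>0 \<le> R\<close> by simp
      let ?l = "\<lambda>b. (x \<bullet> b + R) / (2 * R)"
      have "(\<Sum>b\<in>Basis. ?l b *\<^sub>R (2 * R) *\<^sub>R b) = (\<Sum>b\<in>Basis. (x \<bullet> b) *\<^sub>R b + R *\<^sub>R b)"
        using \<open>0 < R\<close> by (intro sum.cong) (auto simp: scaleR_left_distrib)
      also have "\<dots> = x - z"
        by (simp add: sum.distrib z_def euclidean_representation sum_negf)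
      finally have x: "x = z + (\<Sum>b\<in>Basis. ?l b *\<^sub>R (2 * R) *\<^sub>R b)" by simp
      have "0 \<le> ?l b \<and> ?l b \<le> 1" if "b \<in> Basis" for b
        using Basis_le_norm[OF that, of x] R[OF \<open>x \<in> K\<close>] \<open>0 < R\<close> by (auto simp: divide_le_eq)
      then have "(\<Sum>b\<in>Basis. ?l b *\<^sub>R (2 * R) *\<^sub>R b) \<in> ?W" unfolding zonotope_def
        by (intro CollectI exI[of _ ?l] conjI refl) blast
      with x show ?thesis by (rule image_eqI)
    qed
  qed
  have "\<phi> (K + L) \<le> C + \<phi> L" if L: "L \<in> convex_bodies" for L
  proof -
    have "(+) z ` ?W + L = (+) z ` (?W + L)"
      unfolding translation_eq_set_plus by (rule add.assoc)
    moreover have "K + L \<subseteq> (+) z ` ?W + L" using sub by (intro set_plus_mono2) auto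
    ultimately have "\<phi> (K + L) \<le> \<phi> ((+) z ` (?W + L))"
      using K L W by (intro mono convex_bodies_set_plus convex_bodies_translation) auto
    also have "\<dots> = \<phi> (?W + L)" using L W by (intro Val_translation[OF Val] convex_bodies_set_plus)
    finally show ?thesis using C[OF L] by simp
  qed
  then show thesis using that by blast
qed

text \<open>The defect \<open>\<phi> (K + L) - \<phi> L - \<phi> K\<close> of additivity is a bounded valuation in \<open>L\<close>.\<close>

lemma plus_polytope:
  assumes K: "K \<in> convex_bodies" and F: "finite F" "F \<noteq> {}"
  shows "\<phi> (K + convex hull F) = \<phi> K + \<phi> (convex hull F)"
proof -
  obtain C where C: "\<And>L. L \<in> convex_bodies \<Longrightarrow> \<phi> (K + L) \<le> C + \<phi> L"
    using plus_bounded[OF K] by blast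
  define \<psi> where "\<psi> = (\<lambda>L. if L = {} then 0 else \<phi> (K + L) - \<phi> L - \<phi> K)"
  have bound: "\<bar>\<psi> L\<bar> \<le> \<bar>C\<bar> + \<phi> K" if "compact L" "convex L" for L
    using that
  proof (cases rule: compact_convex_cases)
    case 2
    obtain x where x: "x \<in> K" using convex_bodiesD(3)[OF K] by blast
    have "\<phi> L = \<phi> ((+) x ` L)" using Val_translation[OF Val 2] by simp
    also have "\<dots> \<le> \<phi> (K + L)"
      using x K 2 by (intro mono convex_bodies_set_plus convex_bodies_translation) auto
    finally have "\<phi> L \<le> \<phi> (K + L)" .
    moreover have "\<psi> L = \<phi> (K + L) - \<phi> L - \<phi> K"
      using convex_bodiesD(3)[OF 2] by (simp add: \<psi>_def)
    ultimately show ?thesis using C[OF 2] nonneg[OF K] by linarith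
  qed (use nonneg[OF K] in \<open>simp add: \<psi>_def\<close>)
  have defect: "bounded_valuation \<psi> (\<bar>C\<bar> + \<phi> K)"
  proof
    show "\<psi> {} = 0" by (simp add: \<psi>_def)
  next
    fix A B :: "(real ^ 'n) set"
    assume AB: "compact A" "convex A" "compact B" "convex B" "convex (A \<union> B)"
    show "\<psi> (A \<union> B) + \<psi> (A \<inter> B) = \<psi> A + \<psi> B"
    proof (cases "A = {} \<or> B = {}")
      case False
      then obtain a b where "a \<in> A" "b \<in> B" by blast
      then have ne: "A \<inter> B \<noteq> {}"
        using closed_convex_Un_crossing[OF compact_imp_closed compact_imp_closed] AB
        by (metis empty_iff)
      have K': "compact K" "convex K" using K convex_bodiesD by auto
      have "\<phi> (K + (A \<union> B)) + \<phi> (K + (A \<inter> B)) = \<phi> (K + A) + \<phi> (K + B)"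
      proof -
        have "convex ((K + A) \<union> (K + B))"
          unfolding set_plus_Un_distrib[symmetric] using K' AB by (intro convex_set_plus)
        moreover have "K + (A \<inter> B) = (K + A) \<inter> (K + B)"
          using K' AB by (intro set_plus_Int_distrib) (auto intro: compact_imp_closed)
        ultimately show ?thesis
          using K' AB Val_Un[OF Val, of "K + A" "K + B"]
          by (simp add: set_plus_Un_distrib compact_set_plus convex_set_plus)
      qed
      moreover have "\<phi> (A \<union> B) + \<phi> (A \<inter> B) = \<phi> A + \<phi> B" using AB by (intro Val_Un[OF Val])
      ultimately show ?thesis using False ne by (simp add: \<psi>_def)
    qed (auto simp: \<psi>_def)
  next
    fix A :: "(real ^ 'n) set" and x :: "real ^ 'n"
    assume "compact A" "convex A"
    then show "\<psi> ((+) x ` A) = \<psi> A"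
    proof (cases rule: compact_convex_cases)
      case 2
      have "K + (+) x ` A = (+) x ` (K + A)"
        unfolding translation_eq_set_plus by (rule add.left_commute)
      then show ?thesis
        using Val_translation[OF Val 2] Val_translation[OF Val convex_bodies_set_plus[OF K 2]]
        by (simp add: \<psi>_def)
    qed simp
  next
    fix A :: "(real ^ 'n) set" assume "compact A" "convex A" "A \<noteq> {}"
    then have A: "A \<in> convex_bodies" by (simp add: convex_bodies_def)
    have "(\<lambda>k. \<phi> (K + (*\<^sub>R) (1 / real (Suc k)) ` A) - 1 / real (Suc k) * \<phi> A - \<phi> K)
        \<longlonglongrightarrow> \<phi> K - 0 * \<phi> A - \<phi> K"
      using LIMSEQ_inverse_real_of_nat
      by (intro tendsto_intros shrink_tendsto K A) (simp add: inverse_eq_divide)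
    then show "(\<lambda>k. \<psi> ((*\<^sub>R) (1 / real (Suc k)) ` A)) \<longlonglongrightarrow> 0"
      using \<open>A \<noteq> {}\<close> by (simp add: \<psi>_def scale[OF A] del: of_nat_Suc)
  qed (rule bound)
  show ?thesis using bounded_valuation.polytope_zero[OF defect F(1)] F(2) by (simp add: \<psi>_def)
qed

text \<open>Approximation of \<open>L\<close> by the convex hulls of finite nets in \<open>L\<close>.\<close>

lemma Minkowski_additive:
  assumes K: "K \<in> convex_bodies" and L: "L \<in> convex_bodies"
  shows "\<phi> (K + L) = \<phi> K + \<phi> L"
proof -
  have "\<exists>F. finite F \<and> F \<noteq> {} \<and> F \<subseteq> L \<and> (\<forall>x\<in>L. \<exists>y\<in>F. dist x y \<le> 1 / real (Suc k))" for k
  proof -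
    have "L \<subseteq> (\<Union>y\<in>L. ball y (1 / real (Suc k)))"
      by (auto intro!: bexI simp del: of_nat_Suc)
    then obtain F where F: "F \<subseteq> L" "finite F" "L \<subseteq> (\<Union>y\<in>F. ball y (1 / real (Suc k)))"
      by (rule compactE_image[OF convex_bodiesD(1)[OF L], rotated]) auto
    then have "F \<noteq> {}" using convex_bodiesD(3)[OF L] by auto
    moreover have "\<exists>y\<in>F. dist x y \<le> 1 / real (Suc k)" if "x \<in> L" for x
      using F(3) that by (force simp: dist_commute less_imp_le)
    ultimately show ?thesis using F by blast
  qed
  then obtain F where F: "\<And>k. finite (F k)" "\<And>k. F k \<noteq> {}" "\<And>k. F k \<subseteq> L"
    "\<And>k x. x \<in> L \<Longrightarrow> \<exists>y\<in>F k. dist x y \<le> 1 / real (Suc k)" by metis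
  let ?P = "\<lambda>k. convex hull (F k)"
  have P: "?P k \<in> convex_bodies" for k
    using F(1,2) by (simp add: convex_bodies_def finite_imp_compact_convex_hull)
  have PL: "?P k \<subseteq> L" for k using F(3) convex_bodiesD(2)[OF L] by (intro hull_minimal)
  have lim0: "(\<lambda>k. 1 / real (Suc k)) \<longlonglongrightarrow> 0"
    using LIMSEQ_inverse_real_of_nat by (simp add: inverse_eq_divide)
  have lim: "(\<lambda>k. \<phi> (?P k)) \<longlonglongrightarrow> \<phi> L"
  proof (rule Val_tendsto[OF Val L _ lim0], intro always_eventually allI conjI ballI P)
    fix k x
    show "\<exists>y\<in>?P k. dist x y \<le> 1 / real (Suc k)" if "x \<in> L"
      using F(4)[OF that, of k] by (meson hull_inc)
    show "\<exists>y\<in>L. dist x y \<le> 1 / real (Suc k)" if "x \<in> ?P k"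
      using that PL[of k] by (intro bexI[of _ x]) auto
  qed
  have "(\<lambda>k. \<phi> (K + ?P k)) \<longlonglongrightarrow> \<phi> (K + L)"
  proof (rule Val_tendsto[OF Val convex_bodies_set_plus[OF K L] _ lim0],
      intro always_eventually allI conjI ballI convex_bodies_set_plus K P)
    fix k x
    show "\<exists>y\<in>K + ?P k. dist x y \<le> 1 / real (Suc k)" if "x \<in> K + L"
    proof -
      from that obtain a b where ab: "a \<in> K" "b \<in> L" "x = a + b" by (rule set_plus_elim)
      obtain c where "c \<in> F k" "dist b c \<le> 1 / real (Suc k)" using F(4)[OF ab(2)] by blast
      then show ?thesis
        using ab by (intro bexI[of _ "a + c"]) (auto simp: hull_inc)
    qed
    show "\<exists>y\<in>K + L. dist x y \<le> 1 / real (Suc k)" if "x \<in> K + ?P k"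
      using that set_plus_mono2[OF order_refl PL[of k]] by (intro bexI[of _ x]) auto
  qed
  moreover have "(\<lambda>k. \<phi> (K + ?P k)) \<longlonglongrightarrow> \<phi> K + \<phi> L"
    unfolding plus_polytope[OF K F(1,2)] by (intro tendsto_intros lim)
  ultimately show ?thesis by (rule LIMSEQ_unique)
qed

end

section \<open>Valuations of degree one\<close>

text \<open>A point \<open>x\<close> of \<open>L\<close> outside \<open>K\<close> is separated from \<open>K\<close> by a hyperplane; moving \<open>x\<close> one unit away from
  it yields a point that is further out than any point of \<open>K + cball 0 1\<close>.\<close>

lemma set_plus_cball_psubset:
  fixes K L :: "'a::euclidean_space set"
  assumes K: "convex K" "closed K" "K \<noteq> {}" and "K \<subset> L"
  shows "K + cball 0 1 \<subset> L + cball 0 1"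
proof -
  obtain x where x: "x \<in> L" "x \<notin> K" using \<open>K \<subset> L\<close> by blast
  obtain a b where ab: "a \<bullet> x < b" "\<And>y. y \<in> K \<Longrightarrow> b < a \<bullet> y"
    using separating_hyperplane_closed_point[OF K(1,2) x(2)] by blast
  have "a \<noteq> 0"
  proof
    assume "a = 0"
    obtain y where "y \<in> K" using K(3) by blast
    from ab(2)[OF this] ab(1) show False by (simp add: \<open>a = 0\<close>)
  qed
  define c where "c = - (1 / norm a) *\<^sub>R a"
  have "norm c = 1" using \<open>a \<noteq> 0\<close> by (simp add: c_def)
  have "x + c \<in> L + cball 0 1" using x(1) \<open>norm c = 1\<close> by (intro set_plus_intro) auto
  moreover have "x + c \<notin> K + cball 0 1"
  proof
    assume "x + c \<in> K + cball 0 1"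
    then obtain y d where y: "y \<in> K" and d: "d \<in> cball 0 1" and xc: "x + c = y + d"
      by (rule set_plus_elim)
    have "a \<bullet> c = - norm a" using \<open>a \<noteq> 0\<close> by (simp add: c_def norm_eq_sqrt_inner real_div_sqrt)
    moreover have "- norm a \<le> a \<bullet> d"
    proof -
      have "\<bar>a \<bullet> d\<bar> \<le> norm a * norm d" by (rule Cauchy_Schwarz_ineq2)
      also have "\<dots> \<le> norm a" using d by (simp add: mult_left_le)
      finally show ?thesis by simp
    qed
    moreover have "a \<bullet> x + a \<bullet> c = a \<bullet> y + a \<bullet> d" using xc by (metis inner_add_right)
    ultimately show False using ab(1) ab(2)[OF y] by linarith
  qed
  moreover have "K + cball 0 1 \<subseteq> L + cball 0 1" using \<open>K \<subset> L\<close> by (intro set_plus_mono2) auto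
  ultimately show ?thesis by blast
qed

lemma mem_convex_hull_Un:
  fixes K L :: "'a::euclidean_space set"
  assumes "convex K" "K \<noteq> {}" "convex L" "L \<noteq> {}" "x \<in> convex hull (K \<union> L)"
  obtains u k l where "0 \<le> u" "u \<le> 1" "k \<in> K" "l \<in> L" "x = (1 - u) *\<^sub>R k + u *\<^sub>R l"
proof -
  obtain v u k l where "0 \<le> v" "0 \<le> u" "v + u = 1" "k \<in> K" "l \<in> L" "x = v *\<^sub>R k + u *\<^sub>R l"
    using assms(5) unfolding convex_hull_union_two[OF assms(1-4)] by blast
  moreover from this have "v = 1 - u" by simp
  ultimately show thesis using that[of u k l] by simp
qed

text \<open>A point \<open>(1 - u) k + u m + l\<close> is regrouped as \<open>((1 - u) k + u l) + ((1 - u) l + u m)\<close>.\<close>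

lemma hull_Un_plus_subset:
  fixes K L M :: "'a::euclidean_space set"
  assumes "convex K" "convex M" "K \<noteq> {}" "M \<noteq> {}"
  shows "convex hull (K \<union> M) + L \<subseteq> convex hull (K \<union> L) + convex hull (L \<union> M)"
proof
  fix z assume "z \<in> convex hull (K \<union> M) + L"
  then obtain x l where xl: "x \<in> convex hull (K \<union> M)" "l \<in> L" "z = x + l" by (rule set_plus_elim)
  obtain u k m where ukm: "0 \<le> u" "u \<le> 1" "k \<in> K" "m \<in> M" "x = (1 - u) *\<^sub>R k + u *\<^sub>R m"
    using mem_convex_hull_Un[OF assms(1,3,2,4) xl(1)] by blast
  have "(1 - u) *\<^sub>R k + u *\<^sub>R l \<in> convex hull (K \<union> L)"
    using ukm xl(2) by (intro convexD[OF convex_convex_hull]) (auto intro: hull_inc)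
  moreover have "(1 - u) *\<^sub>R l + u *\<^sub>R m \<in> convex hull (L \<union> M)"
    using ukm xl(2) by (intro convexD[OF convex_convex_hull]) (auto intro: hull_inc)
  moreover have "z = ((1 - u) *\<^sub>R k + u *\<^sub>R l) + ((1 - u) *\<^sub>R l + u *\<^sub>R m)"
    using xl(3) ukm(5) by (simp add: algebra_simps)
  ultimately show "z \<in> convex hull (K \<union> L) + convex hull (L \<union> M)" by auto
qed

text \<open>A point \<open>(1 - u) k + u l + y\<close> is regrouped as \<open>((1 - u) k + u y) + ((1 - u) y + u l)\<close>, which uses that \<open>y\<close>
  lies in both bodies.\<close>

lemma hull_Un_plus_Int_subset:
  fixes K L :: "'a::euclidean_space set"
  assumes "convex K" "convex L" "K \<noteq> {}" "L \<noteq> {}"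
  shows "convex hull (K \<union> L) + (K \<inter> L) \<subseteq> K + L"
proof
  fix z assume "z \<in> convex hull (K \<union> L) + (K \<inter> L)"
  then obtain x y where xy: "x \<in> convex hull (K \<union> L)" "y \<in> K \<inter> L" "z = x + y"
    by (rule set_plus_elim)
  obtain u k l where ukl: "0 \<le> u" "u \<le> 1" "k \<in> K" "l \<in> L" "x = (1 - u) *\<^sub>R k + u *\<^sub>R l"
    using mem_convex_hull_Un[OF assms(1,3,2,4) xy(1)] by blast
  have "(1 - u) *\<^sub>R k + u *\<^sub>R y \<in> K" using ukl xy(2) by (intro convexD[OF assms(1)]) auto
  moreover have "(1 - u) *\<^sub>R y + u *\<^sub>R l \<in> L" using ukl xy(2) by (intro convexD[OF assms(2)]) auto
  moreover have "z = ((1 - u) *\<^sub>R k + u *\<^sub>R y) + ((1 - u) *\<^sub>R y + u *\<^sub>R l)"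
    using xy(3) ukl(5) by (simp add: algebra_simps)
  ultimately show "z \<in> K + L" by auto
qed

lemma meet_deviation_nested:
  assumes "A \<subseteq> B"
  shows "meet_deviation \<phi> A B = \<phi> B - \<phi> A \<and> meet_deviation \<phi> B A = \<phi> B - \<phi> A"
proof -
  have "A \<inter> B = A" "B \<inter> A = A" using assms by auto
  then show ?thesis by (simp add: meet_deviation_def)
qed

lemma join_deviation_nested:
  assumes "A \<subseteq> B" "convex B"
  shows "join_deviation \<phi> A B = \<phi> B - \<phi> A \<and> join_deviation \<phi> B A = \<phi> B - \<phi> A"
proof -
  have "A \<union> B = B" "B \<union> A = B" using assms by auto
  then show ?thesis using assms by (simp add: join_deviation_def hull_same)
qed

lemma meet_deviation_commute: "meet_deviation \<phi> K L = meet_deviation \<phi> L K"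
  by (simp add: meet_deviation_def Int_commute)

lemma join_deviation_commute: "join_deviation \<phi> K L = join_deviation \<phi> L K"
  by (simp add: join_deviation_def Un_commute)

lemma metric_onI:
  assumes "\<And>x y. \<lbrakk>x \<in> M; y \<in> M\<rbrakk> \<Longrightarrow> 0 \<le> d x y"
    and "\<And>x y. \<lbrakk>x \<in> M; y \<in> M\<rbrakk> \<Longrightarrow> d x y = d y x"
    and "\<And>x y. \<lbrakk>x \<in> M; y \<in> M\<rbrakk> \<Longrightarrow> d x y = 0 \<longleftrightarrow> x = y"
    and "\<And>x y z. \<lbrakk>x \<in> M; y \<in> M; z \<in> M\<rbrakk> \<Longrightarrow> d x z \<le> d x y + d y z"
  shows "metric_on M d"
  unfolding metric_on_def
proof
  fix x y z
  show "0 \<le> restrict_dist M d x y" using assms(1) by (simp add: restrict_dist_def)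
  show "restrict_dist M d x y = restrict_dist M d y x"
    using assms(2) by (simp add: restrict_dist_def)
  assume xy: "x \<in> M" "y \<in> M"
  then show "restrict_dist M d x y = 0 \<longleftrightarrow> x = y" using assms(3) by (simp add: restrict_dist_def)
  assume "z \<in> M"
  then show "restrict_dist M d x z \<le> restrict_dist M d x y + restrict_dist M d y z"
    using xy assms(4) by (simp add: restrict_dist_def)
qed

locale strict_linear_valuation = linear_valuation \<phi> for \<phi> :: "(real ^ 'n) set \<Rightarrow> real" +
  fixes k :: nat
  assumes strictly_monotone: "strictly_monotone_val k \<phi>" and k_le: "k \<le> CARD('n)"
begin

text \<open>Additivity removes the dimension bound: the bodies are compared after adding the unit ball to both,
  and the value of the ball cancels.\<close>

lemma strict_mono:
  assumes K: "K \<in> convex_bodies" and L: "L \<in> convex_bodies" and "K \<subset> L"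
  shows "\<phi> K < \<phi> L"
proof -
  let ?B = "cball 0 1 :: (real ^ 'n) set"
  have "K + ?B \<subset> L + ?B"
    using K \<open>K \<subset> L\<close> by (intro set_plus_cball_psubset convex_bodiesD)
  moreover have "K + ?B \<in> convex_bodies_dim k" "L + ?B \<in> convex_bodies_dim k"
    using K L k_le by (auto intro!: set_plus_cball_full_dim)
  ultimately have "\<phi> (K + ?B) < \<phi> (L + ?B)"
    using strictly_monotone by (simp add: strictly_monotone_val_def)
  then show ?thesis
    using Minkowski_additive[OF K convex_bodies_cball[of 1 0]]
      Minkowski_additive[OF L convex_bodies_cball[of 1 0]] by simp
qed

lemma positive:
  assumes K: "K \<in> convex_bodies_dim 1"
  shows "0 < \<phi> K"
proof -
  have K': "K \<in> convex_bodies" using K by (rule convex_bodies_dimD)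
  then obtain x where "x \<in> K" using convex_bodiesD(3) by blast
  moreover have "K \<noteq> {x}" using K by (auto simp: convex_bodies_dim_def)
  ultimately have "\<phi> {x} < \<phi> K" using K' by (intro strict_mono) (auto simp: convex_bodies_def)
  then show ?thesis by (simp add: singleton)
qed

lemma join_deviation_nonneg:
  assumes "K \<in> convex_bodies" "L \<in> convex_bodies"
  shows "0 \<le> join_deviation \<phi> K L"
proof -
  have "\<phi> K \<le> \<phi> (convex hull (K \<union> L))" "\<phi> L \<le> \<phi> (convex hull (K \<union> L))"
    using assms by (auto intro!: mono convex_bodies_hull_Un hull_inc)
  then show ?thesis by (simp add: join_deviation_def)
qed

lemma join_deviation_eq_0:
  assumes K: "K \<in> convex_bodies" and L: "L \<in> convex_bodies"
  shows "join_deviation \<phi> K L = 0 \<longleftrightarrow> K = L"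
proof
  assume *: "join_deviation \<phi> K L = 0"
  let ?H = "convex hull (K \<union> L)"
  have H: "?H \<in> convex_bodies" and sub: "K \<subseteq> ?H" "L \<subseteq> ?H"
    using K L by (auto intro: convex_bodies_hull_Un hull_inc)
  have "\<phi> K \<le> \<phi> ?H" "\<phi> L \<le> \<phi> ?H" using K L H sub by (auto intro: mono)
  then have "\<not> \<phi> K < \<phi> ?H" "\<not> \<phi> L < \<phi> ?H" using * by (auto simp: join_deviation_def)
  then have "K = ?H" "L = ?H" using strict_mono[OF K H] strict_mono[OF L H] sub by blast+
  then show "K = L" by simp
next
  assume "K = L"
  then show "join_deviation \<phi> K L = 0"
    using join_deviation_nested[of K L \<phi>] convex_bodiesD(2)[OF L] by simp
qed

lemma join_deviation_triangle:
  assumes K: "K \<in> convex_bodies" and L: "L \<in> convex_bodies" and M: "M \<in> convex_bodies"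
  shows "join_deviation \<phi> K M \<le> join_deviation \<phi> K L + join_deviation \<phi> L M"
proof -
  have H: "convex hull (K \<union> M) \<in> convex_bodies" "convex hull (K \<union> L) \<in> convex_bodies"
    "convex hull (L \<union> M) \<in> convex_bodies"
    using assms by (auto intro: convex_bodies_hull_Un)
  have "\<phi> (convex hull (K \<union> M) + L) \<le> \<phi> (convex hull (K \<union> L) + convex hull (L \<union> M))"
    using K L M H by (intro mono convex_bodies_set_plus hull_Un_plus_subset convex_bodiesD)
  then show ?thesis
    using Minkowski_additive[OF H(1) L] Minkowski_additive[OF H(2,3)]
    by (simp add: join_deviation_def)
qed

lemma join_deviation_le_meet_deviation:
  assumes K: "K \<in> convex_bodies" and L: "L \<in> convex_bodies" and "K \<inter> L \<noteq> {}"
  shows "join_deviation \<phi> K L \<le> meet_deviation \<phi> K L"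
proof -
  have KL: "K \<inter> L \<in> convex_bodies"
    using assms by (simp add: convex_bodies_def compact_Int convex_Int)
  have H: "convex hull (K \<union> L) \<in> convex_bodies" using K L by (rule convex_bodies_hull_Un)
  have "\<phi> (convex hull (K \<union> L) + (K \<inter> L)) \<le> \<phi> (K + L)"
    using K L H KL by (intro mono convex_bodies_set_plus hull_Un_plus_Int_subset convex_bodiesD)
  then show ?thesis
    using Minkowski_additive[OF H KL] Minkowski_additive[OF K L]
    by (simp add: join_deviation_def meet_deviation_def)
qed

lemma metric_on_join_deviation: "metric_on (convex_bodies_dim d) (join_deviation \<phi>)"
  by (intro metric_onI join_deviation_nonneg join_deviation_commute join_deviation_eq_0
      join_deviation_triangle convex_bodies_dimD)

lemma intrinsic_dist_meet_deviation:
  assumes K: "K \<in> convex_bodies_dim 1" and L: "L \<in> convex_bodies_dim 1"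
  shows "intrinsic_dist (convex_bodies_dim 1) (meet_deviation \<phi>) K L = ereal (join_deviation \<phi> K L)"
proof (rule antisym)
  let ?H = "convex hull (K \<union> L)"
  have bodies: "K \<in> convex_bodies" "L \<in> convex_bodies" using K L convex_bodies_dimD by auto
  then have H: "?H \<in> convex_bodies" by (rule convex_bodies_hull_Un)
  have sub: "K \<subseteq> ?H" "L \<subseteq> ?H" by (auto intro: hull_inc)
  define Y where "Y = (\<lambda>i :: nat. if i = 0 then K else if i = 1 then ?H else (L :: (real ^ 'n) set))"
  have "intrinsic_dist (convex_bodies_dim 1) (meet_deviation \<phi>) (Y 0) (Y 2)
      \<le> ereal (\<Sum>i<(2::nat). \<bar>\<phi> (Y (Suc i)) - \<phi> (Y i)\<bar>)"
  proof (rule intrinsic_dist_le_nested_chain[OF Val])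
    show "Y i \<in> convex_bodies_dim 1" for i
      using K L convex_bodies_dim_mono[OF K H sub(1)] by (simp add: Y_def)
    show "Y i \<subseteq> Y (Suc i) \<or> Y (Suc i) \<subseteq> Y i" if "i < 2" for i
      using that sub by (cases i) (auto simp: Y_def)
  qed (auto intro: mono strict_mono convex_bodies_dimD simp: meet_deviation_nested)
  also have "(\<Sum>i<(2::nat). \<bar>\<phi> (Y (Suc i)) - \<phi> (Y i)\<bar>) = join_deviation \<phi> K L"
    using mono[OF bodies(1) H sub(1)] mono[OF bodies(2) H sub(2)]
    by (simp add: Y_def numeral_2_eq_2 join_deviation_def)
  finally show "intrinsic_dist (convex_bodies_dim 1) (meet_deviation \<phi>) K L
      \<le> ereal (join_deviation \<phi> K L)" by (simp add: Y_def)
  show "ereal (join_deviation \<phi> K L)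
      \<le> intrinsic_dist (convex_bodies_dim 1) (meet_deviation \<phi>) K L"
  proof (rule intrinsic_dist_ge)
    fix A :: "(real ^ 'n) set" assume A: "A \<in> convex_bodies_dim 1"
    note A' = convex_bodies_dimD[OF A]
    show "join_deviation \<phi> A A = 0" using join_deviation_eq_0[OF A' A'] by simp
    \<comment> \<open>For disjoint bodies the meet-deviation is the sum of both values, so bodies closer to \<open>A\<close> than
      \<open>\<phi> A\<close> meet it.\<close>
    show "\<exists>e>0. \<forall>B\<in>convex_bodies_dim 1. meet_deviation \<phi> A B < e \<longrightarrow>
        join_deviation \<phi> A B \<le> meet_deviation \<phi> A B \<and> join_deviation \<phi> B A \<le> meet_deviation \<phi> B A"
    proof (intro exI[of _ "\<phi> A"] conjI ballI impI positive A)
      fix B :: "(real ^ 'n) set" assume "B \<in> convex_bodies_dim 1" and less: "meet_deviation \<phi> A B < \<phi> A"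
      then have B: "B \<in> convex_bodies" using convex_bodies_dimD by blast
      have "A \<inter> B \<noteq> {}"
        using less nonneg[OF B] Val_empty[OF Val] by (auto simp: meet_deviation_def)
      then show "join_deviation \<phi> A B \<le> meet_deviation \<phi> A B"
        and "join_deviation \<phi> B A \<le> meet_deviation \<phi> B A"
        using A' B by (auto intro!: join_deviation_le_meet_deviation)
    qed
  qed (auto intro: join_deviation_triangle convex_bodies_dimD)
qed

end

section \<open>Valuations of top degree are multiples of the volume\<close>

text \<open>Cauchy's functional equation on the half-line: nonnegativity gives monotonicity, and rounding
  \<open>n * s\<close> to an integer shows that \<open>n * \<bar>g s - s * g 1\<bar>\<close> stays bounded.\<close>

lemma additive_nonneg_linear:
  fixes g :: "real \<Rightarrow> real"
  assumes nonneg: "\<And>s. 0 \<le> s \<Longrightarrow> 0 \<le> g s"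
    and additive: "\<And>s t. 0 \<le> s \<Longrightarrow> 0 \<le> t \<Longrightarrow> g (s + t) = g s + g t"
    and s: "0 \<le> s"
  shows "g s = s * g 1"
proof -
  have nat_mult: "g (real n * t) = real n * g t" if "0 \<le> t" for n t
  proof (induction n)
    case 0
    show ?case using additive[of 0 0] by simp
  next
    case (Suc n)
    have "g (real (Suc n) * t) = g (real n * t + t)" by (simp add: algebra_simps)
    also have "\<dots> = g (real n * t) + g t" using that by (intro additive) auto
    finally show ?case using Suc by (simp add: algebra_simps)
  qed
  have mono: "g x \<le> g y" if "0 \<le> x" "x \<le> y" for x y
    using additive[of x "y - x"] nonneg[of "y - x"] that by simp
  have bound: "real n * \<bar>g s - s * g 1\<bar> \<le> g 1" for n
  proof -
    define m where "m = nat \<lfloor>real n * s\<rfloor>"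
    have "0 \<le> real n * s" using s by simp
    then have m: "real m \<le> real n * s" "real n * s \<le> real (Suc m)"
      unfolding m_def by linarith+
    have "g (real m * 1) \<le> g (real n * s)" "g (real n * s) \<le> g (real (Suc m) * 1)"
      using m s by (auto intro: mono)
    then have g: "real m * g 1 \<le> real n * g s" "real n * g s \<le> real (Suc m) * g 1"
      by (simp_all only: nat_mult[OF zero_le_one] nat_mult[OF s])
    have "0 \<le> g 1" by (simp add: nonneg)
    then have "real m * g 1 \<le> real n * s * g 1" "real n * s * g 1 \<le> real (Suc m) * g 1"
      using m by (auto intro: mult_right_mono)
    then have "\<bar>real n * g s - real n * s * g 1\<bar> \<le> g 1" using g by (simp add: algebra_simps)
    moreover have "real n * \<bar>g s - s * g 1\<bar> = \<bar>real n * g s - real n * s * g 1\<bar>"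
      by (simp add: abs_mult_pos' right_diff_distrib mult.assoc)
    ultimately show ?thesis by simp
  qed
  show ?thesis
  proof (rule ccontr)
    assume "g s \<noteq> s * g 1"
    then obtain n where "g 1 < real n * \<bar>g s - s * g 1\<bar>"
      using reals_Archimedean3[of "\<bar>g s - s * g 1\<bar>"] by auto
    then show False using bound[of n] by simp
  qed
qed

locale volume_valuation =
  fixes \<phi> :: "(real ^ 'n) set \<Rightarrow> real"
  assumes Val: "\<phi> \<in> Val"
    and homogeneous: "homogeneous_val CARD('n) \<phi>"
    and mono: "\<lbrakk>A \<in> convex_bodies; B \<in> convex_bodies; A \<subseteq> B\<rbrakk> \<Longrightarrow> \<phi> A \<le> \<phi> B"
    and nonneg: "A \<in> convex_bodies \<Longrightarrow> 0 \<le> \<phi> A"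
begin

definition box_value :: "('n \<Rightarrow> real) \<Rightarrow> real"
  where "box_value c = \<phi> (cbox 0 (\<chi> i. c i))"

lemma cbox_convex_bodies: "(\<And>i. 0 \<le> c i) \<Longrightarrow> cbox 0 (\<chi> i. c i) \<in> (convex_bodies :: (real ^ 'n) set set)"
  by (simp add: convex_bodies_def interval_ne_empty_cart)

lemma box_value_nonneg: "(\<And>i. 0 \<le> c i) \<Longrightarrow> 0 \<le> box_value c"
  unfolding box_value_def by (intro nonneg cbox_convex_bodies)

text \<open>A box cut orthogonally to the axis \<open>i\<close> falls into a box and a translated box, which share a face.\<close>

lemma box_value_cut:
  assumes c: "\<And>j. 0 \<le> c j" and st: "0 \<le> s" "0 \<le> t"
  shows "box_value (c(i := s + t)) + box_value (c(i := 0))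
    = box_value (c(i := s)) + box_value (c(i := t))"
proof -
  let ?B = "\<lambda>r. cbox 0 (\<chi> j. (c(i := r)) j) :: (real ^ 'n) set"
  let ?v = "axis i s :: real ^ 'n"
  have shift: "x \<in> (+) ?v ` ?B r \<longleftrightarrow>
      (s \<le> x $ i \<and> x $ i \<le> s + r) \<and> (\<forall>j. j \<noteq> i \<longrightarrow> 0 \<le> x $ j \<and> x $ j \<le> c j)" for x r
  proof -
    have "x \<in> (+) ?v ` ?B r \<longleftrightarrow> x - ?v \<in> ?B r"
      by (auto simp: image_iff intro!: bexI[of _ "x - ?v"])
    also have "\<dots> \<longleftrightarrow> (\<forall>j. 0 \<le> x $ j - axis i s $ j \<and> x $ j - axis i s $ j \<le> (c(i := r)) j)"
      by (simp add: mem_box_cart)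
    also have "\<dots> \<longleftrightarrow> (s \<le> x $ i \<and> x $ i \<le> s + r) \<and> (\<forall>j. j \<noteq> i \<longrightarrow> 0 \<le> x $ j \<and> x $ j \<le> c j)"
      by (auto simp: axis_def)
    finally show ?thesis .
  qed
  have mem: "x \<in> ?B r \<longleftrightarrow>
      (0 \<le> x $ i \<and> x $ i \<le> r) \<and> (\<forall>j. j \<noteq> i \<longrightarrow> 0 \<le> x $ j \<and> x $ j \<le> c j)" for x r
    by (auto simp: mem_box_cart)
  have Un: "?B s \<union> (+) ?v ` ?B t = ?B (s + t)"
    using st by (auto simp: set_eq_iff mem shift simp del: fun_upd_apply)
  have Int: "?B s \<inter> (+) ?v ` ?B t = (+) ?v ` ?B 0"
    using st by (auto simp: set_eq_iff mem shift simp del: fun_upd_apply)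
  have B: "?B r \<in> convex_bodies" if "0 \<le> r" for r
    using c that by (intro cbox_convex_bodies) simp
  have "\<phi> (?B s \<union> (+) ?v ` ?B t) + \<phi> (?B s \<inter> (+) ?v ` ?B t) = \<phi> (?B s) + \<phi> ((+) ?v ` ?B t)"
    using convex_bodiesD(1,2)[OF B[OF st(1)]]
      convex_bodiesD(1,2)[OF convex_bodies_translation[OF B[OF st(2)]]]
    by (intro Val_Un[OF Val]) (auto simp del: fun_upd_apply simp: Un)
  then show ?thesis
    unfolding Un Int box_value_def
    using Val_translation[OF Val B[OF st(2)]] Val_translation[OF Val B[OF order_refl]]
    by (simp del: fun_upd_apply)
qed

text \<open>Doubling one side at most doubles the value, since the face shared by the halves has nonnegative
  value. All sides but the one of length zero are doubled, which gives at most \<open>2 ^ (n - 1)\<close>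
  times the value, whereas homogeneity gives \<open>2 ^ n\<close> times.\<close>

lemma box_value_degenerate:
  assumes c: "\<And>j. 0 \<le> c j" and i: "c i = 0"
  shows "box_value c = 0"
proof -
  have double: "box_value (\<lambda>j. if j \<in> F then 2 * c j else c j) \<le> 2 ^ card F * box_value c"
    if "finite F" for F :: "'n set"
    using that
  proof (induction F)
    case (insert k F)
    let ?c = "\<lambda>j. if j \<in> F then 2 * c j else c j"
    have double_k: "(\<lambda>j. if j \<in> insert k F then 2 * c j else c j) = ?c(k := c k + c k)"
      using insert.hyps by auto
    have same: "?c(k := c k) = ?c" using insert.hyps by auto
    have "0 \<le> box_value (?c(k := 0))" using c by (intro box_value_nonneg) simp
    moreover have "box_value (?c(k := c k + c k)) + box_value (?c(k := 0))
        = box_value (?c(k := c k)) + box_value (?c(k := c k))"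
      using c by (intro box_value_cut) auto
    ultimately have "box_value (?c(k := c k + c k)) \<le> 2 * box_value ?c"
      unfolding same by linarith
    also have "\<dots> \<le> 2 * (2 ^ card F * box_value c)" using insert.IH by simp
    finally show ?case
      unfolding double_k using insert.hyps by (simp del: fun_upd_apply)
  qed simp
  have "(\<lambda>j. if j \<in> UNIV - {i} then 2 * c j else c j) = (\<lambda>j. 2 * c j)" using i by auto
  then have "box_value (\<lambda>j. 2 * c j) \<le> 2 ^ (CARD('n) - 1) * box_value c"
    using double[of "UNIV - {i}"] by simp
  moreover have "box_value (\<lambda>j. 2 * c j) = 2 ^ CARD('n) * box_value c"
  proof -
    have "(*\<^sub>R) 2 ` cbox 0 (\<chi> j. c j) = (cbox 0 (\<chi> j. 2 * c j) :: (real ^ 'n) set)"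
    proof -
      have "2 *\<^sub>R (\<chi> j. c j) = (\<chi> j. 2 * c j)" by (simp add: vec_eq_iff)
      then show ?thesis
        using image_smult_cbox[of 2 "0 :: real ^ 'n" "\<chi> j. c j"] convex_bodiesD(3)[OF cbox_convex_bodies[of c]] c
        by simp
    qed
    moreover have "\<phi> ((*\<^sub>R) 2 ` cbox 0 (\<chi> j. c j)) = 2 ^ CARD('n) * \<phi> (cbox 0 (\<chi> j. c j))"
      by (rule homogeneous[unfolded homogeneous_val_def, rule_format]) (use cbox_convex_bodies[OF c] in auto)
    ultimately show ?thesis by (simp only: box_value_def)
  qed
  moreover have "(2 :: real) ^ CARD('n) = 2 * 2 ^ (CARD('n) - 1)"
    by (simp add: power_eq_if)
  ultimately have "box_value c \<le> 0" by simp
  then show ?thesis using box_value_nonneg[of c] c by simp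
qed

lemma box_value_prod:
  assumes c: "\<And>j. 0 \<le> c j"
  shows "box_value c = box_value (\<lambda>_. 1) * (\<Prod>j\<in>UNIV. c j)"
proof -
  have linear: "box_value (d(i := s)) = s * box_value (d(i := 1))"
    if d: "\<And>j. 0 \<le> d j" and "0 \<le> s" for d i s
  proof (rule additive_nonneg_linear[OF _ _ \<open>0 \<le> s\<close>])
    show "0 \<le> box_value (d(i := r))" if "0 \<le> r" for r
      using d that by (intro box_value_nonneg) simp
    have "box_value (d(i := 0)) = 0" using d by (intro box_value_degenerate[of _ i]) auto
    then show "box_value (d(i := r + t)) = box_value (d(i := r)) + box_value (d(i := t))"
      if "0 \<le> r" "0 \<le> t" for r t
      using box_value_cut[of d r t i] d that by simp
  qed
  have "box_value (\<lambda>j. if j \<in> F then c j else 1) = box_value (\<lambda>_. 1) * (\<Prod>j\<in>F. c j)"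
    if "finite F" for F :: "'n set"
    using that
  proof (induction F)
    case (insert k F)
    let ?c = "\<lambda>j. if j \<in> F then c j else 1"
    have with_k: "(\<lambda>j. if j \<in> insert k F then c j else 1) = ?c(k := c k)"
      and without_k: "?c(k := 1) = ?c"
      using insert.hyps by auto
    have "box_value (?c(k := c k)) = c k * box_value (?c(k := 1))"
      using c by (intro linear) auto
    then show ?case
      unfolding with_k without_k insert.IH using insert.hyps by (simp del: fun_upd_apply)
  qed simp
  from this[of UNIV] show ?thesis by simp
qed

definition unit_cube_value :: real
  where "unit_cube_value = box_value (\<lambda>_. 1)"

lemma unit_cube_value_nonneg: "0 \<le> unit_cube_value"
  unfolding unit_cube_value_def by (intro box_value_nonneg) simp

lemma cbox_eq:
  assumes "cbox a b \<noteq> {}"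
  shows "\<phi> (cbox a b) = unit_cube_value * measure lborel (cbox a b)"
proof -
  have le: "0 \<le> b $ i - a $ i" for i using assms by (simp add: interval_ne_empty_cart)
  have "cbox a b = (+) a ` cbox 0 (\<chi> i. b $ i - a $ i)"
  proof -
    have "(\<chi> i. b $ i - a $ i) = b - a" by (simp add: vec_eq_iff)
    then show ?thesis using cbox_translation[of a 0 "b - a"] by simp
  qed
  then have "\<phi> (cbox a b) = box_value (\<lambda>i. b $ i - a $ i)"
    using Val_translation[OF Val cbox_convex_bodies[of "\<lambda>i. b $ i - a $ i"]] le
    by (simp add: box_value_def)
  then show ?thesis
    using box_value_prod[of "\<lambda>i. b $ i - a $ i"] le content_cbox_cart[OF assms]
    by (simp add: unit_cube_value_def)
qed

lemma le_content:
  assumes "compact A" "convex A" "A \<subseteq> cbox a b"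
  shows "0 \<le> \<phi> A" "\<phi> A \<le> unit_cube_value * measure lborel (cbox a b)"
proof -
  have "0 \<le> \<phi> A \<and> \<phi> A \<le> unit_cube_value * measure lborel (cbox a b)"
    using assms(1,2)
  proof (cases rule: compact_convex_cases)
    case 1
    then show ?thesis using Val_empty[OF Val] unit_cube_value_nonneg by simp
  next
    case 2
    then have ne: "cbox a b \<noteq> {}" using assms(3) convex_bodiesD(3) by blast
    then have "cbox a b \<in> convex_bodies" by (simp add: convex_bodies_def)
    then show ?thesis using mono[OF 2 _ assms(3)] nonneg[OF 2] cbox_eq[OF ne] by simp
  qed
  then show "0 \<le> \<phi> A" "\<phi> A \<le> unit_cube_value * measure lborel (cbox a b)" by auto
qed

text \<open>The two parts of a box meet in a degenerate box, on which \<open>\<phi>\<close> vanishes.\<close>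

lemma operative_Int:
  assumes K: "compact K" "convex K"
  shows "operative (+) 0 (\<lambda>B. \<phi> (K \<inter> B))"
proof
  fix a b :: "real ^ 'n"
  assume "box a b = {}"
  then have "measure lborel (cbox a b) = 0" by (simp add: content_eq_0_interior)
  then show "\<phi> (K \<inter> cbox a b) = 0"
    using le_content[of "K \<inter> cbox a b" a b] K by (auto simp: compact_Int convex_Int)
next
  fix a b k :: "real ^ 'n" and c
  assume k: "k \<in> Basis"
  let ?L = "cbox a b \<inter> {x. x \<bullet> k \<le> c}" and ?R = "cbox a b \<inter> {x. x \<bullet> k \<ge> c}"
  obtain u v where L: "?L = cbox u v" using interval_split(1)[OF k] by blast
  obtain w z where R: "?R = cbox w z" using interval_split(2)[OF k] by blast
  obtain p q where I: "?L \<inter> ?R = cbox p q"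
    unfolding L R Int_interval by blast
  have "negligible (cbox p q)"
    unfolding I[symmetric] by (rule negligible_subset[OF negligible_standard_hyperplane[OF k, of c]]) auto
  then have "measure lborel (cbox p q) = 0"
    using negligible_imp_measure0[of "cbox p q"] by (simp add: measure_completion)
  then have zero: "\<phi> (K \<inter> (?L \<inter> ?R)) = 0"
    using le_content[of "K \<inter> (?L \<inter> ?R)" p q] K unfolding I by (auto simp: compact_Int convex_Int)
  have Un: "(K \<inter> ?L) \<union> (K \<inter> ?R) = K \<inter> cbox a b" by auto
  have Int: "(K \<inter> ?L) \<inter> (K \<inter> ?R) = K \<inter> (?L \<inter> ?R)" by auto
  have "\<phi> ((K \<inter> ?L) \<union> (K \<inter> ?R)) + \<phi> ((K \<inter> ?L) \<inter> (K \<inter> ?R)) = \<phi> (K \<inter> ?L) + \<phi> (K \<inter> ?R)"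
  proof (rule Val_Un[OF Val])
    show "convex ((K \<inter> ?L) \<union> (K \<inter> ?R))" unfolding Un using K by (intro convex_Int convex_box)
  qed (unfold L R, use K in \<open>auto intro!: compact_Int convex_Int\<close>)
  then show "\<phi> (K \<inter> cbox a b) = \<phi> (K \<inter> ?L) + \<phi> (K \<inter> ?R)"
    unfolding Un Int zero by simp
qed

text \<open>The box function \<open>B \<mapsto> \<phi> (K \<inter> B)\<close> is additive over divisions and hence compared cell by cell with
  the Riemann sum of a multiple of the indicator of \<open>K\<close>. Sufficiently small cells whose
  tag is not on the boundary contribute equally to both. The other cells contribute little in
  total because the boundary of a convex set is negligible.\<close>

lemma eq_measure:
  assumes K: "compact K" "convex K"
  shows "\<phi> K = unit_cube_value * measure lebesgue K"
proof -
  obtain a where a: "K \<subseteq> cbox (- a) a"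
    using bounded_subset_cbox_symmetric[OF compact_imp_bounded[OF K(1)]] by blast
  let ?Q = "cbox (- a) a"
  let ?f = "\<lambda>x. unit_cube_value * indicat_real K x"
  have "(?f has_integral \<phi> K) ?Q"
    unfolding has_integral
  proof (intro allI impI)
    fix e :: real assume "e > 0"
    \<comment> \<open>The summand 1 covers the zero valuation.\<close>
    have pos: "0 < e / (unit_cube_value + 1)" using \<open>e > 0\<close> unit_cube_value_nonneg by simp
    have "(indicat_real (frontier K) has_integral 0) ?Q"
      using negligible_convex_frontier[OF K(2)] by (simp add: negligible_def)
    then obtain \<gamma> where \<gamma>: "gauge \<gamma>" and small: "\<And>D. D tagged_division_of ?Q \<Longrightarrow> \<gamma> fine D \<Longrightarrow>
        \<bar>\<Sum>(x, B)\<in>D. measure lborel B *\<^sub>R indicat_real (frontier K) x\<bar> < e / (unit_cube_value + 1)"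
      using pos unfolding has_integral by (auto simp: real_norm_def)
    \<comment> \<open>Fine cells with tag in the interior lie inside \<open>K\<close>, and those with tag outside \<open>K\<close> miss it.\<close>
    define \<beta> where "\<beta> = (\<lambda>x. if x \<in> interior K then interior K else if x \<in> K then UNIV else - K)"
    have "gauge \<beta>"
      using compact_imp_closed[OF K(1)] by (auto simp: gauge_def \<beta>_def)
    show "\<exists>\<gamma>. gauge \<gamma> \<and> (\<forall>D. D tagged_division_of ?Q \<and> \<gamma> fine D \<longrightarrow>
        norm ((\<Sum>(x, B)\<in>D. measure lborel B *\<^sub>R ?f x) - \<phi> K) < e)"
    proof (intro exI[of _ "\<lambda>x. \<gamma> x \<inter> \<beta> x"] conjI allI impI)
      show "gauge (\<lambda>x. \<gamma> x \<inter> \<beta> x)" using \<gamma> \<open>gauge \<beta>\<close> by (rule gauge_Int)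
      fix D assume D: "D tagged_division_of ?Q \<and> (\<lambda>x. \<gamma> x \<inter> \<beta> x) fine D"
      then have div: "D tagged_division_of ?Q" and fine: "\<gamma> fine D" "\<beta> fine D"
        by (auto simp: fine_Int)
      have local: "\<bar>measure lborel B *\<^sub>R ?f x - \<phi> (K \<inter> B)\<bar>
          \<le> unit_cube_value * (measure lborel B *\<^sub>R indicat_real (frontier K) x)" if xB: "(x, B) \<in> D" for x B
      proof -
        obtain u v where B: "B = cbox u v" using tagged_division_ofD(4)[OF div xB] by blast
        have "x \<in> B" using tagged_division_ofD(2)[OF div that] .
        then have ne: "cbox u v \<noteq> {}" using B by blast
        have sub: "B \<subseteq> \<beta> x" using fine(2) that by (auto simp: fine_def)
        have bounds: "0 \<le> \<phi> (K \<inter> B)" "\<phi> (K \<inter> B) \<le> unit_cube_value * measure lborel B"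
          using le_content[of "K \<inter> B" u v] K by (auto simp: B compact_Int convex_Int)
        consider "x \<in> interior K" | "x \<notin> K" | "x \<in> K" "x \<notin> interior K" by blast
        then show ?thesis
        proof cases
          case 1
          then have "B \<subseteq> K" "x \<in> K" using sub interior_subset[of K] by (auto simp: \<beta>_def)
          then have "K \<inter> B = cbox u v" using B by auto
          then show ?thesis using cbox_eq[OF ne] B \<open>x \<in> K\<close> 1 by (simp add: frontier_def)
        next
          case 2
          then have "K \<inter> B = {}" using sub interior_subset[of K] by (auto simp: \<beta>_def split: if_splits)
          then show ?thesis using 2 Val_empty[OF Val] unit_cube_value_nonneg by simp
        next
          case 3
          then have "x \<in> frontier K" using closure_subset[of K] by (auto simp: frontier_def)
          then show ?thesis using 3 bounds by (simp add: mult.commute)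
        qed
      qed
      have "\<phi> K = (\<Sum>(x, B)\<in>D. \<phi> (K \<inter> B))"
        using operative.tagged_division[OF operative_Int[OF K] div, folded sum_def] a by (simp add: Int_absorb2)
      then have "(\<Sum>(x, B)\<in>D. measure lborel B *\<^sub>R ?f x) - \<phi> K
          = (\<Sum>(x, B)\<in>D. measure lborel B *\<^sub>R ?f x - \<phi> (K \<inter> B))"
        by (simp add: sum_subtractf split_def)
      then have "\<bar>(\<Sum>(x, B)\<in>D. measure lborel B *\<^sub>R ?f x) - \<phi> K\<bar>
          \<le> (\<Sum>(x, B)\<in>D. \<bar>measure lborel B *\<^sub>R ?f x - \<phi> (K \<inter> B)\<bar>)"
        by (simp only: split_def) (rule sum_abs)
      also have "\<dots> \<le> (\<Sum>(x, B)\<in>D. unit_cube_value * (measure lborel B *\<^sub>R indicat_real (frontier K) x))"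
        by (rule sum_mono) (use local in auto)
      also have "\<dots> = unit_cube_value * (\<Sum>(x, B)\<in>D. measure lborel B *\<^sub>R indicat_real (frontier K) x)"
        by (simp add: sum_distrib_left split_def)
      also have "\<dots> \<le> unit_cube_value * (e / (unit_cube_value + 1))"
        using small[OF div fine(1)] unit_cube_value_nonneg by (intro mult_left_mono) auto
      also have "\<dots> < e" using \<open>e > 0\<close> unit_cube_value_nonneg by (simp add: field_simps)
      finally show "norm ((\<Sum>(x, B)\<in>D. measure lborel B *\<^sub>R ?f x) - \<phi> K) < e" by simp
    qed
  qed
  then have "\<phi> K = integral ?Q ?f"
    by (rule Henstock_Kurzweil_Integration.integral_unique[symmetric])
  also have "\<dots> = unit_cube_value * integral ?Q (indicat_real K)"
    by (rule Henstock_Kurzweil_Integration.integral_mult_right)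
  also have "integral ?Q (indicat_real K) = measure lebesgue K"
  proof -
    have "K \<inter> ?Q = K" using a by auto
    then show ?thesis
      using Equivalence_Lebesgue_Henstock_Integration.integral_indicator[of K ?Q] lmeasurable_compact[OF K(1)]
      by simp
  qed
  finally show ?thesis .
qed

end

section \<open>Intrinsic distances in top degree\<close>

locale strict_volume_valuation = volume_valuation \<phi> for \<phi> :: "(real ^ 'n) set \<Rightarrow> real" +
  fixes k :: nat
  assumes strictly_monotone: "strictly_monotone_val k \<phi>" and k_le: "k \<le> CARD('n)"
begin

abbreviation full_bodies :: "(real ^ 'n) set set"
  where "full_bodies \<equiv> convex_bodies_dim CARD('n)"

lemma full_bodies_dim_k: "A \<in> full_bodies \<Longrightarrow> A \<in> convex_bodies_dim k"
  using k_le by (simp add: convex_bodies_dim_def)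

lemma strict_mono: "A \<in> full_bodies \<Longrightarrow> B \<in> full_bodies \<Longrightarrow> A \<subset> B \<Longrightarrow> \<phi> A < \<phi> B"
  using strictly_monotone full_bodies_dim_k unfolding strictly_monotone_val_def by blast

lemma positive: "A \<in> full_bodies \<Longrightarrow> 0 < \<phi> A"
proof -
  assume A: "A \<in> full_bodies"
  have "{} \<subset> A" using convex_bodiesD(3)[OF convex_bodies_dimD[OF A]] by blast
  then have "\<phi> {} < \<phi> A"
    using strictly_monotone full_bodies_dim_k[OF A] unfolding strictly_monotone_val_def by blast
  then show ?thesis by (simp add: Val_empty[OF Val])
qed

text \<open>A convex set without interior is negligible.\<close>

lemma low_dim_zero:
  assumes "compact A" "convex A" "aff_dim A < int CARD('n)"
  shows "\<phi> A = 0"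
proof -
  have "interior A = {}" using assms(3) aff_dim_nonempty_interior[of A] by auto
  then have "negligible A" using negligible_convex_interior[OF assms(2)] by simp
  then show ?thesis using eq_measure[OF assms(1,2)] negligible_imp_measure0[of A] by simp
qed

lemma Int_full_or_zero:
  assumes "K \<in> convex_bodies" "L \<in> convex_bodies"
  obtains "K \<inter> L \<in> full_bodies" | "\<phi> (K \<inter> L) = 0"
proof (cases "K \<inter> L \<in> full_bodies")
  case False
  have cc: "compact (K \<inter> L)" "convex (K \<inter> L)"
    using assms by (auto simp: convex_bodies_def compact_Int convex_Int)
  show thesis
  proof (cases "K \<inter> L = {}")
    case True
    then show thesis using that(2) Val_empty[OF Val] by simp
  next
    case ne: False
    then have "aff_dim (K \<inter> L) < int CARD('n)"
      using False cc by (auto simp: convex_bodies_dim_def convex_bodies_def)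
    then show thesis using that(2) low_dim_zero[OF cc] by simp
  qed
qed (rule that(1))

lemma Int_le:
  assumes "K \<in> convex_bodies" "L \<in> convex_bodies"
  shows "\<phi> (K \<inter> L) \<le> \<phi> K" "\<phi> (K \<inter> L) \<le> \<phi> L" "0 \<le> \<phi> (K \<inter> L)"
proof -
  have "\<phi> (K \<inter> L) \<le> \<phi> K \<and> \<phi> (K \<inter> L) \<le> \<phi> L \<and> 0 \<le> \<phi> (K \<inter> L)"
  proof (cases "K \<inter> L = {}")
    case True
    then show ?thesis using nonneg assms Val_empty[OF Val] by simp
  next
    case False
    then have "K \<inter> L \<in> convex_bodies"
      using assms by (simp add: convex_bodies_def compact_Int convex_Int)
    then show ?thesis using mono nonneg assms by simp
  qed
  then show "\<phi> (K \<inter> L) \<le> \<phi> K" "\<phi> (K \<inter> L) \<le> \<phi> L" "0 \<le> \<phi> (K \<inter> L)" by auto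
qed

lemma meet_deviation_eq_0:
  assumes K: "K \<in> full_bodies" and L: "L \<in> full_bodies"
  shows "meet_deviation \<phi> K L = 0 \<longleftrightarrow> K = L"
proof
  assume 0: "meet_deviation \<phi> K L = 0"
  note bodies = K[THEN convex_bodies_dimD] L[THEN convex_bodies_dimD]
  from bodies show "K = L"
  proof (cases rule: Int_full_or_zero)
    case 1
    have "\<not> \<phi> (K \<inter> L) < \<phi> K" "\<not> \<phi> (K \<inter> L) < \<phi> L"
      using 0 Int_le[OF bodies] by (auto simp: meet_deviation_def)
    then have "K \<inter> L = K" "K \<inter> L = L" using strict_mono[OF 1 K] strict_mono[OF 1 L] by blast+
    then show ?thesis by blast
  next
    case 2
    then show ?thesis using 0 positive[OF K] positive[OF L] by (simp add: meet_deviation_def)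
  qed
qed (simp add: meet_deviation_def)

text \<open>The union of \<open>K \<inter> L\<close> and \<open>L \<inter> M\<close> lies in \<open>L\<close>, and their intersection lies in \<open>K \<inter> M\<close>.\<close>

lemma meet_deviation_triangle:
  assumes "K \<in> convex_bodies" "L \<in> convex_bodies" "M \<in> convex_bodies"
  shows "meet_deviation \<phi> K M \<le> meet_deviation \<phi> K L + meet_deviation \<phi> L M"
proof -
  let ?m = "measure lebesgue"
  have cc: "compact K" "compact L" "compact M" "convex K" "convex L" "convex M"
    using assms by (auto simp: convex_bodies_def)
  have meas: "K \<inter> L \<in> lmeasurable" "L \<inter> M \<in> lmeasurable" "K \<inter> M \<in> lmeasurable" "L \<in> lmeasurable"
    using cc by (auto intro!: lmeasurable_compact compact_Int)
  have "?m (K \<inter> L) + ?m (L \<inter> M) = ?m ((K \<inter> L) \<union> (L \<inter> M)) + ?m ((K \<inter> L) \<inter> (L \<inter> M))"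
    using measure_Un3[OF meas(1,2)] by simp
  also have "\<dots> \<le> ?m L + ?m (K \<inter> M)"
    using meas by (intro add_mono measure_mono_fmeasurable) (auto intro: fmeasurableD)
  finally have "unit_cube_value * (?m (K \<inter> L) + ?m (L \<inter> M))
      \<le> unit_cube_value * (?m L + ?m (K \<inter> M))"
    using unit_cube_value_nonneg by (rule mult_left_mono)
  then show ?thesis
    using cc by (simp add: meet_deviation_def eq_measure compact_Int convex_Int distrib_left)
qed

lemma meet_deviation_le_join_deviation:
  assumes "K \<in> convex_bodies" "L \<in> convex_bodies"
  shows "meet_deviation \<phi> K L \<le> join_deviation \<phi> K L"
proof -
  let ?m = "measure lebesgue" and ?H = "convex hull (K \<union> L)"
  have cc: "compact K" "compact L" "convex K" "convex L"
    using assms by (auto simp: convex_bodies_def)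
  then have H: "compact ?H" by (simp add: compact_convex_hull compact_Un)
  have meas: "K \<in> lmeasurable" "L \<in> lmeasurable" "?H \<in> lmeasurable"
    using cc H by (auto intro!: lmeasurable_compact)
  have "?m K + ?m L = ?m (K \<union> L) + ?m (K \<inter> L)" using measure_Un3[OF meas(1,2)] by simp
  also have "\<dots> \<le> ?m ?H + ?m (K \<inter> L)"
    using meas by (intro add_right_mono measure_mono_fmeasurable)
      (auto intro: fmeasurableD hull_inc)
  finally have "unit_cube_value * (?m K + ?m L) \<le> unit_cube_value * (?m ?H + ?m (K \<inter> L))"
    using unit_cube_value_nonneg by (rule mult_left_mono)
  then show ?thesis
    using cc H by (simp add: meet_deviation_def join_deviation_def eq_measure compact_Int
        convex_Int distrib_left)
qed

lemma metric_on_meet_deviation: "metric_on full_bodies (meet_deviation \<phi>)"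
proof (intro metric_onI meet_deviation_commute meet_deviation_eq_0 meet_deviation_triangle
    convex_bodies_dimD)
  fix K L assume "K \<in> full_bodies" "L \<in> full_bodies"
  then show "0 \<le> meet_deviation \<phi> K L"
    using Int_le[of K L] by (auto simp: meet_deviation_def dest!: convex_bodies_dimD)
qed

lemma intrinsic_dist_chain:
  assumes "\<And>i. i \<le> N \<Longrightarrow> Y i \<in> full_bodies"
    and "\<And>i. i < N \<Longrightarrow> Y i \<subseteq> Y (Suc i) \<or> Y (Suc i) \<subseteq> Y i" and "0 < N"
  shows "intrinsic_dist full_bodies (join_deviation \<phi>) (Y 0) (Y N)
           \<le> ereal (\<Sum>i<N. \<bar>\<phi> (Y (Suc i)) - \<phi> (Y i)\<bar>)"
proof (rule intrinsic_dist_le_nested_chain[OF Val])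
  fix A B :: "(real ^ 'n) set" assume "A \<in> full_bodies" "B \<in> full_bodies" "A \<subseteq> B"
  then show "join_deviation \<phi> A B = \<phi> B - \<phi> A \<and> join_deviation \<phi> B A = \<phi> B - \<phi> A"
    using convex_bodiesD(2)[OF convex_bodies_dimD] by (intro join_deviation_nested) auto
qed (use assms mono strict_mono in auto)

text \<open>The homothetic copy of \<open>K\<close> with centre \<open>p\<close> and ratio \<open>e\<close>.\<close>

lemma shrunk_copy:
  assumes K: "K \<in> full_bodies" and p: "p \<in> K" and e: "0 < e" "e \<le> 1"
  defines "K' \<equiv> (+) ((1 - e) *\<^sub>R p) ` (*\<^sub>R) e ` K"
  shows "K' \<in> full_bodies" "K' \<subseteq> K" "p \<in> K'"
    and "K \<subseteq> cball p R \<Longrightarrow> K' \<subseteq> cball p (e * R)"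
proof -
  note bodies = convex_bodies_dimD[OF K]
  have "aff_dim K' = aff_dim ((*\<^sub>R) e ` K)" unfolding K'_def by (rule aff_dim_translation_eq)
  also have "\<dots> = aff_dim K"
    using e by (intro aff_dim_injective_linear_image linear_scaleR) (auto simp: inj_def)
  finally show "K' \<in> full_bodies"
    using K bodies unfolding convex_bodies_dim_def K'_def
    by (auto intro: convex_bodies_translation convex_bodies_scaling)
  show "K' \<subseteq> K"
    using convexD[OF convex_bodiesD(2)[OF bodies] p, of _ "1 - e" e] e by (auto simp: K'_def)
  have "p = (1 - e) *\<^sub>R p + e *\<^sub>R p" by (simp add: scaleR_left_diff_distrib)
  then show "p \<in> K'" using p unfolding K'_def by blast
  show "K' \<subseteq> cball p (e * R)" if R: "K \<subseteq> cball p R"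
  proof
    fix x assume "x \<in> K'"
    then obtain y where y: "y \<in> K" "x = (1 - e) *\<^sub>R p + e *\<^sub>R y" by (auto simp: K'_def)
    have "p - x = e *\<^sub>R (p - y)" using y(2) by (simp add: algebra_simps)
    then have "dist p x = e * dist p y" using e by (simp add: dist_norm)
    moreover have "dist p y \<le> R" using R y(1) by auto
    ultimately show "x \<in> cball p (e * R)" using e by simp
  qed
qed

text \<open>The chain is \<open>K, A, conv (A \<union> B), B, L\<close> for small copies \<open>A\<close> of \<open>K\<close> and \<open>B\<close> of \<open>L\<close>. Its hull tends to a
  segment, on which \<open>\<phi>\<close> vanishes as the dimension is at least two.\<close>

lemma intrinsic_dist_join_deviation_upper:
  assumes K: "K \<in> full_bodies" and L: "L \<in> full_bodies" and n: "1 < CARD('n)"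
  shows "intrinsic_dist full_bodies (join_deviation \<phi>) K L \<le> ereal (\<phi> K + \<phi> L)"
proof -
  let ?d = "intrinsic_dist full_bodies (join_deviation \<phi>) K L"
  note bodies = K[THEN convex_bodies_dimD] L[THEN convex_bodies_dimD]
  obtain p q where p: "p \<in> K" and q: "q \<in> L" using bodies convex_bodiesD(3) by blast
  obtain R where "\<forall>y\<in>K. dist p y \<le> R"
    using convex_bodiesD(5)[OF bodies(1)] unfolding bounded_any_center[of _ p] by blast
  then have R: "K \<subseteq> cball p R" by auto
  obtain S where "\<forall>y\<in>L. dist q y \<le> S"
    using convex_bodiesD(5)[OF bodies(2)] unfolding bounded_any_center[of _ q] by blast
  then have S: "L \<subseteq> cball q S" by auto
  define T where "T = max R S"
  have T: "K \<subseteq> cball p T" "L \<subseteq> cball q T" using R S by (auto simp: T_def)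
  define e where "e = (\<lambda>j. 1 / real (Suc j))"
  have e: "0 < e j" "e j \<le> 1" for j by (auto simp: e_def)
  define A where "A = (\<lambda>j. (+) ((1 - e j) *\<^sub>R p) ` (*\<^sub>R) (e j) ` K)"
  define B where "B = (\<lambda>j. (+) ((1 - e j) *\<^sub>R q) ` (*\<^sub>R) (e j) ` L)"
  define H where "H = (\<lambda>j. convex hull (A j \<union> B j))"
  have A: "A j \<in> full_bodies" "A j \<subseteq> K" "p \<in> A j" "A j \<subseteq> cball p (e j * T)" for j
    using shrunk_copy(1-3)[OF K p e] shrunk_copy(4)[OF K p e T(1)] unfolding A_def by simp_all
  have B: "B j \<in> full_bodies" "B j \<subseteq> L" "q \<in> B j" "B j \<subseteq> cball q (e j * T)" for j
    using shrunk_copy(1-3)[OF L q e] shrunk_copy(4)[OF L q e T(2)] unfolding B_def by simp_all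
  have H_bodies: "H j \<in> convex_bodies" for j
    unfolding H_def using A(1) B(1) convex_bodies_dimD by (intro convex_bodies_hull_Un) blast+
  have AH: "A j \<subseteq> H j" and BH: "B j \<subseteq> H j" for j unfolding H_def by (auto intro: hull_inc)
  have H: "H j \<in> full_bodies" for j using convex_bodies_dim_mono[OF A(1) H_bodies AH] .
  have step: "?d \<le> ereal (\<phi> K + \<phi> L + 2 * \<phi> (H j))" for j
  proof -
    define Y where "Y = (\<lambda>i :: nat. if i = 0 then K else if i = 1 then A j else if i = 2 then H j
      else if i = 3 then B j else L)"
    have "intrinsic_dist full_bodies (join_deviation \<phi>) (Y 0) (Y 4)
        \<le> ereal (\<Sum>i<(4::nat). \<bar>\<phi> (Y (Suc i)) - \<phi> (Y i)\<bar>)"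
    proof (rule intrinsic_dist_chain)
      show "Y i \<in> full_bodies" for i using K L A B H by (simp add: Y_def)
      show "Y i \<subseteq> Y (Suc i) \<or> Y (Suc i) \<subseteq> Y i" if "i < 4" for i
      proof -
        have "i = 0 \<or> i = 1 \<or> i = 2 \<or> i = 3" using that by linarith
        then show ?thesis using A(2) B(2) AH BH by (auto simp: Y_def)
      qed
    qed simp
    moreover have "(\<Sum>i<(4::nat). \<bar>\<phi> (Y (Suc i)) - \<phi> (Y i)\<bar>) \<le> \<phi> K + \<phi> L + 2 * \<phi> (H j)"
    proof -
      have "(\<Sum>i<(4::nat). \<bar>\<phi> (Y (Suc i)) - \<phi> (Y i)\<bar>)
          = \<bar>\<phi> (A j) - \<phi> K\<bar> + \<bar>\<phi> (H j) - \<phi> (A j)\<bar> + \<bar>\<phi> (B j) - \<phi> (H j)\<bar> + \<bar>\<phi> L - \<phi> (B j)\<bar>"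
        by (simp add: Y_def eval_nat_numeral)
      moreover have "\<phi> (A j) \<le> \<phi> K" "\<phi> (B j) \<le> \<phi> L" "\<phi> (A j) \<le> \<phi> (H j)" "\<phi> (B j) \<le> \<phi> (H j)"
        by (rule mono[OF convex_bodies_dimD[OF A(1)] bodies(1) A(2)]
            mono[OF convex_bodies_dimD[OF B(1)] bodies(2) B(2)]
            mono[OF convex_bodies_dimD[OF A(1)] H_bodies AH]
            mono[OF convex_bodies_dimD[OF B(1)] H_bodies BH])+
      moreover have "0 \<le> \<phi> (A j)" "0 \<le> \<phi> (B j)"
        by (rule nonneg[OF convex_bodies_dimD[OF A(1)]] nonneg[OF convex_bodies_dimD[OF B(1)]])+
      ultimately show ?thesis by linarith
    qed
    ultimately show ?thesis unfolding Y_def by (auto intro: order_trans)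
  qed
  have seg: "closed_segment p q \<in> convex_bodies" by (simp add: convex_bodies_def)
  have "\<phi> (closed_segment p q) = 0"
  proof (rule low_dim_zero)
    have "aff_dim (closed_segment p q) \<le> 1"
      using aff_dim_le_card[of "{p, q}"] card_insert_le_m1[of 2 "{q}" p]
      by (simp add: segment_convex_hull aff_dim_convex_hull)
    then show "aff_dim (closed_segment p q) < int CARD('n)" using n by simp
  qed auto
  moreover have "(\<lambda>j. \<phi> (H j)) \<longlonglongrightarrow> \<phi> (closed_segment p q)"
  proof (rule Val_tendsto[OF Val seg, where r = "\<lambda>j. e j * T"],
      intro always_eventually allI conjI ballI H_bodies)
    have "e \<longlonglongrightarrow> 0" using LIMSEQ_inverse_real_of_nat by (simp add: e_def inverse_eq_divide)
    then show "(\<lambda>j. e j * T) \<longlonglongrightarrow> 0" by (rule tendsto_mult_left_zero)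
    fix j x
    have "0 \<le> T" using T(1) p by auto
    then have eT: "0 \<le> e j * T" using e(1)[of j] by simp
    have "closed_segment p q \<subseteq> H j"
      using A(3) B(3) AH BH convex_bodiesD(2)[OF H_bodies] by (intro closed_segment_subset) blast+
    then show "\<exists>y\<in>H j. dist x y \<le> e j * T" if "x \<in> closed_segment p q"
      using that eT by (intro bexI[of _ x]) auto
    have "H j \<subseteq> closed_segment p q + cball 0 (e j * T)"
      unfolding H_def
    proof (rule hull_minimal)
      have cball: "cball z (e j * T) \<subseteq> closed_segment p q + cball 0 (e j * T)"
        if "z \<in> closed_segment p q" for z
      proof
        fix y assume "y \<in> cball z (e j * T)"
        then have "z + (y - z) \<in> closed_segment p q + cball 0 (e j * T)"
          using that by (intro set_plus_intro) (auto simp: dist_norm norm_minus_commute)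
        then show "y \<in> closed_segment p q + cball 0 (e j * T)" by simp
      qed
      show "A j \<union> B j \<subseteq> closed_segment p q + cball 0 (e j * T)"
        using A(4)[of j] B(4)[of j] cball[of p] cball[of q] by auto
    qed (intro convex_set_plus convex_closed_segment convex_cball)
    then show "\<exists>y\<in>closed_segment p q. dist x y \<le> e j * T" if "x \<in> H j"
    proof -
      obtain y c where "y \<in> closed_segment p q" "c \<in> cball 0 (e j * T)" "x = y + c"
        using \<open>x \<in> H j\<close> \<open>H j \<subseteq> closed_segment p q + cball 0 (e j * T)\<close>
        by (auto elim!: set_plus_elim dest!: subsetD)
      then show ?thesis by (intro bexI[of _ y]) (auto simp: dist_norm)
    qed
  qed
  ultimately have "(\<lambda>j. \<phi> (H j)) \<longlonglongrightarrow> 0" by simp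
  then have "(\<lambda>j. \<phi> K + \<phi> L + 2 * \<phi> (H j)) \<longlonglongrightarrow> \<phi> K + \<phi> L + 2 * 0"
    by (intro tendsto_intros)
  then have "(\<lambda>j. ereal (\<phi> K + \<phi> L + 2 * \<phi> (H j))) \<longlonglongrightarrow> ereal (\<phi> K + \<phi> L)"
    by simp
  then show ?thesis by (rule LIMSEQ_le_const) (use step in blast)
qed

lemma intrinsic_dist_join_deviation:
  assumes K: "K \<in> full_bodies" and L: "L \<in> full_bodies" and n: "1 < CARD('n)"
  shows "intrinsic_dist full_bodies (join_deviation \<phi>) K L = ereal (meet_deviation \<phi> K L)"
proof (rule antisym)
  note bodies = K[THEN convex_bodies_dimD] L[THEN convex_bodies_dimD]
  from bodies show "intrinsic_dist full_bodies (join_deviation \<phi>) K L \<le> ereal (meet_deviation \<phi> K L)"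
  proof (cases rule: Int_full_or_zero)
    case 1
    define Y where "Y = (\<lambda>i :: nat. if i = 0 then K else if i = 1 then K \<inter> L else L)"
    have "intrinsic_dist full_bodies (join_deviation \<phi>) (Y 0) (Y 2)
        \<le> ereal (\<Sum>i<(2::nat). \<bar>\<phi> (Y (Suc i)) - \<phi> (Y i)\<bar>)"
    proof (rule intrinsic_dist_chain)
      show "Y i \<in> full_bodies" for i using K L 1 by (simp add: Y_def)
      show "Y i \<subseteq> Y (Suc i) \<or> Y (Suc i) \<subseteq> Y i" if "i < 2" for i
        using that by (cases i) (auto simp: Y_def)
    qed simp
    also have "(\<Sum>i<(2::nat). \<bar>\<phi> (Y (Suc i)) - \<phi> (Y i)\<bar>) = meet_deviation \<phi> K L"
      using Int_le[OF bodies] by (simp add: Y_def numeral_2_eq_2 meet_deviation_def)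
    finally show ?thesis by (simp add: Y_def)
  next
    case 2
    then show ?thesis
      using intrinsic_dist_join_deviation_upper[OF K L n] by (simp add: meet_deviation_def)
  qed
  show "ereal (meet_deviation \<phi> K L) \<le> intrinsic_dist full_bodies (join_deviation \<phi>) K L"
  proof (rule intrinsic_dist_ge)
    show "meet_deviation \<phi> A A = 0" for A by (simp add: meet_deviation_def)
    show "\<exists>e>0. \<forall>B\<in>full_bodies. join_deviation \<phi> A B < e \<longrightarrow>
        meet_deviation \<phi> A B \<le> join_deviation \<phi> A B \<and> meet_deviation \<phi> B A \<le> join_deviation \<phi> B A"
      if "A \<in> full_bodies" for A
      using that meet_deviation_le_join_deviation convex_bodies_dimD
      by (intro exI[of _ 1]) auto
  qed (auto intro: meet_deviation_triangle convex_bodies_dimD)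
qed

end

theorem theorem1p2:
  fixes \<phi> :: "(real ^ 'n) set \<Rightarrow> real" and k :: nat
  assumes "k \<in> {1..CARD('n)}"
    and "\<phi> \<in> Val"
    and "strictly_monotone_val k \<phi>"
  shows "(homogeneous_val 1 \<phi> \<longrightarrow>
            metric_on (convex_bodies_dim 1) (join_deviation \<phi>) \<and>
            (\<forall>K\<in>convex_bodies_dim 1. \<forall>L\<in>convex_bodies_dim 1.
               intrinsic_dist (convex_bodies_dim 1) (meet_deviation \<phi>) K L
                 = ereal (join_deviation \<phi> K L))) \<and>
         (CARD('n) > 1 \<and> homogeneous_val (CARD('n)) \<phi> \<longrightarrow>
            metric_on (convex_bodies_dim CARD('n)) (meet_deviation \<phi>) \<and>
            (\<forall>K\<in>convex_bodies_dim CARD('n). \<forall>L\<in>convex_bodies_dim CARD('n).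
               intrinsic_dist (convex_bodies_dim CARD('n)) (join_deviation \<phi>) K L
                 = ereal (meet_deviation \<phi> K L)))"
proof (intro conjI impI)
  have k: "k \<le> CARD('n)" using assms(1) by simp
  note mono = monotone_on_convex_bodies[OF assms(2,3) k]
  show "metric_on (convex_bodies_dim 1) (join_deviation \<phi>)"
    and "\<forall>K\<in>convex_bodies_dim 1. \<forall>L\<in>convex_bodies_dim 1.
      intrinsic_dist (convex_bodies_dim 1) (meet_deviation \<phi>) K L = ereal (join_deviation \<phi> K L)"
    if "homogeneous_val 1 \<phi>"
  proof -
    have \<phi>: "strict_linear_valuation \<phi> k"
      using that assms k mono by unfold_locales
    show "metric_on (convex_bodies_dim 1) (join_deviation \<phi>)"
      by (rule strict_linear_valuation.metric_on_join_deviation[OF \<phi>])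
    show "\<forall>K\<in>convex_bodies_dim 1. \<forall>L\<in>convex_bodies_dim 1.
      intrinsic_dist (convex_bodies_dim 1) (meet_deviation \<phi>) K L = ereal (join_deviation \<phi> K L)"
      by (intro ballI strict_linear_valuation.intrinsic_dist_meet_deviation[OF \<phi>])
  qed
  show "metric_on (convex_bodies_dim CARD('n)) (meet_deviation \<phi>)"
    and "\<forall>K\<in>convex_bodies_dim CARD('n). \<forall>L\<in>convex_bodies_dim CARD('n).
      intrinsic_dist (convex_bodies_dim CARD('n)) (join_deviation \<phi>) K L
        = ereal (meet_deviation \<phi> K L)"
    if "CARD('n) > 1 \<and> homogeneous_val CARD('n) \<phi>"
  proof -
    have \<phi>: "strict_volume_valuation \<phi> k"
      using that assms k mono nonneg_on_convex_bodies[OF assms(2,3) k] by unfold_locales auto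
    show "metric_on (convex_bodies_dim CARD('n)) (meet_deviation \<phi>)"
      by (rule strict_volume_valuation.metric_on_meet_deviation[OF \<phi>])
    show "\<forall>K\<in>convex_bodies_dim CARD('n). \<forall>L\<in>convex_bodies_dim CARD('n).
      intrinsic_dist (convex_bodies_dim CARD('n)) (join_deviation \<phi>) K L
        = ereal (meet_deviation \<phi> K L)"
      using that by (intro ballI strict_volume_valuation.intrinsic_dist_join_deviation[OF \<phi>]) auto
  qed
qed

end
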